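(* Let $X(t):=L(\Theta(t))=(L_1(\Theta_1(t)),\dots,L_d(\Theta_d(t)))$, $t\ge0$, be the multivariate subordinated Lévy process. Then $\int_{\mathbb R_+^d}|\mathrm{E}(\chi(L(\theta)))|\,F(d\theta)<\infty$. Define $$\beta=a_0b+\int_{\mathbb R_+^d}\mathrm{E}(\chi(L(\theta)))\,F(d\theta),\qquad \Gamma=a_0Q,$$ $$\mu(A)=\sum_{j=1}^d a_{0,j}\,\nu_j^{\eta_j}(A)+\int_{\mathbb R_+^d}P^{L(\theta)}(A)\,F(d\theta)$$ for any Borel set $A\subseteq H$. Then $(\beta,\Gamma,\mu)$ is the characteristics of $X$.
   Context: Setting. $d\in\mathbb N$; for $j=1,\dots,d$, $(H_j,\langle\cdot|\cdot\rangle_j)$ is a separable (real) Hilbert space and $L_j$ is an $H_j$-valued càdlàg Lévy process with characteristics $(b_j,Q_j,\nu_j)$; $L_1,\dots,L_d$ are independent. The truncation function is $\chi(x)=x1_{\{|x|\le1\}}$. The characteristics of a Hilbert space valued Lévy process $Y$ are the triplet $(b,Q,\nu)$ (drift vector, positive semi-definite trace class covariance operator of the Gaussian part, Lévy measure) in the Lévy–Khintchine representation $\mathrm{E}e^{i\langle u|Y(t)\rangle}=\exp\big(t[i\langle u|b\rangle-\frac12\langle Qu|u\rangle+\int(e^{i\langle u|x\rangle}-1-i\langle u|\chi(x)\rangle)\nu(dx)]\big)$. $H:=H_1\times\dots\times H_d$ with $\langle u|v\rangle=\sum_j\langle u_j|v_j\rangle_j$; $L=(L_1,\dots,L_d)$;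 $L(\theta):=(L_1(\theta_1),\dots,L_d(\theta_d))$ for $\theta\in\mathbb R_+^d$; $P^{L(\theta)}$ is the law of $L(\theta)$. $\eta_j:H_j\to H$ is the natural embedding into the $j$-th coordinate and $\nu_j^{\eta_j}$ is the image of $\nu_j$ under $\eta_j$. $(b,Q,\nu)$ are the characteristics of $L$, so $b=(b_1,\dots,b_d)$ and $Q=Q_1\times\dots\times Q_d$ (acting coordinatewise). For $a\in\mathbb R^d$, $u\in H$: $au:=(a_1u_1,\dots,a_du_d)$; for $a\in\mathbb R_+^d$: $aQ:=a_1Q_1\times\dots\times a_dQ_d$. $\Theta=(\Theta_1,\dots,\Theta_d)$ is an $\mathbb R^d$-valued càdlàg Lévy process such that each $\Theta_j$ is a subordinator (nondecreasing real Lévy process); its Lévy–Khintchine triplet with respect to $\chi$ is $(a,0,F)$, $F$ is concentrated on $\mathbb R_+^d$, and $a_0:=a-\int_{\mathbb R_+^d}\chi(\theta)F(d\theta)\in\mathbb R_+^d$.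
   Formalization: The process Θ is assumed independent of L=(L_1,…,L_d), which the text leaves unsaid and without which the claim fails (e.g. L=Θ a Poisson process); Lévy measures are understood up to their mass at 0, since the formula for μ may charge {0}. *)

theory Defs
  imports "HOL-Probability.Probability"
begin

text \<open>
  The spaces \<open>H\<^sub>1, \<dots>, H\<^sub>d\<close> need not be isometric, so they are modelled as closed linear subspaces of
  one complete separable real inner product space \<open>'h\<close>. This covers every finite family of
  separable Hilbert spaces: embed each of them into their direct sum. The product Hilbert space is
  a closed subspace of \<open>'h ^ 'd\<close>, whose inner product is the sum of the coordinate inner products.
  All notions below are therefore relative to a closed subspace \<open>S\<close>; for a process with values in a
  whole space take \<open>S = UNIV\<close>.
\<close>

text \<open>Needed for Bochner integrals with values in \<open>'h ^ 'd\<close>.\<close>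

instance vec :: ("{metric_space, second_countable_topology}", finite) second_countable_topology
proof
  obtain B :: "'a set set" where B: "countable B" "topological_basis B"
    using ex_countable_basis by auto
  define K :: "('a ^ 'b) set set"
    where "K = (\<lambda>A. {x. \<forall>i. x $ i \<in> A i}) ` (PiE UNIV (\<lambda>_. B))"
  have "countable K"
    unfolding K_def using B(1) by (intro countable_image countable_PiE) auto
  moreover have "topological_basis K"
  proof (rule topological_basisI)
    fix U assume "U \<in> K"
    then show "open U"
      unfolding K_def using topological_basis_open[OF B(2)]
      by (auto intro!: open_vector_box)
  next
    fix U :: "('a ^ 'b) set" and x
    assume "open U" "x \<in> U"
    then obtain A where A: "\<And>i. open (A i)" "\<And>i. x $ i \<in> A i"
        "\<And>y. \<forall>i. y $ i \<in> A i \<Longrightarrow> y \<in> U"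
      unfolding open_vec_def by metis
    have "\<forall>i. \<exists>C\<in>B. x $ i \<in> C \<and> C \<subseteq> A i"
      using topological_basisE[OF B(2) A(1,2)] by metis
    then obtain C where C: "\<And>i. C i \<in> B" "\<And>i. x $ i \<in> C i" "\<And>i. C i \<subseteq> A i"
      by metis
    show "\<exists>V\<in>K. x \<in> V \<and> V \<subseteq> U"
      unfolding K_def using C A(3)
      by (intro bexI[of _ "{x. \<forall>i. x $ i \<in> C i}"]) (auto intro!: A(3) dest: subsetD[OF C(3)])
  qed
  ultimately show "\<exists>B::('a ^ 'b) set set. countable B \<and> open = generate_topology B"
    using topological_basis_imp_subbasis by blast
qed

definition trunc :: "'a::real_normed_vector \<Rightarrow> 'a" where
  "trunc x = (if norm x \<le> 1 then x else 0)"

definition nonneg_orthant :: "(real ^ 'd) set" where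
  "nonneg_orthant = {\<theta>. \<forall>j. 0 \<le> \<theta> $ j}"

definition prod_space :: "('d \<Rightarrow> 'h set) \<Rightarrow> ('h ^ 'd) set" where
  "prod_space H = {u. \<forall>j. u $ j \<in> H j}"

text \<open>Processes are functions \<open>X t \<omega>\<close> of which only the values at times \<open>t \<ge> 0\<close> matter.\<close>

definition cadlag :: "(real \<Rightarrow> 'a::topological_space) \<Rightarrow> bool" where
  "cadlag f \<longleftrightarrow>
     (\<forall>t\<ge>0. (f \<longlongrightarrow> f t) (at_right t)) \<and> (\<forall>t>0. \<exists>l. (f \<longlongrightarrow> l) (at_left t))"

definition levy_process ::
  "'w measure \<Rightarrow> 'a::{real_inner, banach, second_countable_topology} set
     \<Rightarrow> (real \<Rightarrow> 'w \<Rightarrow> 'a) \<Rightarrow> bool" where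
  "levy_process M S X \<longleftrightarrow>
     (\<forall>t\<ge>0. X t \<in> borel_measurable M \<and> (\<forall>\<omega>\<in>space M. X t \<omega> \<in> S)) \<and>
     (AE \<omega> in M. X 0 \<omega> = 0) \<and>
     (\<forall>n (t :: nat \<Rightarrow> real). 0 \<le> t 0 \<longrightarrow> mono_on {..n} t \<longrightarrow>
        prob_space.indep_vars M (\<lambda>_. borel) (\<lambda>i \<omega>. X (t (Suc i)) \<omega> - X (t i) \<omega>) {..<n}) \<and>
     (\<forall>s t. 0 \<le> s \<longrightarrow> s \<le> t \<longrightarrow>
        distr M borel (\<lambda>\<omega>. X t \<omega> - X s \<omega>) = distr M borel (X (t - s))) \<and>
     (\<forall>t\<ge>0. \<forall>\<epsilon>>0.
        ((\<lambda>s. measure M {\<omega> \<in> space M. \<epsilon> < norm (X s \<omega> - X t \<omega>)}) \<longlongrightarrow> 0) (at t within {0..})) \<and>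
     (\<forall>\<omega>\<in>space M. cadlag (\<lambda>t. X t \<omega>))"

text \<open>Nonnegativity is required at every outcome (and not only almost surely), so that
  \<open>L\<^sub>j(\<Theta>\<^sub>j(t))\<close> is defined at every outcome.\<close>

definition subordinator :: "'w measure \<Rightarrow> (real \<Rightarrow> 'w \<Rightarrow> real) \<Rightarrow> bool" where
  "subordinator M Z \<longleftrightarrow> levy_process M UNIV Z \<and>
     (\<forall>\<omega>\<in>space M. mono_on {0..} (\<lambda>t. Z t \<omega>) \<and> (\<forall>t\<ge>0. 0 \<le> Z t \<omega>))"

definition orthonormal_basis_on :: "'a::real_inner set \<Rightarrow> 'a set \<Rightarrow> bool" where
  "orthonormal_basis_on S B \<longleftrightarrow>
     B \<subseteq> S \<and> pairwise orthogonal B \<and> (\<forall>e\<in>B. norm e = 1) \<and> closure (span B) = S"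

text \<open>Positive semi-definite trace class operators \<open>S \<rightarrow> S\<close>; as \<open>|Q| = Q\<close>, the trace class condition
  is the summability of \<open>\<langle>Q e|e\<rangle>\<close> over an orthonormal basis.\<close>

definition covariance_operator :: "'a::real_inner set \<Rightarrow> ('a \<Rightarrow> 'a) \<Rightarrow> bool" where
  "covariance_operator S Q \<longleftrightarrow>
     (\<forall>x\<in>S. Q x \<in> S) \<and>
     (\<forall>x\<in>S. \<forall>y\<in>S. Q (x + y) = Q x + Q y) \<and>
     (\<forall>c. \<forall>x\<in>S. Q (c *\<^sub>R x) = c *\<^sub>R Q x) \<and>
     (\<exists>K. \<forall>x\<in>S. norm (Q x) \<le> K * norm x) \<and>
     (\<forall>x\<in>S. \<forall>y\<in>S. Q x \<bullet> y = x \<bullet> Q y) \<and>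
     (\<forall>x\<in>S. 0 \<le> Q x \<bullet> x) \<and>
     (\<exists>B. orthonormal_basis_on S B \<and> (\<lambda>e. Q e \<bullet> e) summable_on B)"

text \<open>Every integrand in which a Levy measure occurs vanishes at \<open>0\<close>, so the mass of \<open>{0}\<close> is
  immaterial and is not normalised to be \<open>0\<close>: the measure of a subordinated process, defined on all
  Borel sets by \<open>A \<mapsto> \<Sum>\<^sub>j a\<^sub>0\<^sub>j \<nu>\<^sub>j(\<eta>\<^sub>j\<^sup>-\<^sup>1 A) + \<integral> P(L(\<theta>) \<in> A) F(d\<theta>)\<close>, may charge \<open>{0}\<close>, even with infinite mass
  (for instance if \<open>L\<close> is a Poisson process and \<open>F\<close> is infinite).
  See \<open>levy_characteristics_off_0\<close> below.\<close>

definition levy_measure :: "'a::real_inner set \<Rightarrow> 'a measure \<Rightarrow> bool" where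
  "levy_measure S \<nu> \<longleftrightarrow> sets \<nu> = sets borel \<and> (AE x in \<nu>. x \<in> S) \<and>
     (\<integral>\<^sup>+ x. ennreal (min 1 ((norm x)\<^sup>2)) \<partial>\<nu>) < \<infinity>"

definition levy_characteristics ::
  "'w measure \<Rightarrow> 'a::{real_inner, banach, second_countable_topology} set
     \<Rightarrow> (real \<Rightarrow> 'w \<Rightarrow> 'a) \<Rightarrow> 'a \<Rightarrow> ('a \<Rightarrow> 'a) \<Rightarrow> 'a measure \<Rightarrow> bool" where
  "levy_characteristics M S Y b Q \<nu> \<longleftrightarrow>
     levy_process M S Y \<and> b \<in> S \<and> covariance_operator S Q \<and> levy_measure S \<nu> \<and>
     (\<forall>t\<ge>0. \<forall>u\<in>S.
        (CLINT \<omega>|M. iexp (u \<bullet> Y t \<omega>)) =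
        exp (complex_of_real t *
          (\<i> * complex_of_real (u \<bullet> b) - complex_of_real (Q u \<bullet> u) / 2
           + (CLINT x|\<nu>. iexp (u \<bullet> x) - 1 - \<i> * complex_of_real (u \<bullet> trunc x)))))"

lemma levy_characteristics_off_0:
  assumes "sets \<nu> = sets borel" and "0 \<in> S"
  shows "levy_characteristics M S Y b Q \<nu> \<longleftrightarrow>
    levy_characteristics M S Y b Q (density \<nu> (indicator (- {0})))"
proof -
  have [measurable_cong]: "sets \<nu> = sets borel" by (fact assms(1))
  have sp: "space \<nu> = UNIV" using sets_eq_imp_space_eq[OF assms(1)] by simp
  have [measurable]: "(trunc :: 'a \<Rightarrow> 'a) \<in> borel_measurable borel"
    unfolding trunc_def[abs_def] by measurable
  have AE: "(AE x in density \<nu> (indicator (- {0})). x \<in> S) \<longleftrightarrow> (AE x in \<nu>. x \<in> S)"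
    using assms(2) by (subst AE_density) (auto simp: indicator_def intro!: AE_cong)
  have nn: "(\<integral>\<^sup>+ x. ennreal (min 1 ((norm x)\<^sup>2)) \<partial>density \<nu> (indicator (- {0}))) =
      (\<integral>\<^sup>+ x. ennreal (min 1 ((norm x)\<^sup>2)) \<partial>\<nu>)"
    by (subst nn_integral_density) (auto simp: indicator_def intro!: nn_integral_cong)
  have "density \<nu> (indicator (- {0})) = density \<nu> (\<lambda>x. ennreal (indicator (- {0}) x))"
    by (intro density_cong) (auto simp: indicator_def)
  then have int: "(CLINT x|density \<nu> (indicator (- {0})). iexp (u \<bullet> x) - 1 - \<i> * complex_of_real (u \<bullet> trunc x)) =
      (CLINT x|\<nu>. iexp (u \<bullet> x) - 1 - \<i> * complex_of_real (u \<bullet> trunc x))" for u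
    by (simp only:, subst integral_density)
       (auto simp: indicator_def trunc_def intro!: Bochner_Integration.integral_cong)
  show ?thesis
    using AE nn int assms unfolding levy_characteristics_def levy_measure_def by auto
qed

text \<open>The multiparameter process \<open>L(\<theta>) = (L\<^sub>1(\<theta>\<^sub>1), \<dots>, L\<^sub>d(\<theta>\<^sub>d))\<close>.\<close>

definition multi_time ::
  "('d::finite \<Rightarrow> real \<Rightarrow> 'w \<Rightarrow> 'h) \<Rightarrow> real ^ 'd \<Rightarrow> 'w \<Rightarrow> 'h ^ 'd" where
  "multi_time L \<theta> \<omega> = (\<chi> j. L j (\<theta> $ j) \<omega>)"

text \<open>The sigma-algebra generated by a process \<open>(X t)\<close>, \<open>t \<ge> 0\<close>, as the one generated by its path.\<close>

definition process_sigma :: "'w measure \<Rightarrow> (real \<Rightarrow> 'w \<Rightarrow> 'a::topological_space) \<Rightarrow> 'w set set" where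
  "process_sigma M X =
     sets (vimage_algebra (space M) (\<lambda>\<omega>. \<lambda>t\<in>{0..}. X t \<omega>) (PiM {0..} (\<lambda>_. borel)))"

end

theory Submission
  imports Defs "HOL-Complex_Analysis.Conformal_Mappings"
begin

text \<open>
  Write \<open>\<psi>\<^sub>j\<close> for the exponent of \<open>L\<^sub>j\<close>, so that \<open>E e\<^bsup>i\<langle>u|L(\<theta>)\<rangle>\<^esup> = exp (\<Sum>\<^sub>j \<theta>\<^sub>j \<psi>\<^sub>j(u\<^sub>j))\<close> for fixed \<open>\<theta>\<close> in the
  orthant. As \<open>L\<close> and \<open>\<Theta>\<close> are independent, the random time may be frozen, and
  \<open>E e\<^bsup>i\<langle>u|X(t)\<rangle>\<^esup> = E exp (\<Sum>\<^sub>j \<Theta>\<^sub>j(t) \<psi>\<^sub>j(u\<^sub>j))\<close> is the Laplace transform of \<open>\<Theta>(t)\<close> at a point with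
  nonpositive real parts. Its Levy--Khintchine formula, known at imaginary arguments, extends to
  these points by analytic continuation, and gives the exponent
  \<open>\<Sum>\<^sub>j a\<^sub>0\<^sub>j \<psi>\<^sub>j(u\<^sub>j) + \<integral> (E e\<^bsup>i\<langle>u|L(\<theta>)\<rangle>\<^esup> - 1) F(d\<theta>)\<close>. Adding and subtracting \<open>i \<langle>u|E \<chi>(L(\<theta>))\<rangle>\<close> inside the integral
  turns this into the exponent of the triplet \<open>(\<beta>, \<Gamma>, \<mu>)\<close>. This is \<open>exponent_X\<close> and \<open>char_X\<close>.

  The separation of the two terms needs \<open>\<integral> |E \<chi>(L(\<theta>))| F(d\<theta>) < \<infinity>\<close> and \<open>\<integral> min 1 |x|\<^sup>2 \<mu>(dx) < \<infinity>\<close>. As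
  \<open>min 1 |\<theta>|\<close> is \<open>F\<close>-integrable, both follow from \<open>E min 1 |L(\<theta>)|\<^sup>2 \<le> K min 1 |\<theta>|\<close> and
  \<open>|E \<chi>(L(\<theta>))| \<le> C min 1 |\<theta>|\<close>. Instead of a decomposition of the paths, the first estimate uses
  characteristic functions alone: averaging \<open>1 - e\<^bsup>i\<langle>u|x\<rangle>\<^esup>\<close> over a standard Gaussian \<open>u\<close> in a
  finite-dimensional subspace gives \<open>1 - exp (- |Px|\<^sup>2 / 2)\<close>, with \<open>P\<close> the orthogonal projection. The
  bound \<open>|1 - e\<^bsup>t\<psi>(u)\<^esup>| \<le> t |\<psi>(u)|\<close> makes the average of order \<open>t\<close>, uniformly in the subspace because
  \<open>|\<psi>|\<close> is dominated by a constant plus a quadratic form of finite trace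
  (\<open>levy_small_time_estimate\<close>). The second estimate follows from the first by testing
  \<open>E \<chi>(L(\<theta>))\<close> against its own direction (\<open>drift_bound\<close>).

  That \<open>X\<close> is a Levy process also comes from freezing the time: given the path of \<open>\<Theta>\<close>, the
  increments of \<open>X\<close> are independent, and the law of each depends only on the corresponding increment
  of \<open>\<Theta>\<close> (\<open>X_increments_joint_law\<close>). The increments of \<open>\<Theta>\<close> are themselves independent and
  stationary.
\<close>

section \<open>Orthonormal expansions\<close>

lemma norm_integral_le_integral:
  fixes f :: "'a \<Rightarrow> 'b::{banach, second_countable_topology}"
  assumes "integrable M f" "integrable M g" "\<And>x. x \<in> space M \<Longrightarrow> norm (f x) \<le> g x"
  shows "norm (integral\<^sup>L M f) \<le> integral\<^sup>L M g"
proof -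
  have "norm (integral\<^sup>L M f) \<le> (LINT x|M. norm (f x))" by (rule integral_norm_bound)
  also have "\<dots> \<le> integral\<^sup>L M g" using assms by (intro integral_mono) auto
  finally show ?thesis .
qed

lemma orthonormal_projection_pythagoras:
  fixes x :: "'a::real_inner"
  assumes "finite T" "pairwise orthogonal T" "\<forall>e\<in>T. norm e = 1"
  defines "p \<equiv> \<Sum>e\<in>T. (e \<bullet> x) *\<^sub>R e"
  shows "y \<in> span T \<Longrightarrow> y \<bullet> (x - p) = 0"
    and "(norm x)\<^sup>2 = (\<Sum>e\<in>T. (e \<bullet> x)\<^sup>2) + (norm (x - p))\<^sup>2"
proof -
  have ee: "e \<bullet> f = (if e = f then 1 else 0)" if "e \<in> T" "f \<in> T" for e f
    using that assms(2,3) by (auto simp: pairwise_def orthogonal_def dot_square_norm)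
  have ep: "e \<bullet> p = e \<bullet> x" if "e \<in> T" for e
  proof -
    have "e \<bullet> p = (\<Sum>f\<in>T. if e = f then f \<bullet> x else 0)"
      unfolding p_def inner_sum_right using that by (intro sum.cong) (auto simp: ee)
    then show ?thesis using that assms(1) by simp
  qed
  show orth: "y \<in> span T \<Longrightarrow> y \<bullet> (x - p) = 0" for y
  proof (induction rule: span_induct)
    case base
    show ?case by (auto simp: subspace_def inner_add_left)
  next
    case (step e)
    then show ?case by (simp add: inner_diff_right ep)
  qed
  have "p \<in> span T" unfolding p_def by (intro span_sum span_scale span_base)
  then have "p \<bullet> (x - p) = 0" by (rule orth)
  then have "(norm (p + (x - p)))\<^sup>2 = (norm p)\<^sup>2 + (norm (x - p))\<^sup>2"
    by (simp only: power2_norm_eq_inner inner_add_left inner_add_right inner_commute)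
  moreover have "(norm p)\<^sup>2 = (\<Sum>e\<in>T. (e \<bullet> x)\<^sup>2)"
  proof -
    have "(norm p)\<^sup>2 = (\<Sum>e\<in>T. (e \<bullet> x) * (e \<bullet> p))"
      unfolding power2_norm_eq_inner by (subst (1) p_def) (simp add: inner_sum_left)
    then show ?thesis by (simp add: ep power2_eq_square)
  qed
  ultimately show "(norm x)\<^sup>2 = (\<Sum>e\<in>T. (e \<bullet> x)\<^sup>2) + (norm (x - p))\<^sup>2" by simp
qed

lemma bessel_inequality:
  fixes x :: "'a::real_inner"
  assumes "finite T" "pairwise orthogonal T" "\<forall>e\<in>T. norm e = 1"
  shows "(\<Sum>e\<in>T. (e \<bullet> x)\<^sup>2) \<le> (norm x)\<^sup>2"
  using orthonormal_projection_pythagoras(2)[OF assms, of x] by simp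

text \<open>Two orthonormal vectors have distance \<open>\<surd>2\<close>, so points of a countable dense set within distance
\<open>1/2\<close> of them are different.\<close>

lemma countable_orthonormal:
  fixes B :: "'a::{real_inner, second_countable_topology} set"
  assumes "pairwise orthogonal B" "\<forall>e\<in>B. norm e = 1"
  shows "countable B"
proof -
  have far: "1 < dist e f" if "e \<in> B" "f \<in> B" "e \<noteq> f" for e f
  proof -
    have "(norm (e - f))\<^sup>2 = 2"
    proof -
      have "e \<bullet> f = 0" "e \<bullet> e = 1" "f \<bullet> f = 1"
        using that assms by (auto simp: pairwise_def orthogonal_def norm_eq_1)
      then show ?thesis
        unfolding power2_norm_eq_inner inner_diff_left inner_diff_right inner_commute[of f e] by simp
    qed
    then have "1\<^sup>2 < (norm (e - f))\<^sup>2" by simp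
    then show ?thesis unfolding dist_norm by (rule power2_less_imp_less) simp
  qed
  obtain D :: "'a set" where D: "countable D" "\<And>X. open X \<Longrightarrow> X \<noteq> {} \<Longrightarrow> \<exists>d\<in>D. d \<in> X"
    using countable_dense_setE by blast
  have "\<exists>d\<in>D. dist e d < 1 / 2" for e
    using D(2)[of "ball e (1 / 2)"] by (auto simp: dist_commute)
  then obtain g where g: "\<And>e. g e \<in> D" "\<And>e. dist e (g e) < 1 / 2" by metis
  have "inj_on g B"
  proof (rule inj_onI, rule ccontr)
    fix e f assume ef: "e \<in> B" "f \<in> B" "g e = g f" "e \<noteq> f"
    have "dist e f \<le> dist e (g e) + dist f (g f)"
      unfolding ef(3) by (rule dist_triangle2)
    with g(2)[of e] g(2)[of f] far[OF ef(1,2,4)] show False by simp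
  qed
  then show ?thesis using D(1) g(1) by (metis countable_image_inj_on countable_subset image_subsetI)
qed

text \<open>Second countability makes the basis countable, so a single sequence of finite subsets serves
every vector; this is what dominated convergence needs later.\<close>

lemma parseval_limit:
  fixes B :: "'a::{real_inner, second_countable_topology} set"
  assumes B: "pairwise orthogonal B" "\<forall>e\<in>B. norm e = 1"
  obtains T :: "nat \<Rightarrow> 'a set" where "\<And>n. finite (T n)" "\<And>n. T n \<subseteq> B"
    "\<And>x. x \<in> closure (span B) \<Longrightarrow> (\<lambda>n. \<Sum>e\<in>T n. (e \<bullet> x)\<^sup>2) \<longlonglongrightarrow> (norm x)\<^sup>2"
proof -
  have cB: "countable B" by (rule countable_orthonormal[OF B])
  \<comment> \<open>An enumeration by index rather than by image, so that finite and empty bases need no special treatment.\<close>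
  define T where "T n = {e \<in> B. to_nat_on B e < n}" for n
  have fin: "finite (T n)" for n
  proof (rule inj_on_finite[of "to_nat_on B"])
    show "inj_on (to_nat_on B) (T n)"
      using inj_on_to_nat_on[OF cB] by (rule inj_on_subset) (auto simp: T_def)
    show "to_nat_on B ` T n \<subseteq> {..<n}" by (auto simp: T_def)
  qed simp
  have sub: "T n \<subseteq> B" for n by (auto simp: T_def)
  have mono: "T m \<subseteq> T n" if "m \<le> n" for m n using that by (auto simp: T_def)
  have orth: "pairwise orthogonal (T n)" "\<forall>e\<in>T n. norm e = 1" for n
    using B sub[of n] pairwise_mono by (blast, blast)
  have "(\<lambda>n. \<Sum>e\<in>T n. (e \<bullet> x)\<^sup>2) \<longlonglongrightarrow> (norm x)\<^sup>2" if x: "x \<in> closure (span B)" for x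
  proof (rule LIMSEQ_I)
    fix r :: real assume "0 < r"
    then have "0 < sqrt r" by simp
    then obtain y where y: "y \<in> span B" "dist y x < sqrt r"
      using x unfolding closure_approachable by blast
    obtain R c where R: "finite R" "R \<subseteq> B" "y = (\<Sum>e\<in>R. c e *\<^sub>R e)"
      using y(1) unfolding span_explicit by blast
    define N where "N = Suc (Max (insert 0 (to_nat_on B ` R)))"
    have RN: "R \<subseteq> T N"
      using R(1,2) by (auto simp: T_def N_def less_Suc_eq_le intro!: Max_ge)
    show "\<exists>N. \<forall>n\<ge>N. norm ((\<Sum>e\<in>T n. (e \<bullet> x)\<^sup>2) - (norm x)\<^sup>2) < r"
    proof (intro exI allI impI)
      fix n assume "N \<le> n"
      let ?p = "\<Sum>e\<in>T n. (e \<bullet> x) *\<^sub>R e"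
      note P = orthonormal_projection_pythagoras[OF fin[of n] orth(1)[of n] orth(2)[of n], where x = x]
      have "y \<in> span (T n)"
        unfolding R(3) using RN mono[OF \<open>N \<le> n\<close>]
        by (intro span_sum span_scale span_base) blast
      moreover have "?p \<in> span (T n)" by (intro span_sum span_scale span_base)
      ultimately have "(y - ?p) \<bullet> (x - ?p) = 0" by (intro P(1) span_diff)
      then have "(norm ((x - ?p) - (y - ?p)))\<^sup>2 = (norm (x - ?p))\<^sup>2 + (norm (y - ?p))\<^sup>2"
        unfolding power2_norm_eq_inner inner_diff_left[of "x - ?p" "y - ?p"]
          inner_diff_right[of _ "x - ?p" "y - ?p"] inner_commute[of "x - ?p" "y - ?p"] by simp
      then have "(norm (x - y))\<^sup>2 = (norm (x - ?p))\<^sup>2 + (norm (y - ?p))\<^sup>2" by simp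
      then have "(norm (x - ?p))\<^sup>2 \<le> (norm (x - y))\<^sup>2" by simp
      also have "\<dots> < (sqrt r)\<^sup>2"
        using y(2) by (intro power_strict_mono) (auto simp: dist_norm norm_minus_commute)
      also have "\<dots> = r" using \<open>0 < r\<close> by simp
      finally show "norm ((\<Sum>e\<in>T n. (e \<bullet> x)\<^sup>2) - (norm x)\<^sup>2) < r"
        using P(2) by simp
    qed
  qed
  with fin sub that show thesis by blast
qed

text \<open>Projecting \<open>f\<close> onto the span of finitely many basis vectors moves the integral into that span, and
the projections converge to \<open>f\<close>, dominated by a multiple of \<open>|f|\<close>.\<close>

lemma integral_in_closed_subspace:
  fixes f :: "'b \<Rightarrow> 'a::{real_inner, banach, second_countable_topology}"
  assumes S: "subspace S" and B: "orthonormal_basis_on S B"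
    and f: "integrable N f" and fS: "AE x in N. f x \<in> S"
  shows "integral\<^sup>L N f \<in> S"
proof -
  have BS: "B \<subseteq> S" and orth: "pairwise orthogonal B" "\<forall>e\<in>B. norm e = 1" and S_eq: "closure (span B) = S"
    using B by (auto simp: orthonormal_basis_on_def)
  obtain T where T: "\<And>n. finite (T n)" "\<And>n. T n \<subseteq> B"
    "\<And>x. x \<in> closure (span B) \<Longrightarrow> (\<lambda>n. \<Sum>e\<in>T n. (e \<bullet> x)\<^sup>2) \<longlonglongrightarrow> (norm x)\<^sup>2"
    using parseval_limit[OF orth] by metis
  define p where "p n x = (\<Sum>e\<in>T n. (e \<bullet> x) *\<^sub>R e)" for n x
  have pyth: "(norm x)\<^sup>2 = (\<Sum>e\<in>T n. (e \<bullet> x)\<^sup>2) + (norm (x - p n x))\<^sup>2" for n x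
    unfolding p_def using orth T(2)[of n] pairwise_mono
    by (intro orthonormal_projection_pythagoras(2) T(1)) blast+
  have p_lim: "(\<lambda>n. p n x) \<longlonglongrightarrow> x" if "x \<in> S" for x
  proof -
    have "(\<lambda>n. (norm x)\<^sup>2 - (\<Sum>e\<in>T n. (e \<bullet> x)\<^sup>2)) \<longlonglongrightarrow> (norm x)\<^sup>2 - (norm x)\<^sup>2"
      using T(3) that S_eq by (intro tendsto_diff tendsto_const) auto
    moreover have "(norm x)\<^sup>2 - (\<Sum>e\<in>T n. (e \<bullet> x)\<^sup>2) = (norm (x - p n x))\<^sup>2" for n
      using pyth[of x n] by simp
    ultimately have "(\<lambda>n. (norm (x - p n x))\<^sup>2) \<longlonglongrightarrow> 0" by simp
    then have "(\<lambda>n. sqrt ((norm (x - p n x))\<^sup>2)) \<longlonglongrightarrow> sqrt 0" by (rule tendsto_real_sqrt)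
    then have "(\<lambda>n. norm (p n x - x)) \<longlonglongrightarrow> 0" by (simp add: norm_minus_commute)
    then show ?thesis by (simp add: LIM_zero_iff tendsto_norm_zero_iff)
  qed
  have p_le: "norm (p n x) \<le> 2 * norm x" for n x
  proof -
    have "(norm (x - p n x))\<^sup>2 \<le> (norm x)\<^sup>2" using pyth[of x n] by (simp add: sum_nonneg)
    then have "norm (x - p n x) \<le> norm x" by (rule power2_le_imp_le) simp
    then show ?thesis using norm_triangle_ineq4[of x "x - p n x"] by simp
  qed
  have p_int: "integral\<^sup>L N (\<lambda>x. p n (f x)) = (\<Sum>e\<in>T n. (LINT x|N. e \<bullet> f x) *\<^sub>R e)" for n
    unfolding p_def using f by (subst Bochner_Integration.integral_sum) auto
  have "(\<lambda>n. integral\<^sup>L N (\<lambda>x. p n (f x))) \<longlonglongrightarrow> integral\<^sup>L N f"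
  proof (rule integral_dominated_convergence[where w = "\<lambda>x. 2 * norm (f x)"])
    show "AE x in N. (\<lambda>n. p n (f x)) \<longlonglongrightarrow> f x" using fS by eventually_elim (rule p_lim)
    show "AE x in N. norm (p n (f x)) \<le> 2 * norm (f x)" for n using p_le by simp
    show "(\<lambda>x. p n (f x)) \<in> borel_measurable N" for n
      using f unfolding p_def by (intro borel_measurable_sum) auto
  qed (use f in auto)
  moreover have "integral\<^sup>L N (\<lambda>x. p n (f x)) \<in> S" for n
    unfolding p_int using T(2)[of n] BS by (intro subspace_sum[OF S] subspace_scale[OF S]) auto
  moreover have "closed S" using S_eq closed_closure by metis
  ultimately show ?thesis by (metis closed_sequentially)
qed

section \<open>Averaging over Gaussian directions\<close>

abbreviation std_gaussian_on :: "'a set \<Rightarrow> ('a \<Rightarrow> real) measure" where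
  "std_gaussian_on T \<equiv> PiM T (\<lambda>_. std_normal_distribution)"

interpretation std_normal: real_distribution std_normal_distribution
  by (rule real_dist_normal_dist)

interpretation std_gaussian: product_prob_space "\<lambda>_. std_normal_distribution" T for T :: "'a set"
  by unfold_locales

lemma std_gaussian_char:
  fixes x :: "'a \<Rightarrow> real"
  assumes "finite T"
  shows "(CLINT z|std_gaussian_on T. iexp (\<Sum>e\<in>T. z e * x e)) =
    of_real (exp (- (\<Sum>e\<in>T. (x e)\<^sup>2) / 2))"
proof -
  have int: "integrable std_normal_distribution (\<lambda>s. iexp (x e * s))" for e
    by (rule std_normal.integrable_const_bound[where B = 1]) auto
  have one: "(CLINT s|std_normal_distribution. iexp (x e * s)) = of_real (exp (- ((x e)\<^sup>2) / 2))" for e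
    using char_std_normal_distribution by (simp add: char_def fun_eq_iff)
  have "(CLINT z|std_gaussian_on T. iexp (\<Sum>e\<in>T. z e * x e)) =
      (CLINT z|std_gaussian_on T. (\<Prod>e\<in>T. iexp (x e * z e)))"
    using assms by (intro Bochner_Integration.integral_cong)
      (simp_all add: exp_sum[symmetric] sum_distrib_left mult.commute)
  also have "\<dots> = (\<Prod>e\<in>T. of_real (exp (- ((x e)\<^sup>2) / 2)))"
    unfolding std_gaussian.product_integral_prod[OF assms int] by (intro prod.cong refl one)
  also have "\<dots> = of_real (exp (- (\<Sum>e\<in>T. (x e)\<^sup>2) / 2))"
    using assms by (simp add: exp_sum[symmetric] sum_negf sum_divide_distrib flip: of_real_prod)
  finally show ?thesis .
qed

lemma std_gaussian_product_moment:
  assumes "finite T" "e \<in> T" "f \<in> T"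
  shows "integrable (std_gaussian_on T) (\<lambda>z. z e * z f)"
    and "(LINT z|std_gaussian_on T. z e * z f) = (if e = f then 1 else 0)"
proof -
  \<comment> \<open>The product of two coordinates as a product over all of \<open>T\<close>, with an extra factor \<open>s\<close> when \<open>e = f\<close>.\<close>
  define h :: "'a \<Rightarrow> real \<Rightarrow> real"
    where "h g s = (if g = e then s else 1) * (if g = f then s else 1)" for g s
  have m: "integrable std_normal_distribution (\<lambda>s. s ^ k)" for k :: nat
    by (rule integrable_std_normal_distribution_moment)
  have h_eq: "h g = (\<lambda>s. s ^ ((if g = e then 1 else 0) + (if g = f then 1 else 0)))" for g
    by (auto simp: h_def fun_eq_iff power2_eq_square[symmetric] numeral_2_eq_2)
  have int: "integrable std_normal_distribution (h g)" for g
    unfolding h_eq by (rule m)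
  have prod: "z e * z f = (\<Prod>g\<in>T. h g (z g))" for z :: "'a \<Rightarrow> real"
    using assms unfolding h_def by (simp add: prod.distrib)
  show "integrable (std_gaussian_on T) (\<lambda>z. z e * z f)"
    unfolding prod by (rule std_gaussian.product_integrable_prod[OF assms(1) int])
  have I: "(LINT z|std_gaussian_on T. z e * z f) = (\<Prod>g\<in>T. integral\<^sup>L std_normal_distribution (h g))"
    unfolding prod by (rule std_gaussian.product_integral_prod[OF assms(1) int])
  have one: "integral\<^sup>L std_normal_distribution (\<lambda>s. s) = 0"
    using integral_std_normal_distribution_moment_odd[of 1] by simp
  have two: "integral\<^sup>L std_normal_distribution (\<lambda>s. s * s) = 1"
    using std_normal_distribution_even_moments(1)[of 1] by (simp add: power2_eq_square)
  have hI: "integral\<^sup>L std_normal_distribution (h g) = 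
     (if g = e \<and> g = f then 1 else if g = e \<or> g = f then 0 else 1)" for g
    using std_normal.prob_space by (auto simp: h_def[abs_def] one two)
  show "(LINT z|std_gaussian_on T. z e * z f) = (if e = f then 1 else 0)"
  proof (cases "e = f")
    case True
    then show ?thesis unfolding I hI by (auto intro!: prod.neutral)
  next
    case False
    then show ?thesis unfolding I hI using assms by (auto intro!: prod_zero)
  qed
qed

text \<open>Distinct coordinates are uncorrelated with unit variances, so only the diagonal terms
contribute.\<close>

lemma std_gaussian_quadratic_form:
  assumes "finite T"
  shows "integrable (std_gaussian_on T) (\<lambda>z. \<Sum>e\<in>T. \<Sum>f\<in>T. z e * z f * B e f)"
    and "(LINT z|std_gaussian_on T. (\<Sum>e\<in>T. \<Sum>f\<in>T. z e * z f * B e f)) = (\<Sum>e\<in>T. B e e)"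
proof -
  show "integrable (std_gaussian_on T) (\<lambda>z. \<Sum>e\<in>T. \<Sum>f\<in>T. z e * z f * B e f)"
    using assms by (intro Bochner_Integration.integrable_sum integrable_mult_left
        std_gaussian_product_moment(1))
  have "(LINT z|std_gaussian_on T. (\<Sum>e\<in>T. \<Sum>f\<in>T. z e * z f * B e f)) =
      (\<Sum>e\<in>T. \<Sum>f\<in>T. (LINT z|std_gaussian_on T. z e * z f) * B e f)"
    using assms
    by (simp add: Bochner_Integration.integral_sum Bochner_Integration.integrable_sum
        integrable_mult_left std_gaussian_product_moment(1))
  also have "\<dots> = (\<Sum>e\<in>T. \<Sum>f\<in>T. if e = f then B e f else 0)"
    using assms by (intro sum.cong refl) (simp add: std_gaussian_product_moment(2))
  also have "\<dots> = (\<Sum>e\<in>T. B e e)"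
    using assms by (simp add: sum.delta)
  finally show "(LINT z|std_gaussian_on T. (\<Sum>e\<in>T. \<Sum>f\<in>T. z e * z f * B e f)) = (\<Sum>e\<in>T. B e e)" .
qed

text \<open>Fubini's theorem for \<open>e\<^bsup>i\<langle>G|Y\<rangle>\<^esup>\<close> with a standard Gaussian \<open>G\<close> in the span of \<open>T\<close>: integrating out \<open>G\<close>
first gives the left-hand side, integrating out \<open>Y\<close> first gives the average of \<open>1 - E e\<^bsup>i\<langle>u|Y\<rangle>\<^esup>\<close>.
A quadratic bound is enough, because the average of a quadratic form is its trace.\<close>

lemma (in prob_space) gaussian_averaging:
  fixes Y :: "'a \<Rightarrow> 'b::{real_inner, second_countable_topology}"
  assumes [measurable]: "Y \<in> borel_measurable M" and T: "finite T"
    and bound: "\<And>z. cmod (1 - (CLINT \<omega>|M. iexp ((\<Sum>e\<in>T. z e *\<^sub>R e) \<bullet> Y \<omega>)))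
      \<le> C + (\<Sum>e\<in>T. \<Sum>f\<in>T. z e * z f * B e f)"
  shows "(LINT \<omega>|M. 1 - exp (- (\<Sum>e\<in>T. (e \<bullet> Y \<omega>)\<^sup>2) / 2)) \<le> C + (\<Sum>e\<in>T. B e e)"
proof -
  let ?G = "std_gaussian_on T"
  interpret PP: pair_prob_space M ?G by unfold_locales
  define k where "k \<omega> z = iexp (\<Sum>e\<in>T. z e * (e \<bullet> Y \<omega>))" for \<omega> and z :: "'b \<Rightarrow> real"
  have [measurable]: "case_prod k \<in> borel_measurable (M \<Otimes>\<^sub>M ?G)"
    unfolding k_def by measurable
  have k1: "cmod (k \<omega> z) = 1" for \<omega> z by (simp add: k_def)
  have k_int: "integrable (M \<Otimes>\<^sub>M ?G) (case_prod k)"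
    by (rule PP.P.integrable_const_bound[where B = 1]) (auto simp: k1)
  have k_intM: "integrable M (\<lambda>\<omega>. k \<omega> z)" if "z \<in> space ?G" for z
    using that by (intro integrable_const_bound[where B = 1]) (auto simp: k1 measurable_compose_Pair1)
  have swap: "(CLINT z|?G. CLINT \<omega>|M. k \<omega> z) = (CLINT \<omega>|M. CLINT z|?G. k \<omega> z)"
    by (rule PP.Fubini_integral[OF k_int])
  have inner: "(CLINT z|?G. k \<omega> z) = of_real (exp (- (\<Sum>e\<in>T. (e \<bullet> Y \<omega>)\<^sup>2) / 2))" for \<omega>
    unfolding k_def by (rule std_gaussian_char[OF T])
  have ex_int: "integrable M (\<lambda>\<omega>. exp (- (\<Sum>e\<in>T. (e \<bullet> Y \<omega>)\<^sup>2) / 2))"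
    by (rule integrable_const_bound[where B = 1]) (auto intro!: sum_nonneg)
  have G_int: "integrable ?G (\<lambda>z. CLINT \<omega>|M. k \<omega> z)"
    by (rule PP.integrable_snd[OF k_int])
  define I where "I = (LINT \<omega>|M. 1 - exp (- (\<Sum>e\<in>T. (e \<bullet> Y \<omega>)\<^sup>2) / 2))"
  have pG: "measure ?G (space ?G) = 1" by (intro prob_space.prob_space prob_space_PiM std_normal.prob_space_axioms)
  have "of_real I = (CLINT z|?G. 1 - (CLINT \<omega>|M. k \<omega> z))"
    using ex_int G_int swap pG prob_space
    by (simp add: I_def inner)
  also have "cmod \<dots> \<le> (LINT z|?G. C + (\<Sum>e\<in>T. \<Sum>f\<in>T. z e * z f * B e f))"
  proof (rule norm_integral_le_integral)
    show "integrable ?G (\<lambda>z. 1 - (CLINT \<omega>|M. k \<omega> z))" using G_int by simp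
    show "integrable ?G (\<lambda>z. C + (\<Sum>e\<in>T. \<Sum>f\<in>T. z e * z f * B e f))"
      using std_gaussian_quadratic_form(1)[OF T] by simp
    show "cmod (1 - (CLINT \<omega>|M. k \<omega> z)) \<le> C + (\<Sum>e\<in>T. \<Sum>f\<in>T. z e * z f * B e f)" for z
      using bound[of z] by (simp add: k_def inner_sum_left)
  qed
  also have "\<dots> = C + (\<Sum>e\<in>T. B e e)"
    using std_gaussian_quadratic_form[OF T, of B] pG by simp
  finally show ?thesis unfolding I_def[symmetric] by simp
qed

section \<open>The Levy exponent and the behaviour of a Levy process at small times\<close>

lemma measurable_trunc [measurable]:
  "(trunc :: 'a::{real_normed_vector, second_countable_topology} \<Rightarrow> 'a) \<in> borel_measurable borel"
  unfolding trunc_def[abs_def] by measurable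

lemma norm_trunc_le: "norm (trunc x) \<le> 1"
  by (auto simp: trunc_def)

definition levy_exponent ::
  "'a::{real_inner, second_countable_topology} \<Rightarrow> ('a \<Rightarrow> 'a) \<Rightarrow> 'a measure \<Rightarrow> 'a \<Rightarrow> complex" where
  "levy_exponent b Q \<nu> u = \<i> * of_real (u \<bullet> b) - of_real (Q u \<bullet> u) / 2
     + (CLINT x|\<nu>. iexp (u \<bullet> x) - 1 - \<i> * of_real (u \<bullet> trunc x))"

lemma cmod_levy_integrand_le:
  "cmod (iexp (u \<bullet> x) - 1 - \<i> * of_real (u \<bullet> trunc x))
    \<le> (u \<bullet> trunc x)\<^sup>2 / 2 + 2 * indicator {x. 1 < norm x} x"
proof (cases "norm x \<le> 1")
  case True
  then show ?thesis
    using iexp_approx1[of "u \<bullet> x" 1] by (simp add: trunc_def algebra_simps numeral_2_eq_2)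
next
  case False
  have "cmod (iexp (u \<bullet> x) - 1) \<le> 2"
    using norm_triangle_ineq4[of "iexp (u \<bullet> x)" 1] by simp
  then show ?thesis using False by (simp add: trunc_def)
qed

lemma levy_measureD:
  assumes "levy_measure S \<nu>"
  shows "sets \<nu> = sets borel" "AE x in \<nu>. x \<in> S"
    and "integrable \<nu> (\<lambda>x. min 1 ((norm x)\<^sup>2))"
proof -
  show s: "sets \<nu> = sets borel" "AE x in \<nu>. x \<in> S" using assms by (auto simp: levy_measure_def)
  note [measurable_cong] = s(1)
  show "integrable \<nu> (\<lambda>x. min 1 ((norm x)\<^sup>2))"
    using assms by (intro integrableI_nonneg) (auto simp: levy_measure_def)
qed

lemma levy_measure_integrable_trunc_inner:
  fixes e f :: "'a::{real_inner, second_countable_topology}"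
  assumes "levy_measure S \<nu>"
  shows "integrable \<nu> (\<lambda>x. (e \<bullet> trunc x) * (f \<bullet> trunc x))"
    and "integrable \<nu> (\<lambda>x. (norm (trunc x))\<^sup>2)"
    and "integrable \<nu> (indicator {x. 1 < norm x} :: 'a \<Rightarrow> real)"
proof -
  note L = levy_measureD[OF assms]
  note [measurable_cong] = L(1)
  have le: "(norm (trunc x))\<^sup>2 \<le> min 1 ((norm x)\<^sup>2)" for x :: 'a
    by (auto simp: trunc_def power_le_one)
  show "integrable \<nu> (\<lambda>x. (norm (trunc x))\<^sup>2)"
    using L(3) by (rule Bochner_Integration.integrable_bound) (use le in auto)
  show "integrable \<nu> (\<lambda>x. (e \<bullet> trunc x) * (f \<bullet> trunc x))"
  proof (rule Bochner_Integration.integrable_bound)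
    show "integrable \<nu> (\<lambda>x. (norm e * norm f) * min 1 ((norm x)\<^sup>2))" using L(3) by simp
    have "\<bar>(e \<bullet> trunc x) * (f \<bullet> trunc x)\<bar> \<le> \<bar>(norm e * norm f) * min 1 ((norm x)\<^sup>2)\<bar>" for x
    proof -
      have "\<bar>(e \<bullet> trunc x) * (f \<bullet> trunc x)\<bar> \<le> (norm e * norm (trunc x)) * (norm f * norm (trunc x))"
        unfolding abs_mult by (intro mult_mono Cauchy_Schwarz_ineq2) auto
      also have "\<dots> = (norm e * norm f) * (norm (trunc x))\<^sup>2" by (simp add: power2_eq_square)
      also have "\<dots> \<le> (norm e * norm f) * min 1 ((norm x)\<^sup>2)"
        by (intro mult_left_mono le) auto
      finally show ?thesis by simp
    qed
    then show "AE x in \<nu>. norm ((e \<bullet> trunc x) * (f \<bullet> trunc x)) \<le> norm ((norm e * norm f) * min 1 ((norm x)\<^sup>2))"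
      by simp
  qed measurable
  show "integrable \<nu> (indicator {x. 1 < norm x} :: 'a \<Rightarrow> real)"
  proof (rule Bochner_Integration.integrable_bound[OF L(3)])
    show "AE x in \<nu>. norm (indicator {x. 1 < norm x} x :: real) \<le> norm (min 1 ((norm x)\<^sup>2))"
      by (auto simp: indicator_def)
  qed measurable
qed

lemma levy_integrand_integrable:
  fixes u :: "'a::{real_inner, second_countable_topology}"
  assumes "levy_measure S \<nu>"
  shows "integrable \<nu> (\<lambda>x. iexp (u \<bullet> x) - 1 - \<i> * of_real (u \<bullet> trunc x))"
proof -
  note [measurable_cong] = levy_measureD(1)[OF assms]
  note I = levy_measure_integrable_trunc_inner[OF assms]
  show ?thesis
  proof (rule Bochner_Integration.integrable_bound)
    show "integrable \<nu> (\<lambda>x. (u \<bullet> trunc x)\<^sup>2 / 2 + 2 * indicator {x. 1 < norm x} x)"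
      using I(1)[of u u] I(3) by (simp add: power2_eq_square)
    show "AE x in \<nu>. cmod (iexp (u \<bullet> x) - 1 - \<i> * of_real (u \<bullet> trunc x))
        \<le> norm ((u \<bullet> trunc x)\<^sup>2 / 2 + 2 * indicator {x. 1 < norm x} x)"
    proof (rule AE_I2)
      fix x
      show "cmod (iexp (u \<bullet> x) - 1 - \<i> * of_real (u \<bullet> trunc x))
        \<le> norm ((u \<bullet> trunc x)\<^sup>2 / 2 + 2 * indicator {x. 1 < norm x} x)"
        using cmod_levy_integrand_le[of u x] by (simp add: real_norm_def) 
    qed
  qed measurable
qed

text \<open>The drift contributes \<open>|\<langle>u|b\<rangle>| \<le> (1 + \<langle>u|b\<rangle>\<^sup>2) / 2\<close>; estimating it by a quadratic form puts all three
parts of the exponent on the same footing.\<close>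

lemma cmod_levy_exponent_le:
  fixes u :: "'a::{real_inner, second_countable_topology}"
  assumes \<nu>: "levy_measure S \<nu>" and Q: "0 \<le> Q u \<bullet> u"
  shows "cmod (levy_exponent b Q \<nu> u) \<le> 1 / 2 + 2 * (LINT x|\<nu>. indicator {x. 1 < norm x} x)
    + ((u \<bullet> b)\<^sup>2 + Q u \<bullet> u + (LINT x|\<nu>. (u \<bullet> trunc x)\<^sup>2)) / 2"
proof -
  note I = levy_measure_integrable_trunc_inner[OF \<nu>]
  have I2: "integrable \<nu> (\<lambda>x. (u \<bullet> trunc x)\<^sup>2)" using I(1)[of u u] by (simp add: power2_eq_square)
  have "cmod (CLINT x|\<nu>. iexp (u \<bullet> x) - 1 - \<i> * of_real (u \<bullet> trunc x))
      \<le> (LINT x|\<nu>. (u \<bullet> trunc x)\<^sup>2 / 2 + 2 * indicator {x. 1 < norm x} x)"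
    by (rule norm_integral_le_integral[OF levy_integrand_integrable[OF \<nu>]])
       (use I2 I(3) cmod_levy_integrand_le in auto)
  also have "\<dots> = (LINT x|\<nu>. (u \<bullet> trunc x)\<^sup>2) / 2 + 2 * (LINT x|\<nu>. indicator {x. 1 < norm x} x)"
    using I2 I(3) by simp
  finally have 3: "cmod (CLINT x|\<nu>. iexp (u \<bullet> x) - 1 - \<i> * of_real (u \<bullet> trunc x)) \<le> \<dots>" .
  have 1: "cmod (\<i> * of_real (u \<bullet> b)) \<le> 1 / 2 + (u \<bullet> b)\<^sup>2 / 2"
    using sum_squares_bound[of 1 "\<bar>u \<bullet> b\<bar>"] by (simp add: norm_mult)
  have 2: "cmod (of_real (Q u \<bullet> u) / 2) = Q u \<bullet> u / 2"
    using Q by (simp add: norm_divide)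
  show ?thesis
    unfolding levy_exponent_def
    using norm_triangle_ineq[of "\<i> * of_real (u \<bullet> b) - of_real (Q u \<bullet> u) / 2"
        "CLINT x|\<nu>. iexp (u \<bullet> x) - 1 - \<i> * of_real (u \<bullet> trunc x)"]
      norm_triangle_ineq4[of "\<i> * of_real (u \<bullet> b)" "of_real (Q u \<bullet> u) / 2"] 1 2 3
    by (simp add: add_divide_distrib)
qed

text \<open>The derivative of \<open>exp\<close> is bounded by 1 on the left half-plane, which is convex.\<close>

lemma cmod_one_minus_exp_le:
  assumes "Re w \<le> 0"
  shows "cmod (1 - exp w) \<le> cmod w"
proof -
  have "cmod (exp 0 - exp w) \<le> 1 * cmod (0 - w)"
  proof (rule field_differentiable_bound[where S = "{z. Re z \<le> 0}" and f' = exp])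
    show "convex {z. Re z \<le> 0}" by (rule convex_halfspace_Re_le)
  qed (use assms in \<open>auto intro: has_field_derivative_at_within DERIV_exp\<close>)
  then show ?thesis by simp
qed

lemma levy_characteristicsD:
  assumes "levy_characteristics M S Y b Q \<nu>"
  shows "levy_process M S Y" "b \<in> S" "covariance_operator S Q" "levy_measure S \<nu>"
    and "0 \<le> t \<Longrightarrow> u \<in> S \<Longrightarrow>
      (CLINT \<omega>|M. iexp (u \<bullet> Y t \<omega>)) = exp (of_real t * levy_exponent b Q \<nu> u)"
  using assms unfolding levy_characteristics_def levy_exponent_def by auto

lemma levy_processD:
  assumes "levy_process M S Y"
  shows "0 \<le> t \<Longrightarrow> Y t \<in> borel_measurable M"
    and "0 \<le> t \<Longrightarrow> \<omega> \<in> space M \<Longrightarrow> Y t \<omega> \<in> S"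
    and "AE \<omega> in M. Y 0 \<omega> = 0"
    and "0 \<le> \<tau> 0 \<Longrightarrow> mono_on {..n} \<tau> \<Longrightarrow>
      prob_space.indep_vars M (\<lambda>_. borel) (\<lambda>i \<omega>. Y (\<tau> (Suc i)) \<omega> - Y (\<tau> i) \<omega>) {..<n::nat}"
    and "0 \<le> s \<Longrightarrow> s \<le> t \<Longrightarrow>
      distr M borel (\<lambda>\<omega>. Y t \<omega> - Y s \<omega>) = distr M borel (Y (t - s))"
    and "\<omega> \<in> space M \<Longrightarrow> cadlag (\<lambda>t. Y t \<omega>)"
  using assms unfolding levy_process_def by (blast, blast, blast, blast, blast, blast)

text \<open>The modulus of a characteristic function at time 1 is \<open>exp (Re \<psi>)\<close>, and it is at most 1.\<close>

lemma Re_levy_exponent_le_0: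
  assumes "prob_space M" and LC: "levy_characteristics M S Y b Q \<nu>" and "u \<in> S"
  shows "Re (levy_exponent b Q \<nu> u) \<le> 0"
proof -
  interpret prob_space M by fact
  have [measurable]: "Y 1 \<in> borel_measurable M"
    using levy_processD(1)[OF levy_characteristicsD(1)[OF LC]] by simp
  have "exp (Re (levy_exponent b Q \<nu> u)) = cmod (CLINT \<omega>|M. iexp (u \<bullet> Y 1 \<omega>))"
    using levy_characteristicsD(5)[OF LC, of 1 u] \<open>u \<in> S\<close> by simp
  also have "\<dots> \<le> (LINT \<omega>|M. 1)"
    by (rule norm_integral_le_integral) (auto intro!: integrable_const_bound[where B = 1])
  finally show ?thesis by (simp add: prob_space)
qed

lemma covariance_operator_linear_combination:
  assumes Q: "covariance_operator S Q" and S: "subspace S" and T: "finite T" "T \<subseteq> S"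
  shows "Q (\<Sum>e\<in>T. z e *\<^sub>R e) = (\<Sum>e\<in>T. z e *\<^sub>R Q e)"
proof -
  have add: "Q (x + y) = Q x + Q y" if "x \<in> S" "y \<in> S" for x y
    using Q that by (auto simp: covariance_operator_def)
  have scale: "Q (c *\<^sub>R x) = c *\<^sub>R Q x" if "x \<in> S" for c x
    using Q that by (auto simp: covariance_operator_def)
  have "Q 0 = 0" using scale[of 0 0] subspace_0[OF S] by simp
  with T show ?thesis
    by (induction T rule: finite_induct)
       (auto simp: add scale subspace_scale[OF S] subspace_sum[OF S] subset_iff)
qed

text \<open>Half the sum of the covariance form, the form \<open>\<langle>u|b\<rangle>\<langle>v|b\<rangle>\<close> and the second moments of the jumps of
size at most 1: the quadratic part of the bound on the exponent, polarised.\<close>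

definition levy_form ::
  "'a::{real_inner, second_countable_topology} \<Rightarrow> ('a \<Rightarrow> 'a) \<Rightarrow> 'a measure \<Rightarrow> 'a \<Rightarrow> 'a \<Rightarrow> real" where
  "levy_form b Q \<nu> u v =
     ((u \<bullet> b) * (v \<bullet> b) + Q u \<bullet> v + (LINT x|\<nu>. (u \<bullet> trunc x) * (v \<bullet> trunc x))) / 2"

lemma levy_form_linear_combination:
  fixes b :: "'a::{real_inner, second_countable_topology}"
  assumes S: "subspace S" and Q: "covariance_operator S Q" and \<nu>: "levy_measure S \<nu>"
    and T: "finite T" "T \<subseteq> S"
  defines "v z \<equiv> \<Sum>e\<in>T. z e *\<^sub>R e"
  shows "levy_form b Q \<nu> (v z) (v z) = (\<Sum>e\<in>T. \<Sum>f\<in>T. z e * z f * levy_form b Q \<nu> e f)"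
proof -
  note I = levy_measure_integrable_trunc_inner(1)[OF \<nu>]
  have square: "(v z \<bullet> x) * (v z \<bullet> x) = (\<Sum>e\<in>T. \<Sum>f\<in>T. z e * z f * ((e \<bullet> x) * (f \<bullet> x)))" for x
    unfolding v_def inner_sum_left sum_product by (simp add: mult_ac)
  have "Q (v z) \<bullet> v z = (\<Sum>e\<in>T. \<Sum>f\<in>T. z e * z f * (Q e \<bullet> f))"
    unfolding v_def covariance_operator_linear_combination[OF Q S T] inner_sum_left
    unfolding inner_sum_right by (simp add: sum_distrib_left mult_ac)
  moreover have "(LINT x|\<nu>. (v z \<bullet> trunc x) * (v z \<bullet> trunc x)) =
      (\<Sum>e\<in>T. \<Sum>f\<in>T. z e * z f * (LINT x|\<nu>. (e \<bullet> trunc x) * (f \<bullet> trunc x)))"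
    unfolding square using I by (simp add: Bochner_Integration.integral_sum)
  ultimately show ?thesis
    unfolding levy_form_def square
    by (simp add: sum.distrib[symmetric] sum_divide_distrib distrib_left)
qed

text \<open>By Bessel's inequality the trace over \<open>T\<close> is controlled by quantities of the characteristics.
For \<open>Q\<close> of finite trace, the bound is uniform in \<open>T\<close>.\<close>

lemma sum_levy_form_le:
  fixes b :: "'a::{real_inner, second_countable_topology}"
  assumes \<nu>: "levy_measure S \<nu>" and T: "finite T" "pairwise orthogonal T" "\<forall>e\<in>T. norm e = 1"
  shows "(\<Sum>e\<in>T. levy_form b Q \<nu> e e) \<le>
    ((norm b)\<^sup>2 + (\<Sum>e\<in>T. Q e \<bullet> e) + (LINT x|\<nu>. (norm (trunc x))\<^sup>2)) / 2"
proof -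
  note I = levy_measure_integrable_trunc_inner[OF \<nu>]
  have "(\<Sum>e\<in>T. LINT x|\<nu>. (e \<bullet> trunc x) * (e \<bullet> trunc x)) =
      (LINT x|\<nu>. (\<Sum>e\<in>T. (e \<bullet> trunc x) * (e \<bullet> trunc x)))"
    using I(1) by (simp add: Bochner_Integration.integral_sum)
  also have "\<dots> \<le> (LINT x|\<nu>. (norm (trunc x))\<^sup>2)"
    using I bessel_inequality[OF T] by (intro integral_mono) (auto simp: power2_eq_square)
  finally show ?thesis
    using bessel_inequality[OF T, of b]
    by (simp add: levy_form_def sum.distrib sum_divide_distrib[symmetric] power2_eq_square)
qed

text \<open>With \<open>y = r\<^sup>2 / 2\<close> this uses \<open>1 - e\<^bsup>-y\<^esup> \<ge> y / (1 + y)\<close>, a form of \<open>e\<^sup>y \<ge> 1 + y\<close>.\<close>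

lemma min_1_square_le: "min 1 (r\<^sup>2) \<le> 3 * (1 - exp (- r\<^sup>2 / 2))" for r :: real
proof -
  have pos: "0 < 1 + r\<^sup>2 / 2" by (simp add: add_pos_nonneg)
  have "exp (- r\<^sup>2 / 2) \<le> 1 / (1 + r\<^sup>2 / 2)"
    using exp_ge_add_one_self[of "r\<^sup>2 / 2"] pos by (simp add: exp_minus field_simps)
  then have "3 * (1 - 1 / (1 + r\<^sup>2 / 2)) \<le> 3 * (1 - exp (- r\<^sup>2 / 2))" by simp
  moreover have "min 1 (r\<^sup>2) \<le> 3 * (1 - 1 / (1 + r\<^sup>2 / 2))"
  proof -
    have "1 - 1 / (1 + r\<^sup>2 / 2) = r\<^sup>2 / (2 + r\<^sup>2)" using pos by (simp add: field_simps)
    moreover have "min 1 (r\<^sup>2) * (2 + r\<^sup>2) \<le> 3 * r\<^sup>2"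
    proof (cases "r\<^sup>2 \<le> 1")
      case True
      then have "r\<^sup>2 * r\<^sup>2 \<le> r\<^sup>2 * 1" by (intro mult_left_mono) auto
      then show ?thesis using True by (simp add: min_def algebra_simps)
    qed (simp add: min_def)
    ultimately show ?thesis using pos by (simp add: pos_le_divide_eq)
  qed
  ultimately show ?thesis by (rule order_trans[rotated])
qed

text \<open>Averaging over Gaussian directions in the span of finitely many basis vectors bounds
\<open>E (1 - exp (- |P Y\<^sub>t|\<^sup>2 / 2))\<close> by a multiple of \<open>t\<close> that does not depend on the projection \<open>P\<close>;
the projections then exhaust the space. A single direction at a time would not do: summed over a basis,
the large jumps can contribute infinitely much, whereas \<open>1 - exp (- |x|\<^sup>2 / 2)\<close> stays bounded.\<close>

proposition levy_small_time_estimate: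
  assumes "prob_space M" and S: "subspace S" and LC: "levy_characteristics M S Y b Q \<nu>"
  obtains K where "0 \<le> K" "\<And>t. 0 \<le> t \<Longrightarrow> (LINT \<omega>|M. min 1 ((norm (Y t \<omega>))\<^sup>2)) \<le> K * t"
proof -
  interpret prob_space M by fact
  note LD = levy_characteristicsD[OF LC]
  note PD = levy_processD[OF LD(1)]
  obtain B where B: "orthonormal_basis_on S B" "(\<lambda>e. Q e \<bullet> e) summable_on B"
    using LD(3) unfolding covariance_operator_def by blast
  have BS: "B \<subseteq> S" and orth: "pairwise orthogonal B" "\<forall>e\<in>B. norm e = 1"
    and S_eq: "closure (span B) = S"
    using B(1) by (auto simp: orthonormal_basis_on_def)
  have Q0: "0 \<le> Q u \<bullet> u" if "u \<in> S" for u
    using LD(3) that by (auto simp: covariance_operator_def)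
  obtain T where T: "\<And>n. finite (T n)" "\<And>n. T n \<subseteq> B"
    "\<And>x. x \<in> closure (span B) \<Longrightarrow> (\<lambda>n. \<Sum>e\<in>T n. (e \<bullet> x)\<^sup>2) \<longlonglongrightarrow> (norm x)\<^sup>2"
    using parseval_limit[OF orth] by metis
  define C :: real where "C = 1 / 2 + 2 * (LINT x|\<nu>. indicator {x. 1 < norm x} x)"
  define A where "A = ((norm b)\<^sup>2 + (\<Sum>\<^sub>\<infinity>e\<in>B. Q e \<bullet> e) + (LINT x|\<nu>. (norm (trunc x))\<^sup>2)) / 2"
  have C0: "0 \<le> C" unfolding C_def by (simp add: integral_nonneg_AE)
  have A0: "0 \<le> A"
    unfolding A_def using Q0 BS by (auto intro!: add_nonneg_nonneg infsum_nonneg integral_nonneg_AE)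
  have exponent: "cmod (levy_exponent b Q \<nu> u) \<le> C + levy_form b Q \<nu> u u" if "u \<in> S" for u
    using cmod_levy_exponent_le[OF LD(4), of Q u b] Q0[OF that]
    by (simp add: C_def levy_form_def power2_eq_square)
  have main: "(LINT \<omega>|M. min 1 ((norm (Y t \<omega>))\<^sup>2)) \<le> 3 * (C + A) * t" if t: "0 \<le> t" for t
  proof -
    have [measurable]: "Y t \<in> borel_measurable M" using PD(1) t .
    let ?g = "\<lambda>n \<omega>. 1 - exp (- (\<Sum>e\<in>T n. (e \<bullet> Y t \<omega>)\<^sup>2) / 2)"
    have bound: "(LINT \<omega>|M. ?g n \<omega>) \<le> (C + A) * t" for n
    proof -
      have TS: "T n \<subseteq> S" using T(2) BS by blast
      have To: "pairwise orthogonal (T n)" "\<forall>e\<in>T n. norm e = 1"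
        using orth T(2)[of n] pairwise_mono by (blast, blast)
      have "cmod (1 - (CLINT \<omega>|M. iexp ((\<Sum>e\<in>T n. z e *\<^sub>R e) \<bullet> Y t \<omega>)))
          \<le> C * t + (\<Sum>e\<in>T n. \<Sum>f\<in>T n. z e * z f * (levy_form b Q \<nu> e f * t))" for z
      proof -
        let ?u = "\<Sum>e\<in>T n. z e *\<^sub>R e"
        have uS: "?u \<in> S" using TS by (intro subspace_sum[OF S] subspace_scale[OF S]) auto
        have Re: "Re (of_real t * levy_exponent b Q \<nu> ?u) \<le> 0"
          using Re_levy_exponent_le_0[OF \<open>prob_space M\<close> LC uS] t by (simp add: mult_nonneg_nonpos)
        have "cmod (1 - (CLINT \<omega>|M. iexp (?u \<bullet> Y t \<omega>))) \<le> cmod (of_real t * levy_exponent b Q \<nu> ?u)"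
          unfolding LD(5)[OF t uS] by (rule cmod_one_minus_exp_le[OF Re])
        also have "\<dots> = t * cmod (levy_exponent b Q \<nu> ?u)" using t by (simp add: norm_mult)
        also have "\<dots> \<le> t * (C + levy_form b Q \<nu> ?u ?u)"
          using t by (intro mult_left_mono exponent[OF uS])
        finally show ?thesis
          unfolding levy_form_linear_combination[OF S LD(3,4) T(1) TS]
          by (simp add: algebra_simps sum_distrib_left)
      qed
      from gaussian_averaging[OF \<open>Y t \<in> borel_measurable M\<close> T(1) this]
      have "(LINT \<omega>|M. ?g n \<omega>) \<le> C * t + (\<Sum>e\<in>T n. levy_form b Q \<nu> e e) * t"
        by (simp add: sum_distrib_right)
      moreover have "(\<Sum>e\<in>T n. levy_form b Q \<nu> e e) \<le> A"
      proof -
        have "(\<Sum>e\<in>T n. Q e \<bullet> e) \<le> (\<Sum>\<^sub>\<infinity>e\<in>B. Q e \<bullet> e)"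
          using Q0 BS by (intro finite_sum_le_infsum[OF B(2) T(1,2)]) auto
        then show ?thesis
          using sum_levy_form_le[OF LD(4) T(1) To, of b Q] by (simp add: A_def)
      qed
      ultimately show ?thesis
        using mult_right_mono[of "\<Sum>e\<in>T n. levy_form b Q \<nu> e e" A t] t by (simp add: algebra_simps)
    qed
    have "(\<lambda>n. LINT \<omega>|M. ?g n \<omega>) \<longlonglongrightarrow> (LINT \<omega>|M. 1 - exp (- (norm (Y t \<omega>))\<^sup>2 / 2))"
    proof (rule integral_dominated_convergence[where w = "\<lambda>_. 1"])
      show "AE \<omega> in M. (\<lambda>n. ?g n \<omega>) \<longlonglongrightarrow> 1 - exp (- (norm (Y t \<omega>))\<^sup>2 / 2)"
        using PD(2)[OF t] T(3) unfolding S_eq by (intro AE_I2 tendsto_intros) auto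
      show "AE \<omega> in M. norm (?g n \<omega>) \<le> 1" for n
        by (intro AE_I2) (auto simp: abs_le_iff sum_nonneg intro: order_trans[OF _ exp_ge_zero])
    qed auto
    then have "(LINT \<omega>|M. 1 - exp (- (norm (Y t \<omega>))\<^sup>2 / 2)) \<le> (C + A) * t"
      by (rule LIMSEQ_le_const2) (use bound in auto)
    moreover have "(LINT \<omega>|M. min 1 ((norm (Y t \<omega>))\<^sup>2)) \<le> (LINT \<omega>|M. 3 * (1 - exp (- (norm (Y t \<omega>))\<^sup>2 / 2)))"
    proof (intro integral_mono min_1_square_le)
      have "integrable M (\<lambda>\<omega>. exp (- (norm (Y t \<omega>))\<^sup>2 / 2))"
        by (rule integrable_const_bound[where B = 1]) auto
      then show "integrable M (\<lambda>\<omega>. 3 * (1 - exp (- (norm (Y t \<omega>))\<^sup>2 / 2)))" by simp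
    qed (auto intro!: integrable_const_bound[where B = 1])
    moreover have "(LINT \<omega>|M. 3 * (1 - exp (- (norm (Y t \<omega>))\<^sup>2 / 2))) =
        3 * (LINT \<omega>|M. 1 - exp (- (norm (Y t \<omega>))\<^sup>2 / 2))"
      by (rule integral_mult_right_zero)
    ultimately show ?thesis by linarith
  qed
  show thesis
    by (rule that[of "3 * (C + A)"]) (use C0 A0 main in auto)
qed

lemma levy_exponent_bounded:
  assumes Q: "covariance_operator S Q" and \<nu>: "levy_measure S \<nu>"
  obtains C where "0 \<le> C" "\<And>u. u \<in> S \<Longrightarrow> norm u \<le> 1 \<Longrightarrow> cmod (levy_exponent b Q \<nu> u) \<le> C"
proof -
  note I = levy_measure_integrable_trunc_inner[OF \<nu>]
  obtain K where K: "\<And>x. x \<in> S \<Longrightarrow> norm (Q x) \<le> K * norm x" and Q0: "\<And>x. x \<in> S \<Longrightarrow> 0 \<le> Q x \<bullet> x"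
    using Q unfolding covariance_operator_def by blast
  define C where "C = 1 / 2 + 2 * (LINT x|\<nu>. indicator {x. 1 < norm x} x)
    + ((norm b)\<^sup>2 + \<bar>K\<bar> + (LINT x|\<nu>. (norm (trunc x))\<^sup>2)) / 2"
  have "0 \<le> C" unfolding C_def by (intro add_nonneg_nonneg divide_nonneg_nonneg mult_nonneg_nonneg integral_nonneg_AE) auto
  moreover have "cmod (levy_exponent b Q \<nu> u) \<le> C" if u: "u \<in> S" "norm u \<le> 1" for u
  proof -
    have sq: "(u \<bullet> x)\<^sup>2 \<le> (norm x)\<^sup>2" for x
    proof -
      have "\<bar>u \<bullet> x\<bar> \<le> norm u * norm x" by (rule Cauchy_Schwarz_ineq2)
      also have "\<dots> \<le> 1 * norm x" using u(2) by (rule mult_right_mono) simp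
      finally show ?thesis by (simp add: abs_le_square_iff[symmetric])
    qed
    have "Q u \<bullet> u \<le> norm (Q u) * norm u" by (rule norm_cauchy_schwarz)
    also have "\<dots> \<le> (\<bar>K\<bar> * 1) * 1"
    proof (intro mult_mono)
      show "norm (Q u) \<le> \<bar>K\<bar> * 1"
        by (rule order_trans[OF K[OF u(1)] mult_mono]) (use u(2) in auto)
    qed (use u(2) in auto)
    finally have 1: "Q u \<bullet> u \<le> \<bar>K\<bar>" by simp
    have "(LINT x|\<nu>. (u \<bullet> trunc x)\<^sup>2) \<le> (LINT x|\<nu>. (norm (trunc x))\<^sup>2)"
      using I(1)[of u u] I(2) sq by (intro integral_mono) (auto simp: power2_eq_square)
    then have "((u \<bullet> b)\<^sup>2 + Q u \<bullet> u + (LINT x|\<nu>. (u \<bullet> trunc x)\<^sup>2)) / 2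
        \<le> ((norm b)\<^sup>2 + \<bar>K\<bar> + (LINT x|\<nu>. (norm (trunc x))\<^sup>2)) / 2"
      using 1 sq[of b] by (intro divide_right_mono add_mono) auto
    then show ?thesis
      unfolding C_def
      by (rule order_trans[OF cmod_levy_exponent_le[where Q = Q and u = u and b = b, OF \<nu> Q0[OF u(1)]] add_left_mono])
  qed
  ultimately show thesis by (rule that)
qed

section \<open>Analytic continuation to the left half-plane\<close>

text \<open>The difference of the two functions, extended by 0 to the right half-plane, is continuous
across the imaginary axis, hence entire by Morera's theorem, and it vanishes on an open set.\<close>

lemma holomorphic_left_half_plane_unique:
  fixes f g :: "complex \<Rightarrow> complex"
  assumes cont: "continuous_on {z. Re z \<le> 0} f" "continuous_on {z. Re z \<le> 0} g"
    and hol: "f holomorphic_on {z. Re z < 0}" "g holomorphic_on {z. Re z < 0}"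
    and eq: "\<And>y. f (\<i> * of_real y) = g (\<i> * of_real y)"
    and z: "Re z \<le> 0"
  shows "f z = g z"
proof -
  define h where "h z = (if Re z \<le> 0 then f z - g z else 0)" for z
  have imag: "f z = g z" if "Re z = 0" for z
    using eq[of "Im z"] that by (metis complex_eq add_0 of_real_0)
  have "continuous_on UNIV h"
    unfolding h_def using cont imag
    by (intro continuous_on_cases_le continuous_on_diff continuous_on_const continuous_intros) auto
  moreover have "h holomorphic_on (UNIV \<inter> {z. (1::complex) \<bullet> z < 0})"
  proof (rule holomorphic_transform)
    show "(\<lambda>z. f z - g z) holomorphic_on (UNIV \<inter> {z. (1::complex) \<bullet> z < 0})"
      using hol by (intro holomorphic_on_diff) (auto simp: inner_complex_def)
  qed (auto simp: h_def inner_complex_def)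
  moreover have "h holomorphic_on (UNIV \<inter> {z. 0 < (1::complex) \<bullet> z})"
    by (rule holomorphic_transform[of "\<lambda>_. 0"]) (auto simp: h_def inner_complex_def)
  ultimately have "h holomorphic_on UNIV"
    by (intro holomorphic_on_paste_across_line[of UNIV 1]) auto
  moreover have "(1::complex) islimpt {z. 0 < Re z}"
    by (rule interior_limit_point) (simp add: interior_open open_halfspace_Re_gt)
  ultimately have "h z = 0"
    using analytic_continuation[of h UNIV "{z. 0 < Re z}" 1 z] connected_UNIV by (auto simp: h_def)
  then show ?thesis using z by (simp add: h_def)
qed

text \<open>The mean value inequality on the half-plane \<open>Re z \<le> -\<delta>\<close>. With \<open>\<delta> = 0\<close> it bounds the integrand of a
Laplace transform, with \<open>\<delta> > 0\<close> its difference quotients.\<close>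

lemma cmod_exp_diff_half_plane_le:
  assumes "0 \<le> s" "Re a \<le> - \<delta>" "Re b \<le> - \<delta>"
  shows "cmod (exp (a * of_real s) - exp (b * of_real s)) \<le> s * exp (- \<delta> * s) * cmod (a - b)"
proof (rule field_differentiable_bound[where S = "{z. Re z \<le> - \<delta>}"
      and f' = "\<lambda>z. exp (z * of_real s) * of_real s"])
  show "convex {z. Re z \<le> - \<delta>}" by (rule convex_halfspace_Re_le)
  show "cmod (exp (z * of_real s) * of_real s) \<le> s * exp (- \<delta> * s)"
    if "z \<in> {z. Re z \<le> - \<delta>}" for z
    using that assms(1) mult_right_mono[of "Re z" "-\<delta>" s]
    by (simp add: norm_mult mult.commute mult_left_mono)
qed (use assms in \<open>auto intro!: derivative_eq_intros\<close>)

lemma mult_exp_neg_le: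
  fixes \<delta> s :: real
  assumes "0 < \<delta>" "0 \<le> s"
  shows "s * exp (- \<delta> * s) \<le> (1 + 1 / \<delta>) * min 1 s"
proof -
  have 1: "s * exp (- \<delta> * s) \<le> s" using assms by (simp add: mult_left_le)
  have "\<delta> * s \<le> exp (\<delta> * s)" using exp_ge_add_one_self[of "\<delta> * s"] by linarith
  then have 2: "s * exp (- \<delta> * s) \<le> 1 / \<delta>" using assms by (simp add: exp_minus field_simps)
  show ?thesis
  proof (cases "s \<le> 1")
    case True
    have "s \<le> (1 + 1 / \<delta>) * s" using assms by (simp add: algebra_simps)
    then show ?thesis using 1 True by simp
  qed (use 2 in auto)
qed

context
  fixes N :: "'a measure" and S :: "'a \<Rightarrow> real" and Y :: "'a \<Rightarrow> complex"
  assumes [measurable]: "S \<in> borel_measurable N" "Y \<in> borel_measurable N"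
    and S0: "\<And>x. 0 \<le> S x" and Y1: "\<And>x. cmod (Y x) = 1"
    and Y_int: "integrable N (\<lambda>x. Y x - 1)" and S_int: "integrable N (\<lambda>x. min 1 (S x))"
begin

abbreviation e :: "complex \<Rightarrow> 'a \<Rightarrow> complex" where
  "e z x \<equiv> exp (z * of_real (S x))"

lemma laplace_integrand_le:
  assumes "Re z \<le> 0" "cmod z \<le> R"
  shows "cmod (Y x * e z x - 1) \<le> (2 + R) * min 1 (S x) + cmod (Y x - 1)"
proof -
  have e: "cmod (e z x - 1) \<le> (2 + R) * min 1 (S x)"
  proof (cases "S x \<le> 1")
    case True
    have "cmod (e z x - e 0 x) \<le> S x * cmod z"
      using cmod_exp_diff_half_plane_le[of "S x" z 0 0] S0 assms by simp
    also have "\<dots> \<le> S x * (2 + R)" using S0 assms by (intro mult_left_mono) auto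
    finally show ?thesis using True by (simp add: mult.commute)
  next
    case False
    have "cmod (e z x - 1) \<le> cmod (e z x) + 1"
      using norm_triangle_ineq4[of "e z x" 1] by (metis norm_one)
    also have "\<dots> \<le> 2" using assms(1) S0[of x] by (simp add: mult_nonpos_nonneg)
    also have "\<dots> \<le> 2 + R" using assms(2) norm_ge_zero[of z] by linarith
    finally show ?thesis using False by simp
  qed
  have "Y x * e z x - 1 = Y x * (e z x - 1) + (Y x - 1)"
    by (simp add: algebra_simps)
  also have "cmod \<dots> \<le> cmod (e z x - 1) + cmod (Y x - 1)"
    using norm_triangle_ineq[of "Y x * (e z x - 1)" "Y x - 1"] by (simp add: norm_mult Y1)
  finally show ?thesis using e by simp
qed

lemma laplace_integrand_integrable:
  assumes "Re z \<le> 0"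
  shows "integrable N (\<lambda>x. Y x * e z x - 1)"
proof (rule Bochner_Integration.integrable_bound)
  show "integrable N (\<lambda>x. (2 + cmod z) * min 1 (S x) + cmod (Y x - 1))"
    using Y_int S_int by simp
  show "AE x in N. norm (Y x * e z x - 1) \<le> norm ((2 + cmod z) * min 1 (S x) + cmod (Y x - 1))"
    using laplace_integrand_le[OF assms order_refl] by (intro AE_I2) (auto intro: order_trans[OF _ abs_ge_self])
qed measurable

lemma laplace_integral_continuous:
  "continuous_on {z. Re z \<le> 0} (\<lambda>z. CLINT x|N. Y x * e z x - 1)"
  unfolding continuous_on_sequentially
proof (intro allI ballI impI, elim conjE)
  fix X :: "nat \<Rightarrow> complex" and z
  assume z: "z \<in> {z. Re z \<le> 0}" and X: "\<forall>n. X n \<in> {z. Re z \<le> 0}" "X \<longlonglongrightarrow> z"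
  obtain R where R: "\<And>n. cmod (X n) \<le> R"
    using convergent_imp_Bseq[OF convergentI[OF X(2)]] unfolding Bseq_def by blast
  show "((\<lambda>z. CLINT x|N. Y x * e z x - 1) \<circ> X) \<longlonglongrightarrow>
      (CLINT x|N. Y x * e z x - 1)"
    unfolding o_def
  proof (rule integral_dominated_convergence[where w = "\<lambda>x. (2 + R) * min 1 (S x) + cmod (Y x - 1)"])
    show "integrable N (\<lambda>x. (2 + R) * min 1 (S x) + cmod (Y x - 1))" using Y_int S_int by simp
    show "AE x in N. (\<lambda>i. Y x * e (X i) x - 1) \<longlonglongrightarrow> Y x * e z x - 1"
      using X(2) by (intro AE_I2 tendsto_intros)
    show "AE x in N. norm (Y x * e (X i) x - 1) \<le> (2 + R) * min 1 (S x) + cmod (Y x - 1)" for i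
      using X(1) R by (intro AE_I2 laplace_integrand_le) auto
  qed measurable
qed

text \<open>Differentiation under the integral by dominated convergence: near \<open>z\<close> the real parts stay below
some \<open>-\<delta> < 0\<close>, where the difference quotients are at most \<open>S e\<^bsup>-\<delta>S\<^esup>\<close>, a multiple of \<open>min 1 S\<close>. Thus an
infinite measure with \<open>\<integral> min 1 S < \<infinity>\<close> is admissible.\<close>

lemma laplace_integral_holomorphic:
  "(\<lambda>z. CLINT x|N. Y x * e z x - 1) holomorphic_on {z. Re z < 0}"
proof -
  let ?G = "\<lambda>z. CLINT x|N. Y x * e z x - 1"
  have "(?G has_field_derivative (CLINT x|N. Y x * (e z x * of_real (S x)))) (at z)"
    if z: "Re z < 0" for z
    unfolding has_field_derivative_iff tendsto_at_iff_sequentially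
  proof (intro allI impI)
    fix X :: "nat \<Rightarrow> complex"
    assume X: "\<forall>i. X i \<in> UNIV - {z}" "X \<longlonglongrightarrow> z"
    define \<delta> where "\<delta> = - Re z / 2"
    have \<delta>: "0 < \<delta>" using z by (simp add: \<delta>_def)
    have "eventually (\<lambda>n. Re (X n) < - \<delta>) sequentially"
      using tendsto_Re[OF X(2)] z by (intro order_tendstoD(2)) (auto simp: \<delta>_def)
    then obtain n0 where n0: "\<And>n. n \<ge> n0 \<Longrightarrow> Re (X n) < - \<delta>"
      unfolding eventually_sequentially by blast
    define Z where "Z n = X (n + n0)" for n
    have Z: "Z \<longlonglongrightarrow> z" "\<And>n. Z n \<noteq> z" "\<And>n. Re (Z n) < - \<delta>"
      using X n0 LIMSEQ_ignore_initial_segment[OF X(2), of n0] by (auto simp: Z_def[abs_def])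
    have G_diff: "(?G (Z n) - ?G z) / (Z n - z) =
        (CLINT x|N. Y x * ((e (Z n) x - e z x) / (Z n - z)))" for n
    proof -
      have "?G (Z n) - ?G z = (CLINT x|N. (Y x * e (Z n) x - 1) - (Y x * e z x - 1))"
        using Z(3)[of n] z \<delta> by (intro Bochner_Integration.integral_diff[symmetric] laplace_integrand_integrable) auto
      then show ?thesis
        by (subst integral_divide_zero[symmetric, of _ _ "Z n - z"] | simp add: algebra_simps diff_divide_distrib)+
    qed
    have "(\<lambda>n. (?G (Z n) - ?G z) / (Z n - z)) \<longlonglongrightarrow>
        (CLINT x|N. Y x * (e z x * of_real (S x)))"
      unfolding G_diff
    proof (rule integral_dominated_convergence[where w = "\<lambda>x. (1 + 1 / \<delta>) * min 1 (S x)"])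
      show "integrable N (\<lambda>x. (1 + 1 / \<delta>) * min 1 (S x))" using S_int by simp
      show "AE x in N. (\<lambda>n. Y x * ((e (Z n) x - e z x) / (Z n - z)))
          \<longlonglongrightarrow> Y x * (e z x * of_real (S x))"
      proof (intro AE_I2 tendsto_mult tendsto_const)
        fix x
        have "((\<lambda>z. e z x) has_field_derivative
            e z x * of_real (S x)) (at z)"
          by (auto intro!: derivative_eq_intros)
        then show "(\<lambda>n. (e (Z n) x - e z x) / (Z n - z))
          \<longlonglongrightarrow> e z x * of_real (S x)"
          using Z unfolding has_field_derivative_iff tendsto_at_iff_sequentially
          by (auto simp: o_def)
      qed
      show "AE x in N. norm (Y x * ((e (Z n) x - e z x) / (Z n - z)))
          \<le> (1 + 1 / \<delta>) * min 1 (S x)" for n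
      proof (intro AE_I2)
        fix x
        have "cmod (e (Z n) x - e z x) \<le>
            S x * exp (- \<delta> * S x) * cmod (Z n - z)"
          using Z(3)[of n] z by (intro cmod_exp_diff_half_plane_le S0) (auto simp: \<delta>_def)
        then have "cmod (e (Z n) x - e z x) / cmod (Z n - z)
            \<le> S x * exp (- \<delta> * S x)"
          using Z(2)[of n] by (simp add: pos_divide_le_eq)
        also have "\<dots> \<le> (1 + 1 / \<delta>) * min 1 (S x)" by (rule mult_exp_neg_le[OF \<delta> S0])
        finally show "norm (Y x * ((e (Z n) x - e z x) / (Z n - z)))
          \<le> (1 + 1 / \<delta>) * min 1 (S x)"
          by (simp add: norm_mult norm_divide Y1)
      qed
    qed measurable
    then have "(\<lambda>n. (?G (X (n + n0)) - ?G z) / (X (n + n0) - z)) \<longlonglongrightarrow>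
        (CLINT x|N. Y x * (e z x * of_real (S x)))"
      by (simp only: Z_def)
    from LIMSEQ_offset[OF this] show "((\<lambda>w. (?G w - ?G z) / (w - z)) \<circ> X) \<longlonglongrightarrow>
        (CLINT x|N. Y x * (e z x * of_real (S x)))"
      by (simp add: o_def)
  qed
  then show ?thesis
    by (intro holomorphic_onI) (auto simp: field_differentiable_def intro: has_field_derivative_at_within)
qed

end

section \<open>The Laplace transform of a multivariate subordinator\<close>

lemma nonneg_orthant_closed: "closed (nonneg_orthant :: (real ^ 'd::finite) set)"
  unfolding nonneg_orthant_def by (intro closed_Collect_all closed_Collect_le continuous_intros)

lemma nonneg_orthant_measurable [measurable]: "(nonneg_orthant :: (real ^ 'd::finite) set) \<in> sets borel"
  by (intro borel_closed nonneg_orthant_closed)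

text \<open>Below norm 1 the integrand is \<open>|\<chi>(\<theta>)|\<close>, which is integrable by the assumption on the drift of the
subordinator; above it the Levy measure is finite.\<close>

lemma integrable_min_1_norm:
  fixes F :: "(real ^ 'd::finite) measure"
  assumes F: "levy_measure UNIV F" and orth: "AE \<theta> in F. \<theta> \<in> nonneg_orthant"
    and tr: "set_integrable F nonneg_orthant trunc"
  shows "integrable F (\<lambda>\<theta>. min 1 (norm \<theta>))"
proof -
  note L = levy_measureD[OF F]
  note [measurable_cong] = L(1)
  show ?thesis
  proof (rule Bochner_Integration.integrable_bound)
    show "integrable F (\<lambda>\<theta>. min 1 ((norm \<theta>)\<^sup>2) + norm (indicator nonneg_orthant \<theta> *\<^sub>R trunc \<theta>))"
      using L(3) tr unfolding set_integrable_def by (intro Bochner_Integration.integrable_add integrable_norm)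
    show "AE \<theta> in F. norm (min 1 (norm \<theta>)) \<le> norm (min 1 ((norm \<theta>)\<^sup>2) + norm (indicator nonneg_orthant \<theta> *\<^sub>R trunc \<theta>))"
      using orth by eventually_elim (auto simp: trunc_def min_def)
  qed measurable
qed

text \<open>As \<open>\<chi>\<close> is \<open>F\<close>-integrable, the compensator can be taken out of the integral; it turns the drift
\<open>a\<close> into \<open>a\<^sub>0\<close>.\<close>

lemma pure_jump_exponent:
  fixes F :: "(real ^ 'd::finite) measure"
  assumes F: "levy_measure UNIV F" and orth: "AE \<theta> in F. \<theta> \<in> nonneg_orthant"
    and tr: "set_integrable F nonneg_orthant trunc"
    and a0: "a0 = a - (LINT \<theta>:nonneg_orthant|F. trunc \<theta>)"
  shows "integrable F (\<lambda>\<theta>. iexp (u \<bullet> \<theta>) - 1)"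
    and "levy_exponent a (\<lambda>_. 0) F u = \<i> * of_real (u \<bullet> a0) + (CLINT \<theta>|F. iexp (u \<bullet> \<theta>) - 1)"
proof -
  note L = levy_measureD[OF F]
  note [measurable_cong] = L(1)
  show int: "integrable F (\<lambda>\<theta>. iexp (u \<bullet> \<theta>) - 1)"
  proof (rule Bochner_Integration.integrable_bound)
    show "integrable F (\<lambda>\<theta>. (2 + norm u) * min 1 (norm \<theta>))"
      using integrable_min_1_norm[OF F orth tr] by simp
    have "cmod (iexp (u \<bullet> \<theta>) - 1) \<le> (2 + norm u) * min 1 (norm \<theta>)" for \<theta> :: "real ^ 'd"
    proof (cases "norm \<theta> \<le> 1")
      case True
      have "cmod (iexp (u \<bullet> \<theta>) - 1) \<le> \<bar>u \<bullet> \<theta>\<bar>" using iexp_approx1[of "u \<bullet> \<theta>" 0] by simp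
      also have "\<dots> \<le> norm u * norm \<theta>" by (rule Cauchy_Schwarz_ineq2)
      also have "\<dots> \<le> (2 + norm u) * norm \<theta>" by (intro mult_right_mono) auto
      finally show ?thesis using True by simp
    next
      case False
      then show ?thesis
        using norm_triangle_ineq4[of "iexp (u \<bullet> \<theta>)" 1] by (simp add: add_increasing2)
    qed
    then show "AE \<theta> in F. cmod (iexp (u \<bullet> \<theta>) - 1) \<le> norm ((2 + norm u) * min 1 (norm \<theta>))"
      by (intro AE_I2) (auto intro: order_trans[OF _ abs_ge_self])
  qed measurable
  have trunc_int: "integrable F (trunc :: real ^ 'd \<Rightarrow> _)"
    using tr unfolding set_integrable_def
    by (rule integrable_cong_AE_imp) (use orth in \<open>auto elim: eventually_mono\<close>)
  have trunc_eq: "(LINT \<theta>:nonneg_orthant|F. trunc \<theta>) = (LINT \<theta>|F. trunc \<theta>)"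
    unfolding set_lebesgue_integral_def
    by (rule integral_cong_AE) (use orth in \<open>auto elim: eventually_mono\<close>)
  have "(CLINT \<theta>|F. iexp (u \<bullet> \<theta>) - 1 - \<i> * of_real (u \<bullet> trunc \<theta>)) =
      (CLINT \<theta>|F. iexp (u \<bullet> \<theta>) - 1) - \<i> * of_real (u \<bullet> (LINT \<theta>|F. trunc \<theta>))"
    using int trunc_int by simp
  then show "levy_exponent a (\<lambda>_. 0) F u = \<i> * of_real (u \<bullet> a0) + (CLINT \<theta>|F. iexp (u \<bullet> \<theta>) - 1)"
    unfolding levy_exponent_def a0 trunc_eq by (simp add: inner_diff_right algebra_simps)
qed

text \<open>Write \<open>w = - c + i v\<close> with \<open>c\<close> in the orthant. Along the complex line \<open>z \<mapsto> i v + z c\<close> both sides are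
functions of one variable, continuous on \<open>Re z \<le> 0\<close> and holomorphic inside. On the imaginary axis
they agree by the Levy--Khintchine formula, and \<open>z = - 1\<close> is the point \<open>w\<close>. So continuation in a
single variable replaces continuation in each coordinate.\<close>

proposition multivariate_subordinator_laplace:
  fixes F :: "(real ^ 'd::finite) measure" and \<Theta> :: "real \<Rightarrow> 'w \<Rightarrow> real ^ 'd" and w :: "'d \<Rightarrow> complex"
  assumes "prob_space M" and LC: "levy_characteristics M UNIV \<Theta> a (\<lambda>_. 0) F"
    and \<Theta>0: "\<And>t \<omega>. 0 \<le> t \<Longrightarrow> \<omega> \<in> space M \<Longrightarrow> \<Theta> t \<omega> \<in> nonneg_orthant"
    and orth: "AE \<theta> in F. \<theta> \<in> nonneg_orthant"
    and tr: "set_integrable F nonneg_orthant trunc"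
    and a0: "a0 = a - (LINT \<theta>:nonneg_orthant|F. trunc \<theta>)"
    and w: "\<And>j. Re (w j) \<le> 0" and t: "0 \<le> t"
  shows "integrable F (\<lambda>\<theta>. exp (\<Sum>j\<in>UNIV. w j * of_real (\<theta> $ j)) - 1)"
    and "(CLINT \<omega>|M. exp (\<Sum>j\<in>UNIV. w j * of_real (\<Theta> t \<omega> $ j))) =
      exp (of_real t * ((\<Sum>j\<in>UNIV. w j * of_real (a0 $ j))
        + (CLINT \<theta>|F. exp (\<Sum>j\<in>UNIV. w j * of_real (\<theta> $ j)) - 1)))"
proof -
  interpret prob_space M by fact
  note LD = levy_characteristicsD[OF LC]
  note L = levy_measureD[OF LD(4)]
  note [measurable_cong] = L(1)
  have [measurable]: "\<Theta> t \<in> borel_measurable M" using levy_processD(1)[OF LD(1) t] .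
  note PJ = pure_jump_exponent[OF LD(4) orth tr a0]
  define v c :: "real ^ 'd" where "v = (\<chi> j. Im (w j))" and "c = (\<chi> j. - Re (w j))"
  \<comment> \<open>\<open>S\<close> uses positive parts to be nonnegative everywhere, not only on the orthant that carries \<open>F\<close>.\<close>
  define S where "S \<theta> = (\<Sum>j\<in>UNIV. c $ j * max 0 (\<theta> $ j))" for \<theta> :: "real ^ 'd"
  define Y where "Y \<theta> = iexp (v \<bullet> \<theta>)" for \<theta> :: "real ^ 'd"
  have [measurable]: "S \<in> borel_measurable borel" "Y \<in> borel_measurable borel"
    unfolding S_def Y_def by measurable
  have S0: "0 \<le> S \<theta>" for \<theta> unfolding S_def using w by (intro sum_nonneg) (auto simp: c_def mult_nonpos_nonneg)
  have S_orth: "S \<theta> = c \<bullet> \<theta>" if "\<theta> \<in> nonneg_orthant" for \<theta>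
    using that by (auto simp: S_def inner_vec_def nonneg_orthant_def intro!: sum.cong)
  have Y1: "cmod (Y \<theta>) = 1" for \<theta> by (simp add: Y_def)
  have YS: "Y \<theta> * exp (z * of_real (S \<theta>)) =
      exp (\<i> * of_real (v \<bullet> \<theta>) + z * of_real (c \<bullet> \<theta>))" if "\<theta> \<in> nonneg_orthant" for \<theta> z
    using S_orth[OF that] by (simp add: Y_def exp_add)
  have w_eq: "(\<Sum>j\<in>UNIV. w j * of_real (\<theta> $ j)) =
      \<i> * of_real (v \<bullet> \<theta>) + (- 1) * of_real (c \<bullet> \<theta>)" for \<theta>
  proof -
    have "w j = \<i> * of_real (v $ j) - of_real (c $ j)" for j
      by (simp add: v_def c_def complex_eq_iff)
    then have "(\<Sum>j\<in>UNIV. w j * of_real (\<theta> $ j)) =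
        (\<Sum>j\<in>UNIV. (\<i> * of_real (v $ j) - of_real (c $ j)) * of_real (\<theta> $ j))"
      by (intro sum.cong refl) presburger
    then show ?thesis
      by (simp add: inner_vec_def left_diff_distrib sum_subtractf sum_distrib_left sum_negf mult.assoc)
  qed
  have Y_int: "integrable F (\<lambda>\<theta>. Y \<theta> - 1)" unfolding Y_def by (rule PJ(1))
  have S_int: "integrable F (\<lambda>\<theta>. min 1 (S \<theta>))"
  proof (rule Bochner_Integration.integrable_bound)
    show "integrable F (\<lambda>\<theta>. (1 + norm c) * min 1 (norm \<theta>))"
      using integrable_min_1_norm[OF LD(4) orth tr] by simp
    show "AE \<theta> in F. norm (min 1 (S \<theta>)) \<le> norm ((1 + norm c) * min 1 (norm \<theta>))"
      using orth
    proof eventually_elim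
      fix \<theta> :: "real ^ 'd" assume "\<theta> \<in> nonneg_orthant"
      then have "S \<theta> \<le> norm c * norm \<theta>" using norm_cauchy_schwarz[of c \<theta>] S_orth by simp
      also have "\<dots> \<le> (1 + norm c) * norm \<theta>" by (intro mult_right_mono) auto
      finally show "norm (min 1 (S \<theta>)) \<le> norm ((1 + norm c) * min 1 (norm \<theta>))"
        using S0[of \<theta>] norm_ge_zero[of c] unfolding min_def by (auto simp del: norm_ge_zero)
    qed
  qed measurable
  let ?GF = "\<lambda>z. CLINT \<theta>|F. Y \<theta> * exp (z * of_real (S \<theta>)) - 1"
  let ?GM = "\<lambda>z. CLINT \<omega>|M. Y (\<Theta> t \<omega>) * exp (z * of_real (S (\<Theta> t \<omega>))) - 1"
  have YM_int: "integrable M (\<lambda>\<omega>. Y (\<Theta> t \<omega>) - 1)" "integrable M (\<lambda>\<omega>. min 1 (S (\<Theta> t \<omega>)))"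
    using Y1 S0 by (auto intro!: integrable_const_bound[where B = 1] Bochner_Integration.integrable_diff)
  have mM: "(\<lambda>\<omega>. S (\<Theta> t \<omega>)) \<in> borel_measurable M" "(\<lambda>\<omega>. Y (\<Theta> t \<omega>)) \<in> borel_measurable M"
    and mF: "S \<in> borel_measurable F" "Y \<in> borel_measurable F" by measurable
  note GF = laplace_integrand_integrable[OF mF S0 Y1 Y_int S_int]
    laplace_integral_continuous[OF mF S0 Y1 Y_int S_int] laplace_integral_holomorphic[OF mF S0 Y1 Y_int S_int]
  note GM = laplace_integrand_integrable[OF mM S0 Y1 YM_int]
    laplace_integral_continuous[OF mM S0 Y1 YM_int] laplace_integral_holomorphic[OF mM S0 Y1 YM_int]
  have GF_eq: "?GF z = (CLINT \<theta>|F. exp (\<i> * of_real (v \<bullet> \<theta>) + z * of_real (c \<bullet> \<theta>)) - 1)" for z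
    by (rule integral_cong_AE) (use orth YS in \<open>auto elim: eventually_mono\<close>)
  have GM_eq: "?GM z + 1 = (CLINT \<omega>|M. exp (\<i> * of_real (v \<bullet> \<Theta> t \<omega>) + z * of_real (c \<bullet> \<Theta> t \<omega>)))"
    if "Re z \<le> 0" for z
  proof -
    have "?GM z + 1 = (CLINT \<omega>|M. (Y (\<Theta> t \<omega>) * exp (z * of_real (S (\<Theta> t \<omega>))) - 1) + 1)"
      using GM(1)[OF that] by (subst Bochner_Integration.integral_add) (auto simp: prob_space)
    also have "\<dots> = (CLINT \<omega>|M. exp (\<i> * of_real (v \<bullet> \<Theta> t \<omega>) + z * of_real (c \<bullet> \<Theta> t \<omega>)))"
      using YS \<Theta>0[OF t] by (intro Bochner_Integration.integral_cong) auto
    finally show ?thesis .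
  qed
  let ?g = "\<lambda>z. exp (of_real t * (\<i> * of_real (v \<bullet> a0) + z * of_real (c \<bullet> a0) + ?GF z))"
  have "?GM z + 1 = ?g z" if z: "Re z \<le> 0" for z
  proof (rule holomorphic_left_half_plane_unique[where f = "\<lambda>z. ?GM z + 1" and g = ?g, OF _ _ _ _ _ z])
    show "continuous_on {z. Re z \<le> 0} (\<lambda>z. ?GM z + 1)" using GM(2) by (intro continuous_intros)
    show "continuous_on {z. Re z \<le> 0} ?g" using GF(2) by (intro continuous_intros)
    show "(\<lambda>z. ?GM z + 1) holomorphic_on {z. Re z < 0}" using GM(3) by (intro holomorphic_intros)
    show "?g holomorphic_on {z. Re z < 0}"
      using GF(3) holomorphic_on_exp by (intro holomorphic_intros)
    show "?GM (\<i> * of_real y) + 1 = ?g (\<i> * of_real y)" for y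
    proof -
      have comb: "\<i> * of_real (v \<bullet> \<theta>) + \<i> * of_real y * of_real (c \<bullet> \<theta>) =
          \<i> * of_real ((v + y *\<^sub>R c) \<bullet> \<theta>)" for \<theta>
        by (simp add: inner_add_left algebra_simps)
      have "?GM (\<i> * of_real y) + 1 = (CLINT \<omega>|M. iexp ((v + y *\<^sub>R c) \<bullet> \<Theta> t \<omega>))"
        by (subst GM_eq) (simp_all add: comb)
      also have "\<dots> = exp (of_real t * levy_exponent a (\<lambda>_. 0) F (v + y *\<^sub>R c))"
        by (rule LD(5)[OF t]) simp
      also have "\<dots> = ?g (\<i> * of_real y)"
        unfolding PJ(2) GF_eq comb ..
      finally show ?thesis .
    qed
  qed
  from this[of "- 1"] show "(CLINT \<omega>|M. exp (\<Sum>j\<in>UNIV. w j * of_real (\<Theta> t \<omega> $ j))) =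
      exp (of_real t * ((\<Sum>j\<in>UNIV. w j * of_real (a0 $ j))
        + (CLINT \<theta>|F. exp (\<Sum>j\<in>UNIV. w j * of_real (\<theta> $ j)) - 1)))"
    unfolding w_eq using GM_eq[of "- 1"] GF_eq[of "- 1"] by simp
  have "integrable F (\<lambda>\<theta>. Y \<theta> * exp ((- 1) * of_real (S \<theta>)) - 1)" by (rule GF(1)) simp
  then show "integrable F (\<lambda>\<theta>. exp (\<Sum>j\<in>UNIV. w j * of_real (\<theta> $ j)) - 1)"
    unfolding w_eq
  proof (rule integrable_cong_AE_imp)
    show "AE \<theta> in F. Y \<theta> * exp (- 1 * of_real (S \<theta>)) - 1 =
        exp (\<i> * of_real (v \<bullet> \<theta>) + - 1 * of_real (c \<bullet> \<theta>)) - 1"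
      using orth by eventually_elim (simp only: YS)
  qed measurable
qed

section \<open>Finite products of Hilbert spaces\<close>

lemma vec_eq_sum_axis:
  fixes u :: "'a::real_vector ^ 'd::finite"
  shows "u = (\<Sum>j\<in>UNIV. axis j (u $ j))"
  by (simp add: vec_eq_iff axis_def if_distrib sum.If_cases cong: if_cong)

lemma subspace_closure:
  fixes S :: "'a::real_normed_vector set"
  assumes "subspace S"
  shows "subspace (closure S)"
  unfolding subspace_def
proof (intro conjI ballI allI)
  show "0 \<in> closure S" using subspace_0[OF assms] closure_subset by blast
  show "x + y \<in> closure S" if xy: "x \<in> closure S" "y \<in> closure S" for x y
  proof -
    obtain f g where "\<forall>n. f n \<in> S" "f \<longlonglongrightarrow> x" "\<forall>n. g n \<in> S" "g \<longlonglongrightarrow> y"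
      using xy unfolding closure_sequential by blast
    then show ?thesis
      unfolding closure_sequential
      by (intro exI[of _ "\<lambda>n. f n + g n"]) (auto intro: subspace_add[OF assms] tendsto_add)
  qed
  show "c *\<^sub>R x \<in> closure S" if x: "x \<in> closure S" for c x
  proof -
    obtain f where "\<forall>n. f n \<in> S" "f \<longlonglongrightarrow> x"
      using x unfolding closure_sequential by blast
    then show ?thesis
      unfolding closure_sequential
      by (intro exI[of _ "\<lambda>n. c *\<^sub>R f n"]) (auto intro: subspace_scale[OF assms] tendsto_scaleR)
  qed
qed

lemma norm_axis: "norm (axis j x :: 'a::real_inner ^ 'd::finite) = norm x"
  by (simp add: norm_eq_sqrt_inner inner_axis_axis)

lemma bounded_linear_axis: "bounded_linear (axis j :: 'a::real_inner \<Rightarrow> 'a ^ 'd::finite)"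
proof (rule bounded_linear_intro[where K = 1])
  show "norm (axis j x :: 'a ^ 'd) \<le> norm x * 1" for x :: 'a
    by (simp add: norm_axis)
qed (auto simp: axis_def vec_eq_iff)

lemma subspace_prod_space:
  assumes "\<And>j. subspace (H j)"
  shows "subspace (prod_space H)"
  using assms by (auto simp: subspace_def prod_space_def)

lemma closed_prod_space:
  fixes H :: "'d::finite \<Rightarrow> 'a::real_normed_vector set"
  assumes "\<And>j. closed (H j)"
  shows "closed (prod_space H)"
proof -
  have "prod_space H = (\<Inter>j. (\<lambda>u. u $ j) -` H j)" by (auto simp: prod_space_def)
  then show ?thesis using assms by (auto intro!: continuous_closed_vimage continuous_intros)
qed

lemma orthonormal_basis_prod_space:
  fixes H :: "'d::finite \<Rightarrow> 'a::real_inner set"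
  assumes H: "\<And>j. subspace (H j)" "\<And>j. closed (H j)" and B: "\<And>j. orthonormal_basis_on (H j) (B j)"
  shows "orthonormal_basis_on (prod_space H) (\<Union>j. axis j ` B j)"
proof -
  let ?B = "\<Union>j. axis j ` B j"
  have Bj: "B j \<subseteq> H j" "pairwise orthogonal (B j)" "\<forall>e\<in>B j. norm e = 1" "closure (span (B j)) = H j" for j
    using B[of j] by (auto simp: orthonormal_basis_on_def)
  have "?B \<subseteq> prod_space H"
    using Bj(1) subspace_0[OF H(1)] by (force simp: prod_space_def axis_def)
  moreover have "pairwise orthogonal ?B"
  proof (rule pairwiseI)
    fix x y assume xy: "x \<in> ?B" "y \<in> ?B" "x \<noteq> y"
    then obtain i e j f where ef: "x = axis i e" "e \<in> B i" "y = axis j f" "f \<in> B j" by auto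
    show "orthogonal x y"
    proof (cases "i = j")
      case True
      then have "orthogonal e f" using ef xy Bj(2)[of i] by (auto simp: pairwise_def)
      then show ?thesis using True ef by (simp add: orthogonal_def inner_axis_axis)
    next
      case False
      then show ?thesis using ef by (simp add: orthogonal_def inner_axis_axis)
    qed
  qed
  moreover have "\<forall>e\<in>?B. norm e = 1" using Bj(3) by (auto simp: norm_axis)
  moreover have "closure (span ?B) = prod_space H"
  proof
    have "span ?B \<subseteq> prod_space H"
      using \<open>?B \<subseteq> prod_space H\<close> subspace_prod_space[OF H(1)] by (rule span_minimal)
    then show "closure (span ?B) \<subseteq> prod_space H" using closed_prod_space[OF H(2)] by (rule closure_minimal)
    show "prod_space H \<subseteq> closure (span ?B)"
    proof
      fix u assume "u \<in> prod_space H"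
      have sub: "axis j x \<in> closure (span ?B)" if "x \<in> H j" for j x
      proof -
        have "axis j ` span (B j) = span (axis j ` B j)"
          by (rule linear_span_image[symmetric]) (rule bounded_linear.linear[OF bounded_linear_axis])
        also have "\<dots> \<subseteq> span ?B" by (rule span_mono) auto
        finally have *: "axis j ` span (B j) \<subseteq> span ?B" .
        have "axis j ` closure (span (B j)) \<subseteq> closure (span ?B)"
        proof (rule image_closure_subset)
          show "continuous_on (closure (span (B j))) (axis j)"
            using bounded_linear_axis by (rule linear_continuous_on)
          show "axis j ` span (B j) \<subseteq> closure (span ?B)" using * closure_subset by blast
        qed simp
        then show ?thesis using that Bj(4)[of j] by auto
      qed
      have "(\<Sum>j\<in>UNIV. axis j (u $ j)) \<in> closure (span ?B)"
        using \<open>u \<in> prod_space H\<close>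
        by (intro subspace_sum subspace_closure subspace_span sub) (auto simp: prod_space_def)
      then show "u \<in> closure (span ?B)" using vec_eq_sum_axis[of u] by simp
    qed
  qed
  ultimately show ?thesis unfolding orthonormal_basis_on_def by blast
qed

text \<open>The trace is the sum of the coordinate traces, taken over the disjoint union of the embedded
bases.\<close>

lemma covariance_operator_coordinatewise:
  fixes H :: "'d::finite \<Rightarrow> 'a::real_inner set" and Q :: "'d \<Rightarrow> 'a \<Rightarrow> 'a"
  assumes H: "\<And>j. subspace (H j)" "\<And>j. closed (H j)"
    and Q: "\<And>j. covariance_operator (H j) (Q j)" and c: "\<And>j. 0 \<le> c j"
  shows "covariance_operator (prod_space H) (\<lambda>u. \<chi> j. c j *\<^sub>R Q j (u $ j))" (is "covariance_operator _ ?G")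
proof -
  have Qc: "\<And>j x. x \<in> H j \<Longrightarrow> Q j x \<in> H j"
    "\<And>j x y. x \<in> H j \<Longrightarrow> y \<in> H j \<Longrightarrow> Q j (x + y) = Q j x + Q j y"
    "\<And>j r x. x \<in> H j \<Longrightarrow> Q j (r *\<^sub>R x) = r *\<^sub>R Q j x"
    "\<And>j. \<exists>K. \<forall>x\<in>H j. norm (Q j x) \<le> K * norm x"
    "\<And>j x y. x \<in> H j \<Longrightarrow> y \<in> H j \<Longrightarrow> Q j x \<bullet> y = x \<bullet> Q j y"
    "\<And>j x. x \<in> H j \<Longrightarrow> 0 \<le> Q j x \<bullet> x"
    "\<And>j. \<exists>B. orthonormal_basis_on (H j) B \<and> (\<lambda>e. Q j e \<bullet> e) summable_on B"
    using Q unfolding covariance_operator_def by blast+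
  have Q0: "Q j 0 = 0" for j using Qc(3)[of 0 j 0] subspace_0[OF H(1)] by simp
  have mem: "u $ j \<in> H j" if "u \<in> prod_space H" for u j using that by (simp add: prod_space_def)
  obtain K where K: "\<And>j x. x \<in> H j \<Longrightarrow> norm (Q j x) \<le> K j * norm x" using Qc(4) by metis
  obtain B where B: "\<And>j. orthonormal_basis_on (H j) (B j)" "\<And>j. (\<lambda>e. Q j e \<bullet> e) summable_on B j"
    using Qc(7) by metis
  have bound: "norm (?G u) \<le> (\<Sum>j\<in>UNIV. c j * \<bar>K j\<bar>) * norm u" if u: "u \<in> prod_space H" for u
  proof -
    have "norm (?G u) \<le> (\<Sum>j\<in>UNIV. norm (?G u $ j))" unfolding norm_vec_def by (rule L2_set_le_sum) simp
    also have "\<dots> \<le> (\<Sum>j\<in>UNIV. c j * \<bar>K j\<bar> * norm u)"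
    proof (rule sum_mono)
      fix j
      have "norm (Q j (u $ j)) \<le> K j * norm (u $ j)" using K mem[OF u] .
      also have "\<dots> \<le> \<bar>K j\<bar> * norm u" by (intro mult_mono Finite_Cartesian_Product.norm_nth_le) auto
      finally have "c j * norm (Q j (u $ j)) \<le> c j * (\<bar>K j\<bar> * norm u)" using c by (intro mult_left_mono)
      then show "norm (?G u $ j) \<le> c j * \<bar>K j\<bar> * norm u" using c by simp
    qed
    finally show ?thesis by (simp add: sum_distrib_right)
  qed
  have trace: "(\<lambda>e. ?G e \<bullet> e) summable_on (\<Union>j. axis j ` B j)"
  proof -
    have "(\<lambda>e. ?G e \<bullet> e) summable_on axis j ` B j" for j
    proof -
      have "inj_on (axis j) (B j)" by (auto simp: inj_on_def axis_eq_axis)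
      moreover have "((\<lambda>e. ?G e \<bullet> e) \<circ> axis j) = (\<lambda>e. c j * (Q j e \<bullet> e))"
        by (auto simp: fun_eq_iff inner_axis)
      ultimately show ?thesis
        using B(2)[of j] by (subst summable_on_reindex) (auto intro: summable_on_cmult_right)
    qed
    moreover have "disjoint_family_on (\<lambda>j. axis j ` B j) UNIV"
    proof -
      have "e \<noteq> 0" if "e \<in> B j" for e j using B(1)[of j] that by (auto simp: orthonormal_basis_on_def)
      then show ?thesis by (auto simp: disjoint_family_on_def axis_eq_axis)
    qed
    ultimately show ?thesis
      by (intro summable_on_finite_union_disjoint) (auto simp: disjoint_family_on_def)
  qed
  show ?thesis
    unfolding covariance_operator_def
  proof (intro conjI)
    show "\<forall>x\<in>prod_space H. ?G x \<in> prod_space H"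
      using Qc(1) subspace_scale[OF H(1)] by (auto simp: prod_space_def)
    show "\<forall>x\<in>prod_space H. \<forall>y\<in>prod_space H. ?G (x + y) = ?G x + ?G y"
      using mem by (auto simp: vec_eq_iff Qc(2) scaleR_add_right)
    show "\<forall>r. \<forall>x\<in>prod_space H. ?G (r *\<^sub>R x) = r *\<^sub>R ?G x"
      using mem by (auto simp: vec_eq_iff Qc(3))
    show "\<exists>K. \<forall>x\<in>prod_space H. norm (?G x) \<le> K * norm x" using bound by blast
    show "\<forall>x\<in>prod_space H. \<forall>y\<in>prod_space H. ?G x \<bullet> y = x \<bullet> ?G y"
      using mem by (auto simp: inner_vec_def Qc(5) intro!: sum.cong)
    show "\<forall>x\<in>prod_space H. 0 \<le> ?G x \<bullet> x"
      using mem c by (auto simp: inner_vec_def Qc(6) intro!: sum_nonneg)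
    show "\<exists>B. orthonormal_basis_on (prod_space H) B \<and> (\<lambda>e. ?G e \<bullet> e) summable_on B"
      using orthonormal_basis_prod_space[of H B, OF H B(1)] trace by blast
  qed
qed

text \<open>Unless some coordinate is truncated, both sides are the squared norm.\<close>

lemma min_1_norm_vec_le:
  fixes x :: "'a::real_inner ^ 'd::finite"
  shows "min 1 ((norm x)\<^sup>2) \<le> (\<Sum>j\<in>UNIV. min 1 ((norm (x $ j))\<^sup>2))"
proof (cases "\<forall>j. (norm (x $ j))\<^sup>2 \<le> 1")
  case True
  then have "(\<Sum>j\<in>UNIV. min 1 ((norm (x $ j))\<^sup>2)) = (\<Sum>j\<in>UNIV. (norm (x $ j))\<^sup>2)"
    by (intro sum.cong refl min_absorb2) blast
  also have "\<dots> = (norm x)\<^sup>2" by (simp add: power2_norm_eq_inner inner_vec_def)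
  finally have "(\<Sum>j\<in>UNIV. min 1 ((norm (x $ j))\<^sup>2)) = (norm x)\<^sup>2" .
  then show ?thesis by simp
next
  case False
  then obtain j where "1 < (norm (x $ j))\<^sup>2" by (auto simp: not_le)
  then have "1 = min 1 ((norm (x $ j))\<^sup>2)" by simp
  also have "\<dots> \<le> (\<Sum>j\<in>UNIV. min 1 ((norm (x $ j))\<^sup>2))" by (rule member_le_sum) auto
  finally show ?thesis by simp
qed

lemma trunc_axis: "trunc (axis j x :: 'a::real_inner ^ 'd::finite) = axis j (trunc x)"
proof -
  have "axis j (0 :: 'a) = (0 :: 'a ^ 'd)" by (simp add: vec_eq_iff axis_def)
  then show ?thesis by (simp add: trunc_def norm_axis)
qed

lemma measurable_vec_nth [measurable]:
  "(\<lambda>u. u $ j) \<in> borel_measurable (borel :: ('a::{real_normed_vector, second_countable_topology} ^ 'd::finite) measure)"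
  by (intro borel_measurable_continuous_onI continuous_intros)

lemma measurable_axis [measurable]:
  "axis j \<in> measurable borel (borel :: ('a::{real_inner, second_countable_topology} ^ 'd::finite) measure)"
  by (intro borel_measurable_continuous_onI linear_continuous_on bounded_linear_axis)

lemma measurable_vec_lambda [measurable (raw)]:
  fixes f :: "'d::finite \<Rightarrow> 'w \<Rightarrow> 'a::{real_inner, second_countable_topology}"
  assumes [measurable]: "\<And>j. f j \<in> borel_measurable M"
  shows "(\<lambda>x. \<chi> j. f j x) \<in> borel_measurable M"
proof -
  have "(\<lambda>x. \<chi> j. f j x) = (\<lambda>x. \<Sum>j\<in>UNIV. axis j (f j x))"
    using vec_eq_sum_axis[of "\<chi> j. f j _"] by (simp add: fun_eq_iff)
  then show ?thesis by simp
qed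

section \<open>Mixtures of measures\<close>

text \<open>The kernel and \<open>F\<close> are arbitrary, and \<open>F\<close> may fail to be \<open>\<sigma>\<close>-finite (it may have infinite mass at
0), so this measure cannot be obtained from a product measure; it is built from the set function.\<close>

definition mixture_measure ::
  "('i \<Rightarrow> real) \<Rightarrow> ('i::finite \<Rightarrow> 'a::topological_space measure) \<Rightarrow> 'b measure \<Rightarrow> ('b \<Rightarrow> 'a measure) \<Rightarrow> 'a measure" where
  "mixture_measure c \<nu> F \<kappa> = measure_of UNIV (sets borel)
     (\<lambda>A. (\<Sum>j\<in>UNIV. ennreal (c j) * emeasure (\<nu> j) A) + (\<integral>\<^sup>+ \<theta>. emeasure (\<kappa> \<theta>) A \<partial>F))"

lemma sets_mixture_measure [simp, measurable_cong]: "sets (mixture_measure c \<nu> F \<kappa>) = sets borel"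
  unfolding mixture_measure_def
  using sets.sigma_sets_eq[of "borel :: 'a measure"] by (simp add: sets_measure_of)

context
  fixes c :: "'i::finite \<Rightarrow> real" and \<nu> :: "'i \<Rightarrow> 'a::topological_space measure"
    and F :: "'b measure" and \<kappa> :: "'b \<Rightarrow> 'a measure"
  assumes \<nu>: "\<And>j. sets (\<nu> j) = sets borel" and \<kappa>: "\<And>\<theta>. sets (\<kappa> \<theta>) = sets borel"
    and \<kappa>_meas: "\<And>A. A \<in> sets borel \<Longrightarrow> (\<lambda>\<theta>. emeasure (\<kappa> \<theta>) A) \<in> borel_measurable F"
begin

abbreviation mix :: "'a measure" where
  "mix \<equiv> mixture_measure c \<nu> F \<kappa>"

lemma emeasure_mixture_measure:
  assumes "A \<in> sets borel"
  shows "emeasure (mix) A =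
    (\<Sum>j\<in>UNIV. ennreal (c j) * emeasure (\<nu> j) A) + (\<integral>\<^sup>+ \<theta>. emeasure (\<kappa> \<theta>) A \<partial>F)"
proof (rule emeasure_measure_of[OF mixture_measure_def])
  show "sets (borel :: 'a measure) \<subseteq> Pow UNIV" by simp
  show "A \<in> sets (mix)" using assms by simp
  let ?\<mu> = "\<lambda>A. (\<Sum>j\<in>UNIV. ennreal (c j) * emeasure (\<nu> j) A) + (\<integral>\<^sup>+ \<theta>. emeasure (\<kappa> \<theta>) A \<partial>F)"
  show "positive (sets (mix)) ?\<mu>" by (simp add: positive_def)
  show "countably_additive (sets (mix)) ?\<mu>"
  proof (rule countably_additiveI)
    fix A :: "nat \<Rightarrow> 'a set"
    assume A: "range A \<subseteq> sets (mix)" "disjoint_family A"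
    then have Ab: "A n \<in> sets borel" for n by auto
    have n: "emeasure (\<nu> j) (\<Union>n. A n) = (\<Sum>n. emeasure (\<nu> j) (A n))" for j
      using A by (intro suminf_emeasure[symmetric]) (auto simp: \<nu>)
    have k: "emeasure (\<kappa> \<theta>) (\<Union>n. A n) = (\<Sum>n. emeasure (\<kappa> \<theta>) (A n))" for \<theta>
      using A by (intro suminf_emeasure[symmetric]) (auto simp: \<kappa>)
    have "(\<Sum>n. ?\<mu> (A n)) = (\<Sum>n. \<Sum>j\<in>UNIV. ennreal (c j) * emeasure (\<nu> j) (A n))
        + (\<Sum>n. \<integral>\<^sup>+ \<theta>. emeasure (\<kappa> \<theta>) (A n) \<partial>F)"
      by (rule suminf_add[symmetric]) auto
    also have "(\<Sum>n. \<Sum>j\<in>UNIV. ennreal (c j) * emeasure (\<nu> j) (A n)) =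
        (\<Sum>j\<in>UNIV. ennreal (c j) * (\<Sum>n. emeasure (\<nu> j) (A n)))"
      by (subst suminf_sum) auto
    also have "(\<Sum>n. \<integral>\<^sup>+ \<theta>. emeasure (\<kappa> \<theta>) (A n) \<partial>F) = (\<integral>\<^sup>+ \<theta>. (\<Sum>n. emeasure (\<kappa> \<theta>) (A n)) \<partial>F)"
      using \<kappa>_meas[OF Ab] by (intro nn_integral_suminf[symmetric]) auto
    finally show "(\<Sum>n. ?\<mu> (A n)) = ?\<mu> (\<Union>n. A n)" by (simp add: n k)
  qed
qed

lemma nn_integral_kernel_measurable:
  fixes f :: "'a \<Rightarrow> ennreal"
  assumes "f \<in> borel_measurable borel"
  shows "(\<lambda>\<theta>. \<integral>\<^sup>+ x. f x \<partial>\<kappa> \<theta>) \<in> borel_measurable F"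
  using assms
proof (induction f rule: borel_measurable_induct)
  case (cong f g)
  then have "f = g" by (simp add: fun_eq_iff)
  with cong show ?case by simp
next
  case (set A)
  then show ?case using \<kappa>_meas by (simp add: \<kappa>)
next
  case (mult u c)
  then show ?case
    by (subst nn_integral_cmult) (auto simp: measurable_cong_sets[OF \<kappa> refl])
next
  case (add u v)
  then show ?case
    by (subst nn_integral_add) (auto simp: measurable_cong_sets[OF \<kappa> refl])
next
  case (seq U)
  have "(\<integral>\<^sup>+ x. (SUP i. U i) x \<partial>\<kappa> \<theta>) = (SUP i. \<integral>\<^sup>+ x. U i x \<partial>\<kappa> \<theta>)" for \<theta>
    unfolding SUP_apply using seq(1) \<open>incseq U\<close>
    by (intro nn_integral_monotone_convergence_SUP) (auto simp: measurable_cong_sets[OF \<kappa> refl])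
  then have "(\<lambda>\<theta>. \<integral>\<^sup>+ x. (SUP i. U i) x \<partial>\<kappa> \<theta>) = (\<lambda>\<theta>. SUP i. \<integral>\<^sup>+ x. U i x \<partial>\<kappa> \<theta>)" by blast
  moreover have "(\<lambda>\<theta>. SUP i. \<integral>\<^sup>+ x. U i x \<partial>\<kappa> \<theta>) \<in> borel_measurable F"
    using seq by (intro borel_measurable_SUP) auto
  ultimately show ?case by metis
qed

lemma nn_integral_mixture_measure:
  fixes f :: "'a \<Rightarrow> ennreal"
  assumes "f \<in> borel_measurable borel"
  shows "(\<integral>\<^sup>+ x. f x \<partial>mix) =
    (\<Sum>j\<in>UNIV. ennreal (c j) * (\<integral>\<^sup>+ x. f x \<partial>\<nu> j)) + (\<integral>\<^sup>+ \<theta>. \<integral>\<^sup>+ x. f x \<partial>\<kappa> \<theta> \<partial>F)"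
  using assms
proof (induction f rule: borel_measurable_induct)
  case (cong f g)
  then have "f = g" by (simp add: fun_eq_iff)
  with cong show ?case by simp
next
  case (set A)
  then show ?case by (simp add: emeasure_mixture_measure \<nu> \<kappa>)
next
  case (mult u r)
  have m: "u \<in> borel_measurable (\<nu> j)" "u \<in> borel_measurable (\<kappa> \<theta>)" for j \<theta>
    using mult(2) by (auto simp: measurable_cong_sets[OF \<nu> refl] measurable_cong_sets[OF \<kappa> refl])
  show ?case
    using mult m nn_integral_kernel_measurable[OF mult(2)]
    by (simp add: nn_integral_cmult distrib_left sum_distrib_left mult.left_commute)
next
  case (add u v)
  have m: "w \<in> borel_measurable (\<nu> j)" "w \<in> borel_measurable (\<kappa> \<theta>)" if "w \<in> borel_measurable borel" for w :: "'a \<Rightarrow> ennreal" and j \<theta>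
    using that by (auto simp: measurable_cong_sets[OF \<nu> refl] measurable_cong_sets[OF \<kappa> refl])
  have uv: "u \<in> borel_measurable borel" "v \<in> borel_measurable borel"
    "u \<in> borel_measurable (mix)" "v \<in> borel_measurable (mix)"
    using add.hyps by simp_all
  note k = nn_integral_kernel_measurable[OF uv(1)] nn_integral_kernel_measurable[OF uv(2)]
  have swap: "(p + q) + (r + s) = (p + r) + (q + s)" for p q r s :: ennreal
    by (simp add: ac_simps)
  show ?case
    unfolding nn_integral_add[OF uv(4) uv(3)] nn_integral_add[OF m(1)[OF uv(2)] m(1)[OF uv(1)]]
      nn_integral_add[OF m(2)[OF uv(2)] m(2)[OF uv(1)]] nn_integral_add[OF k(2) k(1)]
      distrib_left sum.distrib add.IH by (rule swap)
next
  case (seq U)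
  have m: "U i \<in> borel_measurable (\<nu> j)" "U i \<in> borel_measurable (\<kappa> \<theta>)" for i j \<theta>
    using seq(1) by (auto simp: measurable_cong_sets[OF \<nu> refl] measurable_cong_sets[OF \<kappa> refl])
  have inc: "incseq (\<lambda>i. \<integral>\<^sup>+ x. U i x \<partial>N)" for N
    using \<open>incseq U\<close> by (auto simp: incseq_def le_fun_def intro!: nn_integral_mono)
  have sup: "(\<integral>\<^sup>+ x. (SUP i. U i) x \<partial>N) = (SUP i. \<integral>\<^sup>+ x. U i x \<partial>N)"
    if "\<And>i. U i \<in> borel_measurable N" for N :: "'a measure"
    unfolding SUP_apply using \<open>incseq U\<close> that by (intro nn_integral_monotone_convergence_SUP) auto
  have 1: "(\<integral>\<^sup>+ \<theta>. (SUP i. \<integral>\<^sup>+ x. U i x \<partial>\<kappa> \<theta>) \<partial>F) = (SUP i. \<integral>\<^sup>+ \<theta>. \<integral>\<^sup>+ x. U i x \<partial>\<kappa> \<theta> \<partial>F)"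
    using inc nn_integral_kernel_measurable[OF seq(1)]
    by (intro nn_integral_monotone_convergence_SUP) (auto simp: incseq_def le_fun_def)
  have 2: "(\<Sum>j\<in>UNIV. ennreal (c j) * (SUP i. \<integral>\<^sup>+ x. U i x \<partial>\<nu> j)) =
      (SUP i. \<Sum>j\<in>UNIV. ennreal (c j) * (\<integral>\<^sup>+ x. U i x \<partial>\<nu> j))"
    unfolding SUP_mult_left_ennreal using inc
    by (intro ennreal_SUP_sum[symmetric]) (auto simp: incseq_def intro!: mult_left_mono)
  have "(\<integral>\<^sup>+ x. (SUP i. U i) x \<partial>mix) = (SUP i. \<integral>\<^sup>+ x. U i x \<partial>mix)"
    using seq(1) by (intro sup) auto
  also have "\<dots> = (SUP i. (\<Sum>j\<in>UNIV. ennreal (c j) * (\<integral>\<^sup>+ x. U i x \<partial>\<nu> j)) + (\<integral>\<^sup>+ \<theta>. \<integral>\<^sup>+ x. U i x \<partial>\<kappa> \<theta> \<partial>F))"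
    using seq.IH by (simp only:)
  also have "\<dots> = (SUP i. \<Sum>j\<in>UNIV. ennreal (c j) * (\<integral>\<^sup>+ x. U i x \<partial>\<nu> j)) + (SUP i. \<integral>\<^sup>+ \<theta>. \<integral>\<^sup>+ x. U i x \<partial>\<kappa> \<theta> \<partial>F)"
    using \<open>incseq U\<close> by (intro ennreal_SUP_add)
      (auto simp: incseq_def le_fun_def intro!: sum_mono mult_left_mono nn_integral_mono)
  finally show ?case
    unfolding 1[symmetric] 2[symmetric] sup[OF m(1)] sup[OF m(2)] .
qed

text \<open>Positive and negative parts reduce the claim to the formula for nonnegative integrands, where
finiteness of the integral over the mixture yields integrability over \<open>F\<close>.\<close>

lemma integral_mixture_measure_real:
  fixes f :: "'a \<Rightarrow> real"
  assumes c: "\<And>j. 0 \<le> c j" and f [measurable]: "f \<in> borel_measurable borel"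
    and f\<mu>: "integrable (mix) f"
    and f\<nu>: "\<And>j. integrable (\<nu> j) f" and f\<kappa>: "\<And>\<theta>. integrable (\<kappa> \<theta>) f"
  shows "integrable F (\<lambda>\<theta>. LINT x|\<kappa> \<theta>. f x)"
    and "(LINT x|mix. f x) =
    (\<Sum>j\<in>UNIV. c j * (LINT x|\<nu> j. f x)) + (LINT \<theta>|F. LINT x|\<kappa> \<theta>. f x)"
proof -
  define P where "P g \<longleftrightarrow> integrable F (\<lambda>\<theta>. LINT x|\<kappa> \<theta>. g x) \<and>
    (LINT x|mix. g x) = (\<Sum>j\<in>UNIV. c j * (LINT x|\<nu> j. g x)) + (LINT \<theta>|F. LINT x|\<kappa> \<theta>. g x)" for g
  have pos: "P g"
    if [measurable]: "g \<in> borel_measurable borel" and g\<mu>: "integrable (mix) g"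
    and g\<nu>: "\<And>j. integrable (\<nu> j) g" and g\<kappa>: "\<And>\<theta>. integrable (\<kappa> \<theta>) g" and g0: "\<And>x. 0 \<le> g x" for g
  proof -
    have k: "(\<integral>\<^sup>+ x. ennreal (g x) \<partial>\<kappa> \<theta>) = ennreal (LINT x|\<kappa> \<theta>. g x)" for \<theta>
      using g\<kappa> g0 by (intro nn_integral_eq_integral) auto
    have n: "(\<integral>\<^sup>+ x. ennreal (g x) \<partial>\<nu> j) = ennreal (LINT x|\<nu> j. g x)" for j
      using g\<nu> g0 by (intro nn_integral_eq_integral) auto
    have m: "(\<integral>\<^sup>+ x. ennreal (g x) \<partial>mix) = ennreal (LINT x|mix. g x)"
      using g\<mu> g0 by (intro nn_integral_eq_integral) auto
    have k0: "0 \<le> (LINT x|\<kappa> \<theta>. g x)" for \<theta> using g0 by (simp add: integral_nonneg_AE)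
    have k_meas: "(\<lambda>\<theta>. LINT x|\<kappa> \<theta>. g x) \<in> borel_measurable F"
    proof -
      have eq: "(\<lambda>\<theta>. LINT x|\<kappa> \<theta>. g x) = (\<lambda>\<theta>. enn2real (\<integral>\<^sup>+ x. ennreal (g x) \<partial>\<kappa> \<theta>))"
      proof
        fix \<theta> show "(LINT x|\<kappa> \<theta>. g x) = enn2real (\<integral>\<^sup>+ x. ennreal (g x) \<partial>\<kappa> \<theta>)"
          unfolding k enn2real_ennreal[OF k0] ..
      qed
      show ?thesis
        unfolding eq by (rule borel_measurable_enn2real[OF nn_integral_kernel_measurable
              [OF measurable_compose[OF that(1) measurable_ennreal]]])
    qed
    have s: "(\<Sum>j\<in>UNIV. ennreal (c j) * ennreal (LINT x|\<nu> j. g x)) = ennreal (\<Sum>j\<in>UNIV. c j * (LINT x|\<nu> j. g x))"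
      using c g0 by (simp add: ennreal_mult'[symmetric] integral_nonneg_AE sum_ennreal)
    have eq: "ennreal (LINT x|mix. g x) =
        ennreal (\<Sum>j\<in>UNIV. c j * (LINT x|\<nu> j. g x)) + (\<integral>\<^sup>+ \<theta>. ennreal (LINT x|\<kappa> \<theta>. g x) \<partial>F)"
      using nn_integral_mixture_measure[of "\<lambda>x. ennreal (g x)"] by (simp add: m n k s)
    have int: "integrable F (\<lambda>\<theta>. LINT x|\<kappa> \<theta>. g x)"
    proof (rule integrableI_nonneg[OF k_meas])
      show "AE \<theta> in F. 0 \<le> (LINT x|\<kappa> \<theta>. g x)" using k0 by simp
      have "(\<integral>\<^sup>+ \<theta>. ennreal (LINT x|\<kappa> \<theta>. g x) \<partial>F) \<le> ennreal (LINT x|mix. g x)"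
        unfolding eq by (simp add: add_increasing)
      then show "(\<integral>\<^sup>+ \<theta>. ennreal (LINT x|\<kappa> \<theta>. g x) \<partial>F) < \<infinity>" by (simp add: le_less_trans)
    qed
    have "ennreal (LINT x|mix. g x) =
        ennreal ((\<Sum>j\<in>UNIV. c j * (LINT x|\<nu> j. g x)) + (LINT \<theta>|F. LINT x|\<kappa> \<theta>. g x))"
      unfolding eq using int k0 c g0
      by (subst nn_integral_eq_integral)
         (auto intro!: ennreal_plus[symmetric] sum_nonneg integral_nonneg_AE mult_nonneg_nonneg)
    then have "(LINT x|mix. g x) =
        (\<Sum>j\<in>UNIV. c j * (LINT x|\<nu> j. g x)) + (LINT \<theta>|F. LINT x|\<kappa> \<theta>. g x)"
      using c g0 k0 by (subst (asm) ennreal_inj) (auto intro!: add_nonneg_nonneg sum_nonneg integral_nonneg_AE mult_nonneg_nonneg)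
    with int show ?thesis by (simp add: P_def)
  qed
  define p n where "p x = max 0 (f x)" and "n x = max 0 (- f x)" for x
  have [measurable]: "p \<in> borel_measurable borel" "n \<in> borel_measurable borel"
    unfolding p_def n_def by measurable
  have f_eq: "f x = p x - n x" for x by (auto simp: p_def n_def)
  have int: "integrable N p" "integrable N n" if "integrable N f" for N
    using that unfolding p_def n_def by auto
  have P: "P p" by (rule pos) (use int f\<mu> f\<nu> f\<kappa> in \<open>auto simp: p_def\<close>)
  have N: "P n" by (rule pos) (use int f\<mu> f\<nu> f\<kappa> in \<open>auto simp: n_def\<close>)
  have split: "(LINT x|K. f x) = (LINT x|K. p x) - (LINT x|K. n x)" if "integrable K f" for K
    unfolding f_eq using int[OF that] by simp
  show "integrable F (\<lambda>\<theta>. LINT x|\<kappa> \<theta>. f x)" unfolding split[OF f\<kappa>] using P N unfolding P_def by auto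
  show "(LINT x|mix. f x) =
    (\<Sum>j\<in>UNIV. c j * (LINT x|\<nu> j. f x)) + (LINT \<theta>|F. LINT x|\<kappa> \<theta>. f x)"
    unfolding split[OF f\<kappa>] split[OF f\<nu>] split[OF f\<mu>] using P N unfolding P_def
    by (simp add: sum_subtractf right_diff_distrib)
qed

lemma integral_mixture_measure:
  fixes f :: "'a \<Rightarrow> complex"
  assumes c: "\<And>j. 0 \<le> c j" and f: "f \<in> borel_measurable borel"
    and f\<mu>: "integrable (mix) f"
    and f\<nu>: "\<And>j. integrable (\<nu> j) f" and f\<kappa>: "\<And>\<theta>. integrable (\<kappa> \<theta>) f"
  shows "integrable F (\<lambda>\<theta>. CLINT x|\<kappa> \<theta>. f x)"
    and "(CLINT x|mix. f x) =
    (\<Sum>j\<in>UNIV. of_real (c j) * (CLINT x|\<nu> j. f x)) + (CLINT \<theta>|F. CLINT x|\<kappa> \<theta>. f x)"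
proof -
  have "(\<lambda>x. Re (f x)) \<in> borel_measurable borel" "(\<lambda>x. Im (f x)) \<in> borel_measurable borel"
    using f by simp_all
  note R = integral_mixture_measure_real[OF c this(1) integrable_Re[OF f\<mu>] integrable_Re[OF f\<nu>] integrable_Re[OF f\<kappa>]]
    and I = integral_mixture_measure_real[OF c this(2) integrable_Im[OF f\<mu>] integrable_Im[OF f\<nu>] integrable_Im[OF f\<kappa>]]
  show int: "integrable F (\<lambda>\<theta>. CLINT x|\<kappa> \<theta>. f x)"
  proof -
    have "integrable F (\<lambda>\<theta>. of_real (LINT x|\<kappa> \<theta>. Re (f x)) + \<i> * of_real (LINT x|\<kappa> \<theta>. Im (f x)))"
      using R(1) I(1) by (intro Bochner_Integration.integrable_add integrable_mult_right integrable_of_real)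
    then show ?thesis
      unfolding integral_Re[OF f\<kappa>] integral_Im[OF f\<kappa>] complex_eq[symmetric] .
  qed
  show "(CLINT x|mix. f x) =
    (\<Sum>j\<in>UNIV. of_real (c j) * (CLINT x|\<nu> j. f x)) + (CLINT \<theta>|F. CLINT x|\<kappa> \<theta>. f x)"
    using R(2) I(2)
    by (intro complex_eqI)
       (simp_all add: integral_Re[OF f\<mu>] integral_Im[OF f\<mu>] integral_Re[OF f\<kappa>] integral_Im[OF f\<kappa>]
         integral_Re[OF f\<nu>] integral_Im[OF f\<nu>] integral_Re[OF int] integral_Im[OF int])
qed

end

section \<open>Decoupling of independent processes\<close>

text \<open>A right-continuous path is the limit of its values at the grid points strictly to the right of
\<open>s\<close>, and these approximations involve countably many times only. Replacing \<open>s\<close> by \<open>max 0 s\<close> makes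
the map total on the line.\<close>

lemma jointly_measurable_right_continuous:
  fixes f :: "real \<Rightarrow> 'w \<Rightarrow> 'a::{real_normed_vector, second_countable_topology}"
  assumes meas: "\<And>t. 0 \<le> t \<Longrightarrow> f t \<in> borel_measurable N"
    and rc: "\<And>\<omega> t. \<omega> \<in> space N \<Longrightarrow> 0 \<le> t \<Longrightarrow> ((\<lambda>s. f s \<omega>) \<longlongrightarrow> f t \<omega>) (at_right t)"
  shows "(\<lambda>p. f (max 0 (snd p)) (fst p)) \<in> borel_measurable (N \<Otimes>\<^sub>M borel)"
proof -
  define k where "k n s = nat \<lfloor>max 0 s * real (Suc n)\<rfloor>" for n and s :: real
  define g where "g n s = (real (k n s) + 1) / real (Suc n)" for n s
  have g: "max 0 s < g n s" "g n s \<le> max 0 s + 1 / real (Suc n)" for n s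
  proof -
    have "real (k n s) = of_int \<lfloor>max 0 s * real (Suc n)\<rfloor>" by (simp add: k_def)
    then have "max 0 s * real (Suc n) < real (k n s) + 1" "real (k n s) \<le> max 0 s * real (Suc n)" by linarith+
    moreover have pos: "0 < real (Suc n)" by simp
    ultimately have "max 0 s < (real (k n s) + 1) / real (Suc n)" "real (k n s) / real (Suc n) \<le> max 0 s"
      unfolding pos_less_divide_eq[OF pos] pos_divide_le_eq[OF pos] by blast+
    then show "max 0 s < g n s" "g n s \<le> max 0 s + 1 / real (Suc n)"
      unfolding g_def add_divide_distrib by simp_all
  qed
  show ?thesis
  proof (rule borel_measurable_LIMSEQ_metric)
    show "(\<lambda>p. f (g n (snd p)) (fst p)) \<in> borel_measurable (N \<Otimes>\<^sub>M borel)" for n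
    proof -
      have k: "(\<lambda>p. k n (snd p)) \<in> measurable (N \<Otimes>\<^sub>M borel) (count_space UNIV)"
        unfolding k_def by measurable
      have m: "(\<lambda>p. f ((real i + 1) / real (Suc n)) (fst p)) \<in> borel_measurable (N \<Otimes>\<^sub>M (borel :: real measure))" for i
        by (rule measurable_compose[OF measurable_fst meas]) simp
      show ?thesis unfolding g_def by (rule measurable_compose_countable[OF m k])
    qed
    show "(\<lambda>n. f (g n (snd p)) (fst p)) \<longlonglongrightarrow> f (max 0 (snd p)) (fst p)"
      if "p \<in> space (N \<Otimes>\<^sub>M borel)" for p
    proof -
      let ?s = "max 0 (snd p)"
      have "(\<lambda>n. g n (snd p)) \<longlonglongrightarrow> ?s"
      proof (rule tendsto_sandwich[where f = "\<lambda>_. ?s" and h = "\<lambda>n. ?s + 1 / real (Suc n)"])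
        show "(\<lambda>n. ?s + 1 / real (Suc n)) \<longlonglongrightarrow> ?s"
          using tendsto_add[OF tendsto_const[of ?s] lim_1_over_n[THEN LIMSEQ_Suc]] by simp
      qed (use g less_imp_le in \<open>blast intro: always_eventually tendsto_const\<close>)+
      then have "filterlim (\<lambda>n. g n (snd p)) (at_right ?s) sequentially"
        using g(1) by (intro tendsto_imp_filterlim_at_right) (auto intro: always_eventually)
      then show ?thesis
        using rc[of "fst p" ?s] that by (auto simp: space_pair_measure intro: filterlim_compose)
    qed
  qed
qed

text \<open>The sigma-algebra generated by a process, as a measure space, so that measurability with respect
to it and products of such spaces can be expressed.\<close>

definition path_algebra :: "'w measure \<Rightarrow> (real \<Rightarrow> 'w \<Rightarrow> 'a::topological_space) \<Rightarrow> 'w measure" where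
  "path_algebra M X = vimage_algebra (space M) (\<lambda>\<omega>. \<lambda>t\<in>{0..}. X t \<omega>) (PiM {0..} (\<lambda>_. borel))"

lemma process_sigma_eq: "process_sigma M X = sets (path_algebra M X)"
  by (simp add: process_sigma_def path_algebra_def)

lemma space_path_algebra [simp]: "space (path_algebra M X) = space M"
  by (simp add: path_algebra_def)

lemma measurable_path_algebra:
  assumes "0 \<le> t"
  shows "X t \<in> borel_measurable (path_algebra M X)"
proof -
  have "(\<lambda>\<omega>. \<lambda>t\<in>{0..}. X t \<omega>) \<in> measurable (path_algebra M X) (PiM {0..} (\<lambda>_. borel))"
    unfolding path_algebra_def by (rule measurable_vimage_algebra1) (auto simp: space_PiM)
  from measurable_compose[OF this measurable_component_singleton[of t]] assms show ?thesis by simp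
qed

lemma measurable_path_algebra_le:
  assumes "\<And>t. 0 \<le> t \<Longrightarrow> X t \<in> borel_measurable M" "f \<in> measurable (path_algebra M X) N"
  shows "f \<in> measurable M N"
proof -
  have "(\<lambda>\<omega>. \<lambda>t\<in>{0..}. X t \<omega>) \<in> measurable M (PiM {0..} (\<lambda>_. borel))"
    using assms(1) by (intro measurable_restrict) auto
  then have "(\<lambda>\<omega>. \<omega>) \<in> measurable M (path_algebra M X)"
    unfolding path_algebra_def by (intro measurable_vimage_algebra2) auto
  from measurable_compose[OF this assms(2)] show ?thesis by simp
qed

context prob_space
begin

text \<open>Independence of two sub-sigma-algebras says that the diagonal embedding of the probability space
has a product law. So functionals of two paths can be decoupled without constructing
laws on a path space.\<close>

lemma distr_diagonal:
  assumes indep: "indep_set (sets N1) (sets N2)" and sp: "space N1 = space M" "space N2 = space M"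
  shows "(\<lambda>\<omega>. \<omega>) \<in> measurable M N1" "(\<lambda>\<omega>. \<omega>) \<in> measurable M N2"
    and "distr M (N1 \<Otimes>\<^sub>M N2) (\<lambda>\<omega>. (\<omega>, \<omega>)) = distr M N1 (\<lambda>\<omega>. \<omega>) \<Otimes>\<^sub>M distr M N2 (\<lambda>\<omega>. \<omega>)"
proof -
  have s: "sets N1 \<subseteq> events" "sets N2 \<subseteq> events"
    using indep_setD_ev1[OF indep] indep_setD_ev2[OF indep] by auto
  show m: "(\<lambda>\<omega>. \<omega>) \<in> measurable M N1" "(\<lambda>\<omega>. \<omega>) \<in> measurable M N2"
    using s sp by (auto simp: measurable_def sets.Int_space_eq2)
  have gen: "{(\<lambda>\<omega>. \<omega>) -` A \<inter> space M | A. A \<in> sets N} = sets N" if "space N = space M" for N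
  proof -
    have "(\<lambda>\<omega>. \<omega>) -` A \<inter> space M = A" if "A \<in> sets N" for A
      using sets.sets_into_space[OF that] \<open>space N = space M\<close> by auto
    then show ?thesis unfolding setcompr_eq_image by (simp cong: image_cong)
  qed
  have "sigma_sets (space M) (sets N1) = sets N1" "sigma_sets (space M) (sets N2) = sets N2"
    using sets.sigma_sets_eq[of N1] sets.sigma_sets_eq[of N2] sp by simp_all
  then have "indep_var N1 (\<lambda>\<omega>. \<omega>) N2 (\<lambda>\<omega>. \<omega>)"
    unfolding indep_var_eq gen[OF sp(1)] gen[OF sp(2)] using indep m by simp
  then show "distr M (N1 \<Otimes>\<^sub>M N2) (\<lambda>\<omega>. (\<omega>, \<omega>)) = distr M N1 (\<lambda>\<omega>. \<omega>) \<Otimes>\<^sub>M distr M N2 (\<lambda>\<omega>. \<omega>)"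
    unfolding indep_var_distribution_eq by simp
qed

lemma decoupling_nn_integral:
  assumes indep: "indep_set (sets N1) (sets N2)" and sp: "space N1 = space M" "space N2 = space M"
    and f: "f \<in> borel_measurable (N1 \<Otimes>\<^sub>M N2)"
  shows "(\<integral>\<^sup>+ \<omega>. f (\<omega>, \<omega>) \<partial>M) = (\<integral>\<^sup>+ \<omega>'. \<integral>\<^sup>+ \<omega>. f (\<omega>, \<omega>') \<partial>M \<partial>M)"
proof -
  note D = distr_diagonal[OF indep sp]
  let ?P1 = "distr M N1 (\<lambda>\<omega>. \<omega>)" and ?P2 = "distr M N2 (\<lambda>\<omega>. \<omega>)"
  interpret P1: prob_space ?P1 by (rule prob_space_distr[OF D(1)])
  interpret P2: prob_space ?P2 by (rule prob_space_distr[OF D(2)])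
  interpret P: pair_prob_space ?P1 ?P2 ..
  have "(\<lambda>\<omega>. (\<omega>, \<omega>)) \<in> measurable M (N1 \<Otimes>\<^sub>M N2)" using D(1,2) by (rule measurable_Pair)
  then have "(\<integral>\<^sup>+ \<omega>. f (\<omega>, \<omega>) \<partial>M) = (\<integral>\<^sup>+ p. f p \<partial>(?P1 \<Otimes>\<^sub>M ?P2))"
    using f by (simp add: D(3)[symmetric] nn_integral_distr)
  also have "\<dots> = (\<integral>\<^sup>+ \<omega>'. \<integral>\<^sup>+ \<omega>. f (\<omega>, \<omega>') \<partial>?P1 \<partial>?P2)"
    using f by (intro P.nn_integral_snd[symmetric]) (simp cong: measurable_cong_sets sets_pair_measure_cong)
  also have "\<dots> = (\<integral>\<^sup>+ \<omega>'. \<integral>\<^sup>+ \<omega>. f (\<omega>, \<omega>') \<partial>?P1 \<partial>M)"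
  proof (rule nn_integral_distr[OF D(2)])
    have "(\<lambda>\<omega>'. \<integral>\<^sup>+ \<omega>. f (\<omega>, \<omega>') \<partial>?P1) \<in> borel_measurable ?P2"
      using measurable_pair_swap[OF f]
      by (intro P1.borel_measurable_nn_integral) (simp cong: measurable_cong_sets sets_pair_measure_cong)
    then show "(\<lambda>\<omega>'. \<integral>\<^sup>+ \<omega>. f (\<omega>, \<omega>') \<partial>?P1) \<in> borel_measurable ?P2" .
  qed
  also have "\<dots> = (\<integral>\<^sup>+ \<omega>'. \<integral>\<^sup>+ \<omega>. f (\<omega>, \<omega>') \<partial>M \<partial>M)"
    using f D(1) sp(2) by (intro nn_integral_cong nn_integral_distr) auto
  finally show ?thesis .
qed

lemma decoupling_integral:
  fixes f :: "'a \<times> 'a \<Rightarrow> complex"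
  assumes indep: "indep_set (sets N1) (sets N2)" and sp: "space N1 = space M" "space N2 = space M"
    and f: "f \<in> borel_measurable (N1 \<Otimes>\<^sub>M N2)" and B: "\<And>p. cmod (f p) \<le> B"
  shows "(CLINT \<omega>|M. f (\<omega>, \<omega>)) = (CLINT \<omega>'|M. CLINT \<omega>|M. f (\<omega>, \<omega>'))"
proof -
  note D = distr_diagonal[OF indep sp]
  let ?P1 = "distr M N1 (\<lambda>\<omega>. \<omega>)" and ?P2 = "distr M N2 (\<lambda>\<omega>. \<omega>)"
  interpret P1: prob_space ?P1 by (rule prob_space_distr[OF D(1)])
  interpret P2: prob_space ?P2 by (rule prob_space_distr[OF D(2)])
  interpret P: pair_prob_space ?P1 ?P2 ..
  have f': "f \<in> borel_measurable (?P1 \<Otimes>\<^sub>M ?P2)"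
    using f by (simp cong: measurable_cong_sets sets_pair_measure_cong)
  have int: "integrable (?P1 \<Otimes>\<^sub>M ?P2) f"
    using B by (intro P.P.integrable_const_bound[where B = B] f') auto
  have "(\<lambda>\<omega>. (\<omega>, \<omega>)) \<in> measurable M (N1 \<Otimes>\<^sub>M N2)" using D(1,2) by (rule measurable_Pair)
  then have "(CLINT \<omega>|M. f (\<omega>, \<omega>)) = (CLINT p|?P1 \<Otimes>\<^sub>M ?P2. f p)"
    using f by (simp add: D(3)[symmetric] integral_distr)
  also have "\<dots> = (CLINT \<omega>'|?P2. CLINT \<omega>|?P1. f (\<omega>, \<omega>'))"
    using P.integral_snd[of "\<lambda>x y. f (x, y)"] int by simp
  also have "\<dots> = (CLINT \<omega>'|M. CLINT \<omega>|?P1. f (\<omega>, \<omega>'))"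
  proof (rule integral_distr[OF D(2)])
    have "(\<lambda>\<omega>'. CLINT \<omega>|?P1. f (\<omega>, \<omega>')) \<in> borel_measurable ?P2"
      using P.integrable_snd[of "\<lambda>x y. f (x, y)"] int by auto
    then show "(\<lambda>\<omega>'. CLINT \<omega>|?P1. f (\<omega>, \<omega>')) \<in> borel_measurable N2" by simp
  qed
  also have "\<dots> = (CLINT \<omega>'|M. CLINT \<omega>|M. f (\<omega>, \<omega>'))"
    using f D(1) sp(2) by (intro Bochner_Integration.integral_cong refl integral_distr) auto
  finally show ?thesis .
qed

text \<open>Independent coordinates have a joint law that is the product of their marginals, so the marginals
determine it.\<close>

lemma distr_vec_eq_of_indep_coordinates:
  fixes X Y :: "'d::finite \<Rightarrow> 'a \<Rightarrow> 'h::{real_inner, second_countable_topology}"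
  assumes X: "indep_vars (\<lambda>_. borel) X UNIV" and Y: "indep_vars (\<lambda>_. borel) Y UNIV"
    and eq: "\<And>j. distr M borel (X j) = distr M borel (Y j)"
  shows "distr M borel (\<lambda>\<omega>. \<chi> j. X j \<omega>) = distr M borel (\<lambda>\<omega>. \<chi> j. Y j \<omega>)"
proof -
  have rv: "X j \<in> borel_measurable M" "Y j \<in> borel_measurable M" for j
    using X Y by (auto simp: indep_vars_def)
  have joint: "distr M borel (\<lambda>\<omega>. \<chi> j. Z j \<omega>) =
      distr (PiM UNIV (\<lambda>j. distr M borel (Z j))) borel (\<lambda>f. \<chi> j. f j)"
    if Z: "indep_vars (\<lambda>_. borel) Z UNIV" for Z :: "'d \<Rightarrow> 'a \<Rightarrow> 'h"
  proof -
    have rv: "Z j \<in> borel_measurable M" for j using Z by (auto simp: indep_vars_def)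
    have "distr M (PiM UNIV (\<lambda>_. borel)) (\<lambda>\<omega>. \<lambda>j\<in>UNIV. Z j \<omega>) = PiM UNIV (\<lambda>j. distr M borel (Z j))"
      using Z rv by (subst indep_vars_iff_distr_eq_PiM[symmetric]) auto
    then have "distr (PiM UNIV (\<lambda>j. distr M borel (Z j))) borel (\<lambda>f. \<chi> j. f j) =
        distr (distr M (PiM UNIV (\<lambda>_. borel)) (\<lambda>\<omega>. \<lambda>j\<in>UNIV. Z j \<omega>)) borel (\<lambda>f. \<chi> j. f j)" by simp
    also have "\<dots> = distr M borel ((\<lambda>f. \<chi> j. f j) \<circ> (\<lambda>\<omega>. \<lambda>j\<in>UNIV. Z j \<omega>))"
      using rv by (intro distr_distr measurable_vec_lambda measurable_restrict) auto
    finally show ?thesis by (simp add: o_def restrict_def)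
  qed
  show ?thesis unfolding joint[OF X] joint[OF Y] eq ..
qed

end

section \<open>Paths of a time-changed process\<close>

text \<open>At a left limit \<open>l\<close> of \<open>g\<close> there are two cases: either \<open>g\<close> has reached \<open>l\<close> before and is constant from
then on, or it stays strictly below \<open>l\<close> and the left limit of \<open>f\<close> at \<open>l\<close> applies.\<close>

lemma cadlag_compose_mono:
  fixes f :: "real \<Rightarrow> 'a::topological_space" and g :: "real \<Rightarrow> real"
  assumes f: "cadlag f" and g: "cadlag g" and mono: "mono_on {0..} g" and g0: "\<And>t. 0 \<le> t \<Longrightarrow> 0 \<le> g t"
  shows "cadlag (\<lambda>t. f (g t))"
proof -
  have m: "g r \<le> g s" if "0 \<le> r" "r \<le> s" for r s
    using mono_onD[OF mono, of r s] that by simp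
  show ?thesis
    unfolding cadlag_def
  proof (intro conjI allI impI)
    fix t :: real assume t: "0 \<le> t"
    have "(f \<longlongrightarrow> f (g t)) (at_right (g t))" using f g0[OF t] by (simp add: cadlag_def)
    then have "continuous (at (g t) within {g t..}) f"
      by (simp add: continuous_within at_within_Ici_at_right)
    moreover have "eventually (\<lambda>s. g s \<in> {g t..}) (at_right t)"
      using t by (intro eventually_at_rightI[of t "t + 1"]) (auto intro: m)
    moreover have "(g \<longlongrightarrow> g t) (at_right t)" using g t by (simp add: cadlag_def)
    ultimately show "((\<lambda>t. f (g t)) \<longlongrightarrow> f (g t)) (at_right t)"
      by (rule continuous_within_tendsto_compose)
  next
    fix t :: real assume t: "0 < t"
    obtain l where l: "(g \<longlongrightarrow> l) (at_left t)" using g t by (auto simp: cadlag_def)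
    have le: "g s \<le> l" if s: "0 \<le> s" "s < t" for s
    proof (rule tendsto_lowerbound[OF l])
      show "eventually (\<lambda>r. g s \<le> g r) (at_left t)"
        using s by (intro eventually_at_leftI[of s]) (auto intro: m)
    qed simp
    show "\<exists>l. ((\<lambda>t. f (g t)) \<longlongrightarrow> l) (at_left t)"
    proof (cases "\<exists>s. 0 \<le> s \<and> s < t \<and> g s = l")
      case True
      then obtain s where s: "0 \<le> s" "s < t" "g s = l" by blast
      have "eventually (\<lambda>r. f (g r) = f l) (at_left t)"
      proof (rule eventually_at_leftI[of s])
        fix r assume r: "r \<in> {s<..<t}"
        then have "g s \<le> g r" using s by (auto intro: m)
        then have "g r = l" using le[of r] r s by auto
        then show "f (g r) = f l" by simp
      qed (use s in simp)
      then show ?thesis by (auto intro: tendsto_eventually)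
    next
      case False
      then have less: "g s < l" if "0 \<le> s" "s < t" for s using le[OF that] that by (auto simp: less_le)
      then have "0 < l" using g0[of 0] t by (force intro: le_less_trans)
      then obtain l' where "(f \<longlongrightarrow> l') (at_left l)" using f by (auto simp: cadlag_def)
      moreover have "filterlim g (at_left l) (at_left t)"
        using l less t by (intro tendsto_imp_filterlim_at_left eventually_at_leftI[of 0]) auto
      ultimately show ?thesis by (auto intro: filterlim_compose)
    qed
  qed
qed

lemma cadlag_vec:
  fixes f :: "'d::finite \<Rightarrow> real \<Rightarrow> 'a::topological_space"
  assumes "\<And>j. cadlag (f j)"
  shows "cadlag (\<lambda>t. \<chi> j. f j t)"
  unfolding cadlag_def
proof (intro conjI allI impI)
  show "((\<lambda>t. \<chi> j. f j t) \<longlongrightarrow> (\<chi> j. f j t)) (at_right t)" if "0 \<le> t" for t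
    using assms that by (intro vec_tendstoI) (auto simp: cadlag_def)
  show "\<exists>l. ((\<lambda>t. \<chi> j. f j t) \<longlongrightarrow> l) (at_left t)" if "0 < t" for t
  proof -
    have "\<forall>j. \<exists>l. (f j \<longlongrightarrow> l) (at_left t)" using assms \<open>0 < t\<close> unfolding cadlag_def by blast
    then obtain l where "\<And>j. (f j \<longlongrightarrow> l j) (at_left t)" by metis
    then show ?thesis by (intro exI[of _ "\<chi> j. l j"] vec_tendstoI) auto
  qed
qed

section \<open>Increments of the subordinated process\<close>

locale subordinated_levy = prob_space M
  for M :: "'w measure"
    and H :: "'d::finite \<Rightarrow> 'h::{real_inner, banach, second_countable_topology} set"
    and L :: "'d \<Rightarrow> real \<Rightarrow> 'w \<Rightarrow> 'h"
    and b :: "'d \<Rightarrow> 'h" and Q :: "'d \<Rightarrow> 'h \<Rightarrow> 'h" and \<nu> :: "'d \<Rightarrow> 'h measure"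
    and \<Theta> :: "real \<Rightarrow> 'w \<Rightarrow> real ^ 'd"
    and a a0 :: "real ^ 'd" and F :: "(real ^ 'd) measure" +
  assumes H_subspace: "\<And>j. subspace (H j)" and H_closed: "\<And>j. closed (H j)"
    and L_char: "\<And>j. levy_characteristics M (H j) (L j) (b j) (Q j) (\<nu> j)"
    and L_indep: "indep_sets (\<lambda>j. process_sigma M (L j)) UNIV"
    and \<Theta>_char: "levy_characteristics M UNIV \<Theta> a (\<lambda>_. 0) F"
    and \<Theta>_subordinator: "\<And>j. subordinator M (\<lambda>t \<omega>. \<Theta> t \<omega> $ j)"
    and L_\<Theta>_indep: "indep_set (process_sigma M (\<lambda>t \<omega>. \<chi> j. L j t \<omega>)) (process_sigma M \<Theta>)"
    and F_orthant: "AE \<theta> in F. \<theta> \<in> nonneg_orthant"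
    and F_trunc: "set_integrable F nonneg_orthant trunc"
    and a0_eq: "a0 = a - (LINT \<theta>:nonneg_orthant|F. trunc \<theta>)"
    and a0_orthant: "a0 \<in> nonneg_orthant"
begin

abbreviation pos :: "real ^ 'd \<Rightarrow> real ^ 'd" where
  "pos \<theta> \<equiv> \<chi> j. max 0 (\<theta> $ j)"

text \<open>Taking positive parts makes the process measurable in \<open>\<theta>\<close> and \<open>\<omega>\<close> on the whole space, since nothing is
known about \<open>L\<close> at negative times. On the orthant it is \<open>L(\<theta>)\<close>.\<close>

abbreviation L\<theta> :: "real ^ 'd \<Rightarrow> 'w \<Rightarrow> 'h ^ 'd" where
  "L\<theta> \<theta> \<omega> \<equiv> multi_time L (pos \<theta>) \<omega>"

definition X :: "real \<Rightarrow> 'w \<Rightarrow> 'h ^ 'd" where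
  "X t \<omega> = multi_time L (\<Theta> t \<omega>) \<omega>"

abbreviation "path_L \<equiv> path_algebra M (\<lambda>t \<omega>. \<chi> j. L j t \<omega>)"
abbreviation "path_\<Theta> \<equiv> path_algebra M \<Theta>"

lemma pos_id: "\<theta> \<in> nonneg_orthant \<Longrightarrow> pos \<theta> = \<theta>"
  by (simp add: nonneg_orthant_def vec_eq_iff max_def)

lemma pos_orthant: "pos \<theta> \<in> nonneg_orthant"
  by (simp add: nonneg_orthant_def)

lemmas L_levy = levy_processD[OF levy_characteristicsD(1)[OF L_char]]
lemmas \<Theta>_levy = levy_processD[OF levy_characteristicsD(1)[OF \<Theta>_char]]

lemma \<Theta>_mono: "\<omega> \<in> space M \<Longrightarrow> 0 \<le> s \<Longrightarrow> s \<le> t \<Longrightarrow> \<Theta> s \<omega> $ j \<le> \<Theta> t \<omega> $ j"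
  using \<Theta>_subordinator[of j] mono_onD[of "{0..}" "\<lambda>t. \<Theta> t \<omega> $ j" s t]
  unfolding subordinator_def by auto

lemma \<Theta>_orthant: "\<omega> \<in> space M \<Longrightarrow> 0 \<le> t \<Longrightarrow> \<Theta> t \<omega> \<in> nonneg_orthant"
  using \<Theta>_subordinator unfolding subordinator_def nonneg_orthant_def by auto

lemma \<Theta>_diff_orthant: "\<omega> \<in> space M \<Longrightarrow> 0 \<le> s \<Longrightarrow> s \<le> t \<Longrightarrow> \<Theta> t \<omega> - \<Theta> s \<omega> \<in> nonneg_orthant"
  using \<Theta>_mono by (simp add: nonneg_orthant_def)

lemma X_eq: "\<omega> \<in> space M \<Longrightarrow> 0 \<le> t \<Longrightarrow> X t \<omega> = L\<theta> (\<Theta> t \<omega>) \<omega>"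
  by (simp add: X_def pos_id[OF \<Theta>_orthant])

lemma L_measurable_path: "0 \<le> t \<Longrightarrow> L j t \<in> borel_measurable path_L"
  using measurable_compose[OF measurable_path_algebra[of t "\<lambda>t \<omega>. \<chi> j. L j t \<omega>" M] measurable_vec_nth[of j]]
  by simp

lemma L\<theta>_jointly_measurable:
  assumes N: "space N = space M" "\<And>j t. 0 \<le> t \<Longrightarrow> L j t \<in> borel_measurable N"
  shows "(\<lambda>p. L\<theta> (snd p) (fst p)) \<in> borel_measurable (N \<Otimes>\<^sub>M borel)"
proof -
  have L: "(\<lambda>p. L j (max 0 (snd p)) (fst p)) \<in> borel_measurable (N \<Otimes>\<^sub>M borel)" for j
    using N L_levy(6)[of _ j] by (intro jointly_measurable_right_continuous) (auto simp: cadlag_def)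
  have "(\<lambda>p. L j (max 0 (snd p $ j)) (fst p)) \<in> borel_measurable (N \<Otimes>\<^sub>M (borel :: (real ^ 'd) measure))" for j
  proof -
    have "(\<lambda>p. (fst p, (snd p) $ j)) \<in> measurable (N \<Otimes>\<^sub>M (borel :: (real ^ 'd) measure)) (N \<Otimes>\<^sub>M borel)"
      by measurable
    from measurable_compose[OF this L] show ?thesis by simp
  qed
  then show ?thesis unfolding multi_time_def by (simp add: measurable_vec_lambda)
qed

lemmas L\<theta>_measurable_path = L\<theta>_jointly_measurable[of path_L, OF _ L_measurable_path, simplified]
lemmas L\<theta>_measurable = L\<theta>_jointly_measurable[of M, OF refl L_levy(1)]

lemma L\<theta>_measurable_swap: "(\<lambda>p. L\<theta> (fst p) (snd p)) \<in> borel_measurable (borel \<Otimes>\<^sub>M M)"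
proof -
  have "(\<lambda>p. (snd p, fst p)) \<in> measurable (borel \<Otimes>\<^sub>M M) (M \<Otimes>\<^sub>M borel)" by measurable
  from measurable_compose[OF this L\<theta>_measurable] show ?thesis by simp
qed

lemma L\<theta>_measurable1: "L\<theta> \<theta> \<in> borel_measurable M"
  using measurable_compose[OF measurable_Pair2'[of \<theta> borel M] L\<theta>_measurable] by simp

lemma indep_coordinates:
  assumes Z: "\<And>j. Z j \<in> borel_measurable (path_algebra M (L j))"
  shows "indep_vars (\<lambda>_. borel) Z UNIV"
  unfolding indep_vars_def2
proof (intro conjI ballI)
  show "random_variable borel (Z j)" for j
    using measurable_path_algebra_le[OF L_levy(1) Z] .
  show "indep_sets (\<lambda>j. {Z j -` A \<inter> space M | A. A \<in> sets borel}) UNIV"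
  proof (rule indep_sets_mono_sets[OF L_indep])
    show "{Z j -` A \<inter> space M | A. A \<in> sets borel} \<subseteq> process_sigma M (L j)" for j
      using measurable_sets[OF Z] by (auto simp: process_sigma_eq)
  qed
qed

text \<open>Both vectors have independent coordinates, with laws that agree by stationarity of each \<open>L\<^sub>j\<close>.\<close>

lemma L\<theta>_increment_law:
  assumes "\<theta> \<in> nonneg_orthant" "\<theta>' - \<theta> \<in> nonneg_orthant"
  shows "distr M borel (\<lambda>\<omega>. L\<theta> \<theta>' \<omega> - L\<theta> \<theta> \<omega>) = distr M borel (L\<theta> (\<theta>' - \<theta>))"
proof -
  have o: "0 \<le> \<theta> $ j" "\<theta> $ j \<le> \<theta>' $ j" for j using assms by (auto simp: nonneg_orthant_def)
  then have o': "0 \<le> \<theta>' $ j" for j using order_trans by blast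
  have "distr M borel (\<lambda>\<omega>. \<chi> j. L j (\<theta>' $ j) \<omega> - L j (\<theta> $ j) \<omega>) =
      distr M borel (\<lambda>\<omega>. \<chi> j. L j (\<theta>' $ j - \<theta> $ j) \<omega>)"
  proof (rule distr_vec_eq_of_indep_coordinates)
    show "indep_vars (\<lambda>_. borel) (\<lambda>j \<omega>. L j (\<theta>' $ j) \<omega> - L j (\<theta> $ j) \<omega>) UNIV"
      using o o' by (intro indep_coordinates borel_measurable_diff measurable_path_algebra)
    show "indep_vars (\<lambda>_. borel) (\<lambda>j. L j (\<theta>' $ j - \<theta> $ j)) UNIV"
      using o by (intro indep_coordinates measurable_path_algebra) simp
    show "distr M borel (\<lambda>\<omega>. L j (\<theta>' $ j) \<omega> - L j (\<theta> $ j) \<omega>) = distr M borel (L j (\<theta>' $ j - \<theta> $ j))" for j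
      using o by (rule L_levy(5))
  qed
  moreover have "(\<lambda>\<omega>. L\<theta> \<theta>' \<omega> - L\<theta> \<theta> \<omega>) = (\<lambda>\<omega>. \<chi> j. L j (\<theta>' $ j) \<omega> - L j (\<theta> $ j) \<omega>)"
    using o o' by (auto simp: multi_time_def fun_eq_iff vec_eq_iff)
  moreover have "L\<theta> (\<theta>' - \<theta>) = (\<lambda>\<omega>. \<chi> j. L j (\<theta>' $ j - \<theta> $ j) \<omega>)"
    using o by (auto simp: multi_time_def fun_eq_iff vec_eq_iff)
  ultimately show ?thesis by simp
qed

text \<open>The increments of a single \<open>L\<^sub>j\<close> are independent over the time steps, and the processes \<open>L\<^sub>j\<close> are
independent over \<open>j\<close>; hence all scalar increments, indexed by time step and coordinate, are jointly
independent. Grouping them by time step gives the vectors.\<close>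

lemma L\<theta>_increments_indep:
  fixes \<tau> :: "nat \<Rightarrow> real ^ 'd"
  assumes \<tau>0: "\<tau> 0 \<in> nonneg_orthant" and \<tau>: "\<And>j. mono_on {..n} (\<lambda>i. \<tau> i $ j)"
  shows "indep_vars (\<lambda>_. borel) (\<lambda>i \<omega>. L\<theta> (\<tau> (Suc i)) \<omega> - L\<theta> (\<tau> i) \<omega>) {..<n}"
proof -
  have \<tau>_nn: "0 \<le> \<tau> i $ j" if "i \<le> n" for i j
    using mono_onD[OF \<tau>, of 0 i j] \<tau>0 that by (auto simp: nonneg_orthant_def intro: order_trans)
  define D where "D p \<omega> = L (snd p) (\<tau> (Suc (fst p)) $ snd p) \<omega> - L (snd p) (\<tau> (fst p) $ snd p) \<omega>" for p \<omega>
  define I where "I = {..<n} \<times> (UNIV :: 'd set)"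
  have D_path: "D (i, j) \<in> borel_measurable (path_algebra M (L j))" if "i < n" for i j
    unfolding D_def using that \<tau>_nn by (auto intro!: borel_measurable_diff measurable_path_algebra)
  have D_meas: "D p \<in> borel_measurable M" if "p \<in> I" for p
    using that \<tau>_nn unfolding D_def I_def by (intro borel_measurable_diff L_levy(1)) auto
  have "indep_vars (\<lambda>_. borel) D I"
  proof (cases "n = 0")
    case True
    then show ?thesis by (simp add: I_def indep_vars_def indep_sets_def)
  next
    case False
    let ?F = "\<lambda>p. {D p -` A \<inter> space M | A. A \<in> sets borel}"
    have "indep_sets ?F I"
    proof (subst indep_sets_finite)
      show "I \<noteq> {}" "finite I" using False by (auto simp: I_def)
      show "?F p \<subseteq> events" if "p \<in> I" for p using measurable_sets[OF D_meas[OF that]] by auto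
      show "space M \<in> ?F p" for p by (auto intro!: exI[of _ UNIV])
      show "\<forall>A\<in>Pi I ?F. prob (\<Inter>p\<in>I. A p) = (\<Prod>p\<in>I. prob (A p))"
      proof
        fix A assume A: "A \<in> Pi I ?F"
        have AF: "A (i, j) \<in> ?F (i, j)" if "i < n" for i j using A that by (auto simp: I_def Pi_iff)
        have row: "(\<Inter>i<n. A (i, j)) \<in> process_sigma M (L j)" for j
          unfolding process_sigma_eq
        proof (rule sets.finite_INT)
          show "A (i, j) \<in> sets (path_algebra M (L j))" if "i \<in> {..<n}" for i
            using AF[of i j] measurable_sets[OF D_path[of i j]] that by auto
        qed (use False in auto)
        have "prob (\<Inter>p\<in>I. A p) = prob (\<Inter>j. \<Inter>i<n. A (i, j))"
          by (intro arg_cong[where f = prob]) (auto simp: I_def)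
        also have "\<dots> = (\<Prod>j\<in>UNIV. prob (\<Inter>i<n. A (i, j)))"
          by (rule indep_setsD[OF L_indep]) (use row in auto)
        also have "\<dots> = (\<Prod>j\<in>UNIV. \<Prod>i<n. prob (A (i, j)))"
        proof (rule prod.cong[OF refl])
          fix j
          have "indep_vars (\<lambda>_. borel) (\<lambda>i \<omega>. L j (\<tau> (Suc i) $ j) \<omega> - L j (\<tau> i $ j) \<omega>) {..<n}"
            using \<tau>0 \<tau>[of j] by (intro L_levy(4)) (auto simp: nonneg_orthant_def)
          then have "indep_sets (\<lambda>i. ?F (i, j)) {..<n}"
            unfolding indep_vars_def2 D_def by simp
          then show "prob (\<Inter>i<n. A (i, j)) = (\<Prod>i<n. prob (A (i, j)))"
            by (rule indep_setsD) (use AF False in auto)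
        qed
        also have "\<dots> = (\<Prod>p\<in>I. prob (A p))"
          unfolding I_def by (subst prod.swap) (simp add: prod.cartesian_product)
        finally show "prob (\<Inter>p\<in>I. A p) = (\<Prod>p\<in>I. prob (A p))" .
      qed
    qed
    then show ?thesis unfolding indep_vars_def2 using D_meas by auto
  qed
  then have "indep_vars (\<lambda>i. PiM ({i} \<times> UNIV) (\<lambda>_. borel)) (\<lambda>i \<omega>. \<lambda>p\<in>{i} \<times> UNIV. D p \<omega>) {..<n}"
    by (rule indep_vars_restrict) (auto simp: I_def disjoint_family_on_def)
  then have "indep_vars (\<lambda>_. borel) (\<lambda>i \<omega>. (\<lambda>f. \<chi> j. f (i, j)) (\<lambda>p\<in>{i} \<times> UNIV. D p \<omega>)) {..<n}"
    by (rule indep_vars_compose2) (auto intro!: measurable_vec_lambda measurable_component_singleton)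
  then show ?thesis
  proof (subst indep_vars_cong)
    show "(\<lambda>\<omega>. L\<theta> (\<tau> (Suc i)) \<omega> - L\<theta> (\<tau> i) \<omega>) = (\<lambda>\<omega>. (\<lambda>f. \<chi> j. f (i, j)) (\<lambda>p\<in>{i} \<times> UNIV. D p \<omega>))"
      if "i \<in> {..<n}" for i
      using that \<tau>_nn[of i] \<tau>_nn[of "Suc i"] by (auto simp: D_def multi_time_def fun_eq_iff vec_eq_iff)
  qed auto
qed

definition law :: "('h ^ 'd) set \<Rightarrow> real ^ 'd \<Rightarrow> ennreal" where
  "law A \<theta> = (\<integral>\<^sup>+ \<omega>. indicator A (L\<theta> \<theta> \<omega>) \<partial>M)"

lemma law_measurable [measurable]:
  assumes [measurable]: "A \<in> sets borel"
  shows "law A \<in> borel_measurable borel"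
proof -
  note [measurable] = L\<theta>_measurable_swap
  show ?thesis unfolding law_def
    by (intro borel_measurable_nn_integral) (simp add: split_beta')
qed

lemma law_eq_emeasure: "A \<in> sets borel \<Longrightarrow> law A \<theta> = emeasure (distr M borel (L\<theta> \<theta>)) A"
  unfolding law_def using nn_integral_distr[OF L\<theta>_measurable1, of "indicator A" \<theta>] by simp

lemma L\<theta>_\<Theta>_measurable_path:
  assumes "0 \<le> t"
  shows "(\<lambda>p. L\<theta> (\<Theta> t (snd p)) (fst p)) \<in> borel_measurable (path_L \<Otimes>\<^sub>M path_\<Theta>)"
proof -
  have [measurable]: "\<Theta> t \<in> borel_measurable path_\<Theta>" using assms by (rule measurable_path_algebra)
  have "(\<lambda>p. (fst p, \<Theta> t (snd p))) \<in> measurable (path_L \<Otimes>\<^sub>M path_\<Theta>) (path_L \<Otimes>\<^sub>M borel)" by measurable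
  from measurable_compose[OF this L\<theta>_measurable_path] show ?thesis by simp
qed

text \<open>Given the path of \<open>\<Theta>\<close>, the increments of \<open>X\<close> are increments of \<open>L\<close> at fixed multivariate times, hence
independent, with laws that depend on the increments of \<open>\<Theta>\<close>. Integrating over the path, the product
factorises once more, by independence of the increments of \<open>\<Theta>\<close>.\<close>

lemma X_increments_joint_law:
  fixes t :: "nat \<Rightarrow> real" and A :: "nat \<Rightarrow> ('h ^ 'd) set"
  assumes t0: "0 \<le> t 0" and t: "mono_on {..n} t" and A [measurable]: "\<And>i. A i \<in> sets borel"
  shows "(\<integral>\<^sup>+ \<omega>. (\<Prod>i<n. indicator (A i) (X (t (Suc i)) \<omega> - X (t i) \<omega>)) \<partial>M) =
    (\<Prod>i<n. \<integral>\<^sup>+ \<omega>. law (A i) (\<Theta> (t (Suc i)) \<omega> - \<Theta> (t i) \<omega>) \<partial>M)"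
proof -
  have t_nn: "0 \<le> t i" if "i \<le> n" for i
    using mono_onD[OF t, of 0 i] t0 that by auto
  have t_Suc: "t i \<le> t (Suc i)" if "i < n" for i
    using mono_onD[OF t, of i "Suc i"] that by auto
  define f where "f p = (\<Prod>i<n. indicator (A i) (L\<theta> (\<Theta> (t (Suc i)) (snd p)) (fst p) - L\<theta> (\<Theta> (t i) (snd p)) (fst p)) :: ennreal)" for p
  have f_m: "f \<in> borel_measurable (path_L \<Otimes>\<^sub>M path_\<Theta>)"
    unfolding f_def
  proof (rule borel_measurable_prod_ennreal)
    fix i assume "i \<in> {..<n}"
    then have [measurable]: "(\<lambda>p. L\<theta> (\<Theta> (t (Suc i)) (snd p)) (fst p) - L\<theta> (\<Theta> (t i) (snd p)) (fst p)) \<in> borel_measurable (path_L \<Otimes>\<^sub>M path_\<Theta>)"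
      by (intro borel_measurable_diff L\<theta>_\<Theta>_measurable_path t_nn) auto
    show "(\<lambda>p. indicator (A i) (L\<theta> (\<Theta> (t (Suc i)) (snd p)) (fst p) - L\<theta> (\<Theta> (t i) (snd p)) (fst p)) :: ennreal)
        \<in> borel_measurable (path_L \<Otimes>\<^sub>M path_\<Theta>)"
      by (rule measurable_compose[of _ _ borel "indicator (A i)"]) measurable
  qed
  have "(\<integral>\<^sup>+ \<omega>. (\<Prod>i<n. indicator (A i) (X (t (Suc i)) \<omega> - X (t i) \<omega>)) \<partial>M) = (\<integral>\<^sup>+ \<omega>. f (\<omega>, \<omega>) \<partial>M)"
    unfolding f_def by (intro nn_integral_cong prod.cong refl) (auto simp: X_eq t_nn)
  also have "\<dots> = (\<integral>\<^sup>+ \<omega>'. \<integral>\<^sup>+ \<omega>. f (\<omega>, \<omega>') \<partial>M \<partial>M)"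
    using L_\<Theta>_indep f_m by (intro decoupling_nn_integral) (simp_all add: process_sigma_eq)
  also have "\<dots> = (\<integral>\<^sup>+ \<omega>'. (\<Prod>i<n. law (A i) (\<Theta> (t (Suc i)) \<omega>' - \<Theta> (t i) \<omega>')) \<partial>M)"
  proof (rule nn_integral_cong)
    fix \<omega>' assume \<omega>': "\<omega>' \<in> space M"
    let ?\<tau> = "\<lambda>i. \<Theta> (t i) \<omega>'"
    have ind: "indep_vars (\<lambda>_. borel) (\<lambda>i \<omega>. L\<theta> (?\<tau> (Suc i)) \<omega> - L\<theta> (?\<tau> i) \<omega>) {..<n}"
    proof (rule L\<theta>_increments_indep)
      show "?\<tau> 0 \<in> nonneg_orthant" using \<Theta>_orthant[OF \<omega>' t0] .
      show "mono_on {..n} (\<lambda>i. ?\<tau> i $ j)" for j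
        using t t_nn \<Theta>_mono[OF \<omega>'] by (auto simp: mono_on_def)
    qed
    have "(\<integral>\<^sup>+ \<omega>. f (\<omega>, \<omega>') \<partial>M) = (\<Prod>i<n. \<integral>\<^sup>+ \<omega>. indicator (A i) (L\<theta> (?\<tau> (Suc i)) \<omega> - L\<theta> (?\<tau> i) \<omega>) \<partial>M)"
      unfolding f_def fst_conv snd_conv
      by (rule indep_vars_nn_integral) (auto intro!: indep_vars_compose2[OF ind])
    also have "\<dots> = (\<Prod>i<n. law (A i) (?\<tau> (Suc i) - ?\<tau> i))"
    proof (rule prod.cong[OF refl])
      fix i assume i: "i \<in> {..<n}"
      have "(\<integral>\<^sup>+ \<omega>. indicator (A i) (L\<theta> (?\<tau> (Suc i)) \<omega> - L\<theta> (?\<tau> i) \<omega>) \<partial>M) =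
          (\<integral>\<^sup>+ x. indicator (A i) x \<partial>distr M borel (\<lambda>\<omega>. L\<theta> (?\<tau> (Suc i)) \<omega> - L\<theta> (?\<tau> i) \<omega>))"
        using L\<theta>_measurable1 by (subst nn_integral_distr) (auto intro!: borel_measurable_diff)
      also have "\<dots> = (\<integral>\<^sup>+ x. indicator (A i) x \<partial>distr M borel (L\<theta> (?\<tau> (Suc i) - ?\<tau> i)))"
        using i \<omega>' t_nn[of i] t_Suc[of i] by (subst L\<theta>_increment_law) (auto intro: \<Theta>_orthant \<Theta>_diff_orthant)
      also have "\<dots> = law (A i) (?\<tau> (Suc i) - ?\<tau> i)"
        unfolding law_def by (rule nn_integral_distr[OF L\<theta>_measurable1]) auto
      finally show "(\<integral>\<^sup>+ \<omega>. indicator (A i) (L\<theta> (?\<tau> (Suc i)) \<omega> - L\<theta> (?\<tau> i) \<omega>) \<partial>M) = law (A i) (?\<tau> (Suc i) - ?\<tau> i)" .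
    qed
    finally show "(\<integral>\<^sup>+ \<omega>. f (\<omega>, \<omega>') \<partial>M) = (\<Prod>i<n. law (A i) (?\<tau> (Suc i) - ?\<tau> i))" .
  qed
  also have "\<dots> = (\<Prod>i<n. \<integral>\<^sup>+ \<omega>. law (A i) (\<Theta> (t (Suc i)) \<omega> - \<Theta> (t i) \<omega>) \<partial>M)"
    by (rule indep_vars_nn_integral) (auto intro!: indep_vars_compose2[OF \<Theta>_levy(4)[OF t0 t]])
  finally show ?thesis .
qed

end

section \<open>The subordinated process is a Levy process\<close>

context subordinated_levy
begin

lemma X_measurable: "0 \<le> t \<Longrightarrow> X t \<in> borel_measurable M"
proof -
  assume t: "0 \<le> t"
  have [measurable]: "\<Theta> t \<in> borel_measurable M" using \<Theta>_levy(1)[OF t] .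
  have "(\<lambda>\<omega>. (\<omega>, \<Theta> t \<omega>)) \<in> measurable M (M \<Otimes>\<^sub>M borel)" by measurable
  from measurable_compose[OF this L\<theta>_measurable] show ?thesis
    by (subst measurable_cong[OF X_eq[OF _ t]]) simp_all
qed

lemma X_in_prod_space: "0 \<le> t \<Longrightarrow> \<omega> \<in> space M \<Longrightarrow> X t \<omega> \<in> prod_space H"
  using L_levy(2) \<Theta>_orthant[of \<omega> t] by (auto simp: X_def multi_time_def prod_space_def nonneg_orthant_def)

lemma X_0: "AE \<omega> in M. X 0 \<omega> = 0"
proof -
  have "AE \<omega> in M. \<forall>j. L j 0 \<omega> = 0" by (rule eventually_all_finite) (rule L_levy(3))
  with \<Theta>_levy(3) show ?thesis
    by eventually_elim (simp add: X_def multi_time_def vec_eq_iff)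
qed

lemma X_cadlag:
  assumes \<omega>: "\<omega> \<in> space M"
  shows "cadlag (\<lambda>t. X t \<omega>)"
  unfolding X_def multi_time_def
proof (rule cadlag_vec)
  fix j
  have "subordinator M (\<lambda>t \<omega>. \<Theta> t \<omega> $ j)" by (rule \<Theta>_subordinator)
  then have "cadlag (\<lambda>t. \<Theta> t \<omega> $ j)" "mono_on {0..} (\<lambda>t. \<Theta> t \<omega> $ j)" "\<And>t. 0 \<le> t \<Longrightarrow> 0 \<le> \<Theta> t \<omega> $ j"
    using \<omega> levy_processD(6)[of M UNIV "\<lambda>t \<omega>. \<Theta> t \<omega> $ j" \<omega>] unfolding subordinator_def by auto
  then show "cadlag (\<lambda>t. L j (\<Theta> t \<omega> $ j) \<omega>)"
    by (rule cadlag_compose_mono[OF L_levy(6)[OF \<omega>]])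
qed

lemma X_increments_single_law:
  assumes s: "0 \<le> s" "s \<le> t" and A: "A \<in> sets borel"
  shows "emeasure M {\<omega> \<in> space M. X t \<omega> - X s \<omega> \<in> A} = (\<integral>\<^sup>+ \<omega>. law A (\<Theta> t \<omega> - \<Theta> s \<omega>) \<partial>M)"
proof -
  define r where "r i = (if i = 0 then s else t)" for i :: nat
  have "mono_on {..1::nat} r" using s by (auto simp: mono_on_def r_def)
  from X_increments_joint_law[OF _ this, of "\<lambda>_. A"]
  have "(\<integral>\<^sup>+ \<omega>. indicator A (X t \<omega> - X s \<omega>) \<partial>M) = (\<integral>\<^sup>+ \<omega>. law A (\<Theta> t \<omega> - \<Theta> s \<omega>) \<partial>M)"
    using s A by (simp add: r_def)
  moreover have "(\<integral>\<^sup>+ \<omega>. indicator A (X t \<omega> - X s \<omega>) \<partial>M) = (\<integral>\<^sup>+ \<omega>. indicator {\<omega> \<in> space M. X t \<omega> - X s \<omega> \<in> A} \<omega> \<partial>M)"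
    by (intro nn_integral_cong) (auto simp: indicator_def)
  moreover have "{\<omega> \<in> space M. X t \<omega> - X s \<omega> \<in> A} \<in> events"
    using measurable_sets[OF borel_measurable_diff[OF X_measurable X_measurable] A, of t s] s
    by (simp add: vimage_def Int_def conj_commute)
  ultimately show ?thesis by simp
qed

lemma X_independent_increments:
  fixes t :: "nat \<Rightarrow> real"
  assumes t0: "0 \<le> t 0" and t: "mono_on {..n} t"
  shows "indep_vars (\<lambda>_. borel) (\<lambda>i \<omega>. X (t (Suc i)) \<omega> - X (t i) \<omega>) {..<n}"
proof (cases "n = 0")
  case True
  then show ?thesis by (simp add: indep_vars_def indep_sets_def)
next
  case False
  let ?D = "\<lambda>i \<omega>. X (t (Suc i)) \<omega> - X (t i) \<omega>"
  let ?F = "\<lambda>i. {?D i -` A \<inter> space M | A. A \<in> sets borel}"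
  have t_nn: "0 \<le> t i" if "i \<le> n" for i using mono_onD[OF t, of 0 i] t0 that by auto
  have t_Suc: "t i \<le> t (Suc i)" if "i < n" for i using mono_onD[OF t, of i "Suc i"] that by auto
  have D: "?D i \<in> borel_measurable M" if "i < n" for i
    using that t_nn by (intro borel_measurable_diff X_measurable) auto
  have "indep_sets ?F {..<n}"
  proof (subst indep_sets_finite)
    show "{..<n} \<noteq> {}" "finite {..<n}" using False by auto
    show "?F i \<subseteq> events" if "i \<in> {..<n}" for i using measurable_sets[OF D[of i]] that by auto
    show "space M \<in> ?F i" for i by (auto intro!: exI[of _ UNIV])
    show "\<forall>B\<in>Pi {..<n} ?F. prob (\<Inter>i\<in>{..<n}. B i) = (\<Prod>i\<in>{..<n}. prob (B i))"
    proof
      fix B assume B: "B \<in> Pi {..<n} ?F"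
      then have "\<forall>i. \<exists>A. A \<in> sets borel \<and> (i < n \<longrightarrow> B i = ?D i -` A \<inter> space M)"
        by (force simp: Pi_iff)
      then obtain A where A: "\<And>i. A i \<in> sets borel" "\<And>i. i < n \<Longrightarrow> B i = ?D i -` A i \<inter> space M" by metis
      have B_ev: "B i \<in> events" if "i < n" for i using A that measurable_sets[OF D] by auto
      have I: "(\<Inter>i<n. B i) \<in> events" using B_ev False by (intro sets.finite_INT) auto
      have "emeasure M (\<Inter>i<n. B i) = (\<integral>\<^sup>+ \<omega>. (\<Prod>i<n. indicator (A i) (?D i \<omega>)) \<partial>M)"
      proof -
        have "emeasure M (\<Inter>i<n. B i) = (\<integral>\<^sup>+ \<omega>. indicator (\<Inter>i<n. B i) \<omega> \<partial>M)" using I by simp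
        also have "\<dots> = (\<integral>\<^sup>+ \<omega>. (\<Prod>i<n. indicator (A i) (?D i \<omega>)) \<partial>M)"
        proof (rule nn_integral_cong)
          fix \<omega> assume \<omega>: "\<omega> \<in> space M"
          show "indicator (\<Inter>i<n. B i) \<omega> = (\<Prod>i<n. indicator (A i) (?D i \<omega>) :: ennreal)"
          proof (cases "\<forall>i<n. ?D i \<omega> \<in> A i")
            case True
            then show ?thesis using A(2) \<omega> by (auto simp: indicator_def)
          next
            case False
            then obtain i where "i < n" "?D i \<omega> \<notin> A i" by blast
            then have "\<omega> \<notin> (\<Inter>i<n. B i)" "(\<Prod>i<n. indicator (A i) (?D i \<omega>) :: ennreal) = 0"
              using A(2) by (auto intro!: prod_zero bexI[of _ i])
            then show ?thesis by simp
          qed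
        qed
        finally show ?thesis .
      qed
      also have "\<dots> = (\<Prod>i<n. \<integral>\<^sup>+ \<omega>. law (A i) (\<Theta> (t (Suc i)) \<omega> - \<Theta> (t i) \<omega>) \<partial>M)"
        by (rule X_increments_joint_law[OF t0 t A(1)])
      also have "\<dots> = (\<Prod>i<n. emeasure M (B i))"
      proof (rule prod.cong[OF refl])
        fix i assume i: "i \<in> {..<n}"
        then have Bi: "B i = {\<omega> \<in> space M. ?D i \<omega> \<in> A i}" using A(2) by auto
        show "(\<integral>\<^sup>+ \<omega>. law (A i) (\<Theta> (t (Suc i)) \<omega> - \<Theta> (t i) \<omega>) \<partial>M) = emeasure M (B i)"
          unfolding Bi using i t_nn[of i] t_Suc[of i] by (intro X_increments_single_law[symmetric] A(1)) auto
      qed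
      finally show "prob (\<Inter>i\<in>{..<n}. B i) = (\<Prod>i\<in>{..<n}. prob (B i))"
        by (simp add: emeasure_eq_measure prod_ennreal prod_nonneg)
    qed
  qed
  then show ?thesis unfolding indep_vars_def2 using D by auto
qed

lemma X_stationary_increments:
  assumes s: "0 \<le> s" "s \<le> t"
  shows "distr M borel (\<lambda>\<omega>. X t \<omega> - X s \<omega>) = distr M borel (X (t - s))"
proof (rule measure_eqI)
  fix A assume "A \<in> sets (distr M borel (\<lambda>\<omega>. X t \<omega> - X s \<omega>))"
  then have A [measurable]: "A \<in> sets borel" by simp
  have [measurable]: "X t \<in> borel_measurable M" "X s \<in> borel_measurable M" "X (t - s) \<in> borel_measurable M" "X 0 \<in> borel_measurable M"
    "\<Theta> t \<in> borel_measurable M" "\<Theta> s \<in> borel_measurable M" "\<Theta> (t - s) \<in> borel_measurable M" "\<Theta> 0 \<in> borel_measurable M"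
    using s by (auto intro!: X_measurable \<Theta>_levy(1))
  have "emeasure (distr M borel (\<lambda>\<omega>. X t \<omega> - X s \<omega>)) A = (\<integral>\<^sup>+ \<omega>. law A (\<Theta> t \<omega> - \<Theta> s \<omega>) \<partial>M)"
    using X_increments_single_law[OF s A] by (simp add: emeasure_distr vimage_def Int_def conj_commute)
  also have "\<dots> = (\<integral>\<^sup>+ \<theta>. law A \<theta> \<partial>distr M borel (\<lambda>\<omega>. \<Theta> t \<omega> - \<Theta> s \<omega>))"
    by (subst nn_integral_distr) auto
  also have "distr M borel (\<lambda>\<omega>. \<Theta> t \<omega> - \<Theta> s \<omega>) = distr M borel (\<Theta> (t - s))"
    using s by (rule \<Theta>_levy(5))
  \<comment> \<open>The formula for increments covers \<open>X(t - s) - X(0)\<close>, which equals \<open>X(t - s)\<close> almost surely.\<close>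
  also have "\<dots> = distr M borel (\<lambda>\<omega>. \<Theta> (t - s) \<omega> - \<Theta> 0 \<omega>)"
    using \<Theta>_levy(5)[of 0 "t - s"] s by simp
  also have "(\<integral>\<^sup>+ \<theta>. law A \<theta> \<partial>\<dots>) = (\<integral>\<^sup>+ \<omega>. law A (\<Theta> (t - s) \<omega> - \<Theta> 0 \<omega>) \<partial>M)"
    by (subst nn_integral_distr) auto
  also have "\<dots> = emeasure M {\<omega> \<in> space M. X (t - s) \<omega> - X 0 \<omega> \<in> A}"
    using X_increments_single_law[of 0 "t - s" A] s A by simp
  also have "\<dots> = emeasure M {\<omega> \<in> space M. X (t - s) \<omega> \<in> A}"
    by (rule emeasure_eq_AE) (use X_0 in \<open>auto elim: eventually_mono\<close>)
  also have "\<dots> = emeasure (distr M borel (X (t - s))) A"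
    by (simp add: emeasure_distr vimage_def Int_def conj_commute)
  finally show "emeasure (distr M borel (\<lambda>\<omega>. X t \<omega> - X s \<omega>)) A = emeasure (distr M borel (X (t - s))) A" .
qed simp

text \<open>By stationarity the probability depends on \<open>|s - t|\<close> only, so it is enough to let the time tend to
0 from the right, where the paths converge to \<open>X(0) = 0\<close> almost surely.\<close>

lemma X_stochastically_continuous:
  assumes t: "0 \<le> t" and \<epsilon>: "0 < \<epsilon>"
  shows "((\<lambda>s. prob {\<omega> \<in> space M. \<epsilon> < norm (X s \<omega> - X t \<omega>)}) \<longlongrightarrow> 0) (at t within {0..})"
proof -
  define h where "h r = prob {\<omega> \<in> space M. \<epsilon> < norm (X r \<omega>)}" for r
  have h_eq: "prob {\<omega> \<in> space M. \<epsilon> < norm (X v \<omega> - X u \<omega>)} = h (v - u)" if "0 \<le> u" "u \<le> v" for u v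
  proof -
    have [measurable]: "X u \<in> borel_measurable M" "X v \<in> borel_measurable M" "X (v - u) \<in> borel_measurable M"
      using that by (auto intro!: X_measurable)
    have "prob {\<omega> \<in> space M. \<epsilon> < norm (X v \<omega> - X u \<omega>)} =
        measure (distr M borel (\<lambda>\<omega>. X v \<omega> - X u \<omega>)) {x. \<epsilon> < norm x}"
      by (subst measure_distr) (auto simp: vimage_def Int_def conj_commute)
    also have "\<dots> = measure (distr M borel (X (v - u))) {x. \<epsilon> < norm x}"
      using X_stationary_increments[OF that] by simp
    also have "\<dots> = h (v - u)"
      unfolding h_def by (subst measure_distr) (auto simp: vimage_def Int_def conj_commute)
    finally show ?thesis .
  qed
  have h_abs: "prob {\<omega> \<in> space M. \<epsilon> < norm (X s \<omega> - X t \<omega>)} = h \<bar>s - t\<bar>" if "0 \<le> s" for s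
    using h_eq[of t s] h_eq[of s t] that t by (cases "t \<le> s") (auto simp: norm_minus_commute)
  have h0: "h 0 = 0"
  proof -
    have "AE \<omega> in M. \<not> \<epsilon> < norm (X 0 \<omega>)" using X_0 by eventually_elim (use \<epsilon> in auto)
    moreover have "{\<omega> \<in> space M. \<epsilon> < norm (X 0 \<omega>)} \<in> events"
      using X_measurable[of 0] by simp
    ultimately show ?thesis unfolding h_def by (subst prob_eq_0) auto
  qed
  have "(h \<longlongrightarrow> 0) (at_right 0)"
    unfolding tendsto_at_iff_sequentially
  proof (intro allI impI)
    fix S :: "nat \<Rightarrow> real" assume S: "\<forall>i. S i \<in> {0<..} - {0}" "S \<longlonglongrightarrow> 0"
    then have S0: "0 < S i" for i by auto
    have [measurable]: "X (S i) \<in> borel_measurable M" for i using S0[of i] by (intro X_measurable) simp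
    let ?f = "\<lambda>i \<omega>. indicator {\<omega> \<in> space M. \<epsilon> < norm (X (S i) \<omega>)} \<omega> :: real"
    have "(\<lambda>i. LINT \<omega>|M. ?f i \<omega>) \<longlonglongrightarrow> (LINT \<omega>|M. 0)"
    proof (rule integral_dominated_convergence[where w = "\<lambda>_. 1"])
      show "AE \<omega> in M. (\<lambda>i. ?f i \<omega>) \<longlonglongrightarrow> 0"
        using X_0 AE_space
      proof eventually_elim
        fix \<omega> assume \<omega>: "X 0 \<omega> = 0" "\<omega> \<in> space M"
        have "((\<lambda>r. X r \<omega>) \<longlongrightarrow> X 0 \<omega>) (at_right 0)" using X_cadlag[OF \<omega>(2)] by (simp add: cadlag_def)
        then have "(\<lambda>i. X (S i) \<omega>) \<longlonglongrightarrow> 0"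
          using S \<omega>(1) unfolding tendsto_at_iff_sequentially by (auto simp: o_def)
        then have "eventually (\<lambda>i. norm (X (S i) \<omega>) < \<epsilon>) sequentially"
          using \<epsilon> tendsto_norm_zero order_tendstoD(2) by blast
        then have "eventually (\<lambda>i. ?f i \<omega> = 0) sequentially" by eventually_elim simp
        then show "(\<lambda>i. ?f i \<omega>) \<longlonglongrightarrow> 0" by (rule tendsto_eventually)
      qed
    qed auto
    then show "(h \<circ> S) \<longlonglongrightarrow> 0" by (simp add: o_def h_def)
  qed
  then have "continuous (at 0 within {0..}) h"
    by (simp add: continuous_within at_within_Ici_at_right h0)
  moreover have "eventually (\<lambda>s. \<bar>s - t\<bar> \<in> {0..}) (at t within {0..})" by simp
  moreover have "((\<lambda>s. \<bar>s - t\<bar>) \<longlongrightarrow> 0) (at t within {0..})"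
    using tendsto_rabs[OF tendsto_diff[OF tendsto_ident_at[of t "{0..}"] tendsto_const[of t]]] by simp
  ultimately have "((\<lambda>s. h \<bar>s - t\<bar>) \<longlongrightarrow> h 0) (at t within {0..})"
    by (rule continuous_within_tendsto_compose)
  then show ?thesis
    unfolding h0
  proof (rule Lim_transform_eventually)
    show "eventually (\<lambda>s. h \<bar>s - t\<bar> = prob {\<omega> \<in> space M. \<epsilon> < norm (X s \<omega> - X t \<omega>)}) (at t within {0..})"
      using h_abs by (auto simp: eventually_at_filter)
  qed
qed

proposition levy_process_X: "levy_process M (prod_space H) X"
  unfolding levy_process_def
  using X_measurable X_in_prod_space X_0 X_independent_increments X_stationary_increments
    X_stochastically_continuous X_cadlag by blast

end

section \<open>Moments of the process at fixed multivariate times\<close>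

context subordinated_levy
begin

definition \<psi> :: "'h ^ 'd \<Rightarrow> 'd \<Rightarrow> complex" where
  "\<psi> u j = levy_exponent (b j) (Q j) (\<nu> j) (u $ j)"

abbreviation \<Psi> :: "'h ^ 'd \<Rightarrow> real ^ 'd \<Rightarrow> complex" where
  "\<Psi> u \<theta> \<equiv> \<Sum>j\<in>UNIV. \<psi> u j * of_real (\<theta> $ j)"

abbreviation m2 :: "real ^ 'd \<Rightarrow> real" where
  "m2 \<theta> \<equiv> LINT \<omega>|M. min 1 ((norm (L\<theta> \<theta> \<omega>))\<^sup>2)"

definition drift :: "real ^ 'd \<Rightarrow> 'h ^ 'd" where
  "drift \<theta> = (LINT \<omega>|M. trunc (L\<theta> \<theta> \<omega>))"

lemmas L_charD = levy_characteristicsD[OF L_char]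
lemmas \<Theta>_charD = levy_characteristicsD[OF \<Theta>_char]

lemma Re_\<psi>: "u \<in> prod_space H \<Longrightarrow> Re (\<psi> u j) \<le> 0"
  unfolding \<psi>_def by (intro Re_levy_exponent_le_0[OF prob_space_axioms L_char]) (simp add: prod_space_def)

lemma subspace_prod: "subspace (prod_space H)" by (intro subspace_prod_space H_subspace)

lemma L\<theta>_in_prod_space: "\<omega> \<in> space M \<Longrightarrow> L\<theta> \<theta> \<omega> \<in> prod_space H"
  using L_levy(2) by (auto simp: multi_time_def prod_space_def)

lemma trunc_in_prod_space: "x \<in> prod_space H \<Longrightarrow> trunc x \<in> prod_space H"
  using subspace_0[OF subspace_prod] by (simp add: trunc_def)

lemma prod_space_basis:
  obtains B where "orthonormal_basis_on (prod_space H) B"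
proof -
  have "\<forall>j. \<exists>B. orthonormal_basis_on (H j) B"
    using L_charD(3) unfolding covariance_operator_def by blast
  then obtain B where "\<And>j. orthonormal_basis_on (H j) (B j)" by metis
  from orthonormal_basis_prod_space[of H B, OF H_subspace H_closed this] show thesis by (rule that)
qed

lemma integrable_trunc_L\<theta>: "integrable M (\<lambda>\<omega>. trunc (L\<theta> \<theta> \<omega>))"
  using measurable_compose[OF L\<theta>_measurable1 measurable_trunc] norm_trunc_le
  by (intro integrable_const_bound[where B = 1]) auto

lemma drift_in_prod_space: "drift \<theta> \<in> prod_space H"
proof -
  obtain B where B: "orthonormal_basis_on (prod_space H) B" by (rule prod_space_basis)
  show ?thesis unfolding drift_def
    by (rule integral_in_closed_subspace[OF subspace_prod B integrable_trunc_L\<theta>])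
       (auto intro!: AE_I2 trunc_in_prod_space L\<theta>_in_prod_space)
qed

lemma char_L\<theta>:
  assumes \<theta>: "\<theta> \<in> nonneg_orthant" and u: "u \<in> prod_space H"
  shows "(CLINT \<omega>|M. iexp (u \<bullet> L\<theta> \<theta> \<omega>)) = exp (\<Psi> u \<theta>)"
proof -
  have \<theta>j: "0 \<le> \<theta> $ j" for j using \<theta> by (simp add: nonneg_orthant_def)
  have uj: "u $ j \<in> H j" for j using u by (simp add: prod_space_def)
  have "indep_vars (\<lambda>_. borel) (\<lambda>j. L j (\<theta> $ j)) UNIV"
    using \<theta>j by (intro indep_coordinates measurable_path_algebra)
  then have ind: "indep_vars (\<lambda>_. borel) (\<lambda>j \<omega>. iexp (u $ j \<bullet> L j (\<theta> $ j) \<omega>)) UNIV"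
    by (rule indep_vars_compose2) auto
  have m: "L j (\<theta> $ j) \<in> borel_measurable M" for j using L_levy(1) \<theta>j .
  have "(CLINT \<omega>|M. iexp (u \<bullet> L\<theta> \<theta> \<omega>)) = (CLINT \<omega>|M. (\<Prod>j\<in>UNIV. iexp (u $ j \<bullet> L j (\<theta> $ j) \<omega>)))"
    unfolding pos_id[OF \<theta>] multi_time_def
    by (intro Bochner_Integration.integral_cong refl)
       (simp add: inner_vec_def exp_sum[symmetric] sum_distrib_left)
  also have "\<dots> = (\<Prod>j\<in>UNIV. CLINT \<omega>|M. iexp (u $ j \<bullet> L j (\<theta> $ j) \<omega>))"
  proof (rule indep_vars_lebesgue_integral[OF _ ind])
    show "integrable M (\<lambda>\<omega>. iexp (u $ j \<bullet> L j (\<theta> $ j) \<omega>))" for j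
      using m[of j] by (intro integrable_const_bound[where B = 1]) auto
  qed simp
  also have "\<dots> = (\<Prod>j\<in>UNIV. exp (\<psi> u j * of_real (\<theta> $ j)))"
    using L_charD(5)[OF \<theta>j uj] by (simp add: \<psi>_def mult.commute)
  finally show ?thesis by (simp add: exp_sum)
qed

text \<open>The truncated square of the norm is at most the sum of those of the coordinates, and these are
controlled by the small-time estimate for the single processes.\<close>

lemma L\<theta>_second_moment_bound:
  obtains K where "0 \<le> K" "\<And>\<theta>. \<theta> \<in> nonneg_orthant \<Longrightarrow>
    m2 \<theta> \<le> K * min 1 (norm \<theta>)"
proof -
  have "\<forall>j. \<exists>K. 0 \<le> K \<and> (\<forall>t\<ge>0. (LINT \<omega>|M. min 1 ((norm (L j t \<omega>))\<^sup>2)) \<le> K * t)"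
    using levy_small_time_estimate[OF prob_space_axioms H_subspace L_char] by metis
  then obtain K where K: "\<And>j. 0 \<le> K j"
    "\<And>j t. 0 \<le> t \<Longrightarrow> (LINT \<omega>|M. min 1 ((norm (L j t \<omega>))\<^sup>2)) \<le> K j * t" by metis
  have bounded_int: "integrable M (\<lambda>\<omega>. min 1 ((norm (Z \<omega>))\<^sup>2))"
    if "Z \<in> borel_measurable M" for Z :: "'w \<Rightarrow> 'x::{real_normed_vector, second_countable_topology}"
    using that by (intro integrable_const_bound[where B = 1]) auto
  have "m2 \<theta> \<le> (1 + (\<Sum>j\<in>UNIV. K j)) * min 1 (norm \<theta>)"
    if \<theta>: "\<theta> \<in> nonneg_orthant" for \<theta>
  proof -
    have \<theta>j: "0 \<le> \<theta> $ j" for j using \<theta> by (simp add: nonneg_orthant_def)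
    have Lm: "L j (\<theta> $ j) \<in> borel_measurable M" for j using L_levy(1) \<theta>j .
    have KS: "0 \<le> (\<Sum>j\<in>UNIV. K j)" using K(1) by (intro sum_nonneg) auto
    have "m2 \<theta> \<le> (LINT \<omega>|M. (\<Sum>j\<in>UNIV. min 1 ((norm (L j (\<theta> $ j) \<omega>))\<^sup>2)))"
    proof (rule integral_mono)
      show "min 1 ((norm (L\<theta> \<theta> \<omega>))\<^sup>2) \<le> (\<Sum>j\<in>UNIV. min 1 ((norm (L j (\<theta> $ j) \<omega>))\<^sup>2))" for \<omega>
        using min_1_norm_vec_le[of "L\<theta> \<theta> \<omega>"] unfolding pos_id[OF \<theta>] by (simp add: multi_time_def)
      show "integrable M (\<lambda>\<omega>. min 1 ((norm (L\<theta> \<theta> \<omega>))\<^sup>2))" by (intro bounded_int L\<theta>_measurable1)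
      show "integrable M (\<lambda>\<omega>. \<Sum>j\<in>UNIV. min 1 ((norm (L j (\<theta> $ j) \<omega>))\<^sup>2))"
        by (intro Bochner_Integration.integrable_sum bounded_int Lm)
    qed
    also have "\<dots> = (\<Sum>j\<in>UNIV. LINT \<omega>|M. min 1 ((norm (L j (\<theta> $ j) \<omega>))\<^sup>2))"
      by (intro Bochner_Integration.integral_sum bounded_int Lm)
    also have "\<dots> \<le> (\<Sum>j\<in>UNIV. K j * norm \<theta>)"
    proof (rule sum_mono)
      fix j
      have "\<theta> $ j \<le> norm \<theta>" using component_le_norm_cart[of \<theta> j] by simp
      then show "(LINT \<omega>|M. min 1 ((norm (L j (\<theta> $ j) \<omega>))\<^sup>2)) \<le> K j * norm \<theta>"
        using K(2)[OF \<theta>j] mult_left_mono[OF _ K(1)] by (blast intro: order_trans)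
    qed
    also have "\<dots> \<le> (1 + (\<Sum>j\<in>UNIV. K j)) * norm \<theta>"
      unfolding sum_distrib_right[symmetric] by (intro mult_right_mono) auto
    finally have 1: "m2 \<theta> \<le> (1 + (\<Sum>j\<in>UNIV. K j)) * norm \<theta>" .
    have "m2 \<theta> \<le> (LINT \<omega>|M. 1)"
      by (intro integral_mono bounded_int L\<theta>_measurable1) auto
    then have 2: "m2 \<theta> \<le> 1" by (simp add: prob_space)
    show ?thesis using 1 2 KS by (auto simp: min_def)
  qed
  moreover have "0 \<le> 1 + (\<Sum>j\<in>UNIV. K j)" using K(1) by (intro add_nonneg_nonneg sum_nonneg) auto
  ultimately show thesis using that by blast
qed

lemma integrand_L\<theta>:
  assumes \<theta>: "\<theta> \<in> nonneg_orthant" and u: "u \<in> prod_space H"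
  shows "integrable M (\<lambda>\<omega>. iexp (u \<bullet> L\<theta> \<theta> \<omega>) - 1 - \<i> * of_real (u \<bullet> trunc (L\<theta> \<theta> \<omega>)))"
    and "(CLINT \<omega>|M. iexp (u \<bullet> L\<theta> \<theta> \<omega>) - 1 - \<i> * of_real (u \<bullet> trunc (L\<theta> \<theta> \<omega>))) =
      exp (\<Psi> u \<theta>) - 1 - \<i> * of_real (u \<bullet> drift \<theta>)"
proof -
  have i1: "integrable M (\<lambda>\<omega>. iexp (u \<bullet> L\<theta> \<theta> \<omega>))"
    using L\<theta>_measurable1[of \<theta>] by (intro integrable_const_bound[where B = 1]) auto
  have i2: "integrable M (\<lambda>\<omega>. \<i> * of_real (u \<bullet> trunc (L\<theta> \<theta> \<omega>)))"
    using integrable_trunc_L\<theta> by simp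
  show "integrable M (\<lambda>\<omega>. iexp (u \<bullet> L\<theta> \<theta> \<omega>) - 1 - \<i> * of_real (u \<bullet> trunc (L\<theta> \<theta> \<omega>)))"
    using i1 i2 by (intro Bochner_Integration.integrable_diff) auto
  show "(CLINT \<omega>|M. iexp (u \<bullet> L\<theta> \<theta> \<omega>) - 1 - \<i> * of_real (u \<bullet> trunc (L\<theta> \<theta> \<omega>))) =
      exp (\<Psi> u \<theta>) - 1 - \<i> * of_real (u \<bullet> drift \<theta>)"
    using i1 i2 integrable_trunc_L\<theta>[of \<theta>] char_L\<theta>[OF \<theta> u]
    by (simp add: drift_def prob_space)
qed

text \<open>For \<open>u = E \<chi>(L(\<theta>)) / |E \<chi>(L(\<theta>))|\<close> the norm is \<open>\<langle>u|E \<chi>(L(\<theta>))\<rangle>\<close>. This differs from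
\<open>(E e\<^bsup>i\<langle>u|L(\<theta>)\<rangle>\<^esup> - 1) / i\<close>, which is of order \<open>|\<theta>|\<close>, by an expectation of second order in \<open>L(\<theta>)\<close>.
The vector \<open>u\<close> is an admissible argument of the characteristic function because the expectation of a
variable with values in the closed subspace lies in it.\<close>

lemma drift_bound:
  obtains C where "0 \<le> C" "\<And>\<theta>. \<theta> \<in> nonneg_orthant \<Longrightarrow> norm (drift \<theta>) \<le> C * min 1 (norm \<theta>)"
proof -
  obtain K where K: "0 \<le> K" "\<And>\<theta>. \<theta> \<in> nonneg_orthant \<Longrightarrow>
    m2 \<theta> \<le> K * min 1 (norm \<theta>)" using L\<theta>_second_moment_bound by blast
  have "\<forall>j. \<exists>C. 0 \<le> C \<and> (\<forall>u\<in>H j. norm u \<le> 1 \<longrightarrow> cmod (levy_exponent (b j) (Q j) (\<nu> j) u) \<le> C)"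
    using levy_exponent_bounded[OF L_charD(3) L_charD(4)] by metis
  then obtain C where C: "\<And>j. 0 \<le> C j"
    "\<And>j u. u \<in> H j \<Longrightarrow> norm u \<le> 1 \<Longrightarrow> cmod (levy_exponent (b j) (Q j) (\<nu> j) u) \<le> C j" by metis
  have CS: "0 \<le> (\<Sum>j\<in>UNIV. C j)" using C(1) by (intro sum_nonneg) auto
  have "norm (drift \<theta>) \<le> (1 + (\<Sum>j\<in>UNIV. C j) + 2 * K) * min 1 (norm \<theta>)" if \<theta>: "\<theta> \<in> nonneg_orthant" for \<theta>
  proof -
    have le1: "norm (drift \<theta>) \<le> 1"
    proof -
      have "norm (drift \<theta>) \<le> (LINT \<omega>|M. 1)"
        unfolding drift_def using norm_trunc_le by (intro norm_integral_le_integral integrable_trunc_L\<theta>) auto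
      then show ?thesis by (simp add: prob_space)
    qed
    define u where "u = (1 / norm (drift \<theta>)) *\<^sub>R drift \<theta>"
    have u: "u \<in> prod_space H" unfolding u_def by (intro subspace_scale[OF subspace_prod] drift_in_prod_space)
    have u1: "norm u \<le> 1" by (simp add: u_def)
    have u_drift: "u \<bullet> drift \<theta> = norm (drift \<theta>)"
      by (simp add: u_def power2_norm_eq_inner[symmetric] power2_eq_square)
    let ?s = "\<Sum>j\<in>UNIV. \<psi> u j * of_real (\<theta> $ j)"
    have \<theta>j: "0 \<le> \<theta> $ j" for j using \<theta> by (simp add: nonneg_orthant_def)
    have "Re ?s \<le> 0" using Re_\<psi>[OF u] \<theta>j by (auto intro!: sum_nonpos simp: mult_nonpos_nonneg)
    then have "cmod (1 - exp ?s) \<le> cmod ?s" by (rule cmod_one_minus_exp_le)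
    also have "\<dots> \<le> (\<Sum>j\<in>UNIV. C j * norm \<theta>)"
    proof (rule sum_norm_le)
      fix j
      have "norm (u $ j) \<le> 1" using u1 Finite_Cartesian_Product.norm_nth_le[of u j] by simp
      then have "cmod (\<psi> u j) \<le> C j" using C(2) u by (simp add: \<psi>_def prod_space_def)
      moreover have "\<bar>\<theta> $ j\<bar> \<le> norm \<theta>" by (rule component_le_norm_cart)
      ultimately show "cmod (\<psi> u j * of_real (\<theta> $ j)) \<le> C j * norm \<theta>"
        using C(1)[of j] by (simp add: norm_mult mult_mono)
    qed
    finally have 1: "cmod (1 - exp ?s) \<le> (\<Sum>j\<in>UNIV. C j) * norm \<theta>" by (simp add: sum_distrib_right)
    have "cmod (exp ?s - 1 - \<i> * of_real (u \<bullet> drift \<theta>)) \<le> (LINT \<omega>|M. 2 * min 1 ((norm (L\<theta> \<theta> \<omega>))\<^sup>2))"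
      unfolding integrand_L\<theta>(2)[OF \<theta> u, symmetric]
    proof (rule norm_integral_le_integral[OF integrand_L\<theta>(1)[OF \<theta> u]])
      show "integrable M (\<lambda>\<omega>. 2 * min 1 ((norm (L\<theta> \<theta> \<omega>))\<^sup>2))"
        using L\<theta>_measurable1[of \<theta>] by (intro integrable_mult_right integrable_const_bound[where B = 1]) auto
      fix \<omega>
      let ?x = "L\<theta> \<theta> \<omega>"
      have "(u \<bullet> trunc ?x)\<^sup>2 / 2 + 2 * indicator {x. 1 < norm x} ?x \<le> 2 * min 1 ((norm ?x)\<^sup>2)"
      proof (cases "norm ?x \<le> 1")
        case True
        have "\<bar>u \<bullet> ?x\<bar> \<le> norm u * norm ?x" by (rule Cauchy_Schwarz_ineq2)
        also have "\<dots> \<le> 1 * norm ?x" using u1 by (rule mult_right_mono) simp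
        finally have sq: "(u \<bullet> ?x)\<^sup>2 \<le> (norm ?x)\<^sup>2" by (simp add: abs_le_square_iff[symmetric])
        have eqs: "trunc ?x = ?x" "min 1 ((norm ?x)\<^sup>2) = (norm ?x)\<^sup>2" "indicator {x. 1 < norm x} ?x = (0 :: real)"
          using True by (simp_all add: trunc_def power_le_one)
        show ?thesis unfolding eqs using sq zero_le_power2[of "norm ?x"] by linarith
      qed (simp add: trunc_def)
      then show "cmod (iexp (u \<bullet> ?x) - 1 - \<i> * of_real (u \<bullet> trunc ?x)) \<le> 2 * min 1 ((norm ?x)\<^sup>2)"
        using cmod_levy_integrand_le[of u ?x] by linarith
    qed
    also have "\<dots> \<le> 2 * (K * min 1 (norm \<theta>))"
      unfolding integral_mult_right_zero by (intro mult_left_mono K(2)[OF \<theta>]) simp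
    finally have 2: "cmod (exp ?s - 1 - \<i> * of_real (u \<bullet> drift \<theta>)) \<le> 2 * K * min 1 (norm \<theta>)" by simp
    have "norm (drift \<theta>) = cmod ((1 - exp ?s) + (exp ?s - 1 - \<i> * of_real (u \<bullet> drift \<theta>)))"
      by (simp add: u_drift norm_mult)
    also have "\<dots> \<le> (\<Sum>j\<in>UNIV. C j) * norm \<theta> + 2 * K * min 1 (norm \<theta>)"
      using norm_triangle_ineq 1 2 by (rule order_trans[OF _ add_mono])
    finally have 3: "norm (drift \<theta>) \<le> (\<Sum>j\<in>UNIV. C j) * norm \<theta> + 2 * K * min 1 (norm \<theta>)" .
    show ?thesis
    proof (cases "norm \<theta> \<le> 1")
      case True
      then show ?thesis using 3 by (simp add: algebra_simps add_increasing)
    next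
      case False
      then show ?thesis using le1 CS K(1) by simp
    qed
  qed
  moreover have "0 \<le> 1 + (\<Sum>j\<in>UNIV. C j) + 2 * K" using CS K(1) by simp
  ultimately show thesis using that by blast
qed

lemma drift_measurable: "drift \<in> borel_measurable borel"
proof -
  note [measurable] = L\<theta>_measurable_swap
  show ?thesis unfolding drift_def[abs_def]
    by (intro borel_measurable_lebesgue_integral) (simp add: split_beta')
qed

lemma F_sets [measurable_cong]: "sets F = sets borel"
  using levy_measureD(1)[OF \<Theta>_charD(4)] .

lemma drift_integrable: "integrable F drift"
proof -
  obtain C where C: "0 \<le> C" "\<And>\<theta>. \<theta> \<in> nonneg_orthant \<Longrightarrow> norm (drift \<theta>) \<le> C * min 1 (norm \<theta>)"
    using drift_bound by metis
  show ?thesis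
  proof (rule Bochner_Integration.integrable_bound)
    show "integrable F (\<lambda>\<theta>. C * min 1 (norm \<theta>))"
      using integrable_min_1_norm[OF \<Theta>_charD(4) F_orthant F_trunc] by simp
    show "drift \<in> borel_measurable F" using drift_measurable measurable_cong_sets[OF F_sets refl] by blast
    show "AE \<theta> in F. norm (drift \<theta>) \<le> norm (C * min 1 (norm \<theta>))"
      using F_orthant by eventually_elim (use C in \<open>auto intro: order_trans[OF _ abs_ge_self]\<close>)
  qed
qed

end

section \<open>The characteristics of the subordinated process\<close>

context subordinated_levy
begin

abbreviation \<kappa> :: "real ^ 'd \<Rightarrow> ('h ^ 'd) measure" where
  "\<kappa> \<theta> \<equiv> distr M borel (L\<theta> \<theta>)"

abbreviation \<nu>\<eta> :: "'d \<Rightarrow> ('h ^ 'd) measure" where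
  "\<nu>\<eta> j \<equiv> distr (\<nu> j) borel (axis j)"

definition \<mu> :: "('h ^ 'd) measure" where
  "\<mu> = mixture_measure (\<lambda>j. a0 $ j) \<nu>\<eta> F \<kappa>"

definition \<beta> :: "'h ^ 'd" where
  "\<beta> = (\<chi> j. a0 $ j *\<^sub>R b j) + (LINT \<theta>|F. drift \<theta>)"

definition \<Gamma> :: "'h ^ 'd \<Rightarrow> 'h ^ 'd" where
  "\<Gamma> u = (\<chi> j. a0 $ j *\<^sub>R Q j (u $ j))"

lemma a0_nonneg: "0 \<le> a0 $ j" using a0_orthant by (simp add: nonneg_orthant_def)

lemma \<nu>_sets: "sets (\<nu> j) = sets borel" using levy_measureD(1)[OF L_charD(4)] .

lemma axis_measurable: "axis j \<in> measurable (\<nu> j) (borel :: ('h ^ 'd) measure)"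
  using measurable_axis measurable_cong_sets[OF \<nu>_sets refl] by blast

lemma law_measurable_F:
  "A \<in> sets borel \<Longrightarrow> (\<lambda>\<theta>. emeasure (\<kappa> \<theta>) A) \<in> borel_measurable F"
  using law_measurable[of A] law_eq_emeasure[of A] measurable_cong_sets[OF F_sets refl]
  by (metis (no_types, lifting) ext)

lemma \<mu>_sets [simp, measurable_cong]: "sets \<mu> = sets borel"
  by (simp add: \<mu>_def)

lemma emeasure_\<mu>:
  assumes "A \<in> sets borel"
  shows "emeasure \<mu> A = (\<Sum>j\<in>UNIV. ennreal (a0 $ j) * emeasure (\<nu>\<eta> j) A)
    + (\<integral>\<^sup>+ \<theta>. emeasure (\<kappa> \<theta>) A \<partial>F)"
  unfolding \<mu>_def
  by (rule emeasure_mixture_measure[OF sets_distr sets_distr law_measurable_F assms])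

lemma nn_integral_\<mu>:
  assumes "f \<in> borel_measurable borel"
  shows "(\<integral>\<^sup>+ x. f x \<partial>\<mu>) =
    (\<Sum>j\<in>UNIV. ennreal (a0 $ j) * (\<integral>\<^sup>+ x. f x \<partial>\<nu>\<eta> j))
    + (\<integral>\<^sup>+ \<theta>. \<integral>\<^sup>+ x. f x \<partial>\<kappa> \<theta> \<partial>F)"
  unfolding \<mu>_def
  by (rule nn_integral_mixture_measure[OF sets_distr sets_distr law_measurable_F assms])

lemma integral_\<mu>:
  fixes f :: "'h ^ 'd \<Rightarrow> complex"
  assumes f: "f \<in> borel_measurable borel" "integrable \<mu> f"
    "\<And>j. integrable (\<nu>\<eta> j) f" "\<And>\<theta>. integrable (\<kappa> \<theta>) f"
  shows "integrable F (\<lambda>\<theta>. CLINT x|\<kappa> \<theta>. f x)"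
    and "(CLINT x|\<mu>. f x) =
      (\<Sum>j\<in>UNIV. of_real (a0 $ j) * (CLINT x|\<nu>\<eta> j. f x))
      + (CLINT \<theta>|F. CLINT x|\<kappa> \<theta>. f x)"
  unfolding \<mu>_def
  by (rule integral_mixture_measure[OF sets_distr sets_distr law_measurable_F a0_nonneg f(1) f(2)[unfolded \<mu>_def] f(3,4)]; assumption)+

lemma emeasure_\<mu>_orthant:
  assumes A: "A \<in> sets borel"
  shows "emeasure \<mu> A = (\<Sum>j\<in>UNIV. ennreal (a0 $ j) * emeasure (\<nu>\<eta> j) A)
      + (\<integral>\<^sup>+ \<theta>\<in>nonneg_orthant. emeasure (distr M borel (multi_time L \<theta>)) A \<partial>F)"
proof -
  have "(\<integral>\<^sup>+ \<theta>. emeasure (\<kappa> \<theta>) A \<partial>F) =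
      (\<integral>\<^sup>+ \<theta>\<in>nonneg_orthant. emeasure (distr M borel (multi_time L \<theta>)) A \<partial>F)"
    using F_orthant by (intro nn_integral_cong_AE) (auto elim!: eventually_mono simp: pos_id)
  then show ?thesis using emeasure_\<mu>[OF A] by simp
qed

text \<open>The first part of \<open>\<mu>\<close> inherits integrability from the \<open>\<nu>\<^sub>j\<close>, and the second has it since
\<open>E min 1 |L(\<theta>)|\<^sup>2\<close> is at most a multiple of the \<open>F\<close>-integrable function \<open>min 1 |\<theta>|\<close>.\<close>

lemma levy_measure_\<mu>: "levy_measure (prod_space H) \<mu>"
  unfolding levy_measure_def
proof (intro conjI)
  show "sets \<mu> = sets borel" by simp
  have P: "prod_space H \<in> sets borel" by (intro borel_closed closed_prod_space H_closed)
  have "emeasure \<mu> (- prod_space H) = 0"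
  proof -
    have "emeasure (\<nu>\<eta> j) (- prod_space H) = 0" for j
    proof -
      have "AE x in \<nu> j. axis j x \<in> prod_space H"
        using levy_measureD(2)[OF L_charD(4)] subspace_0[OF H_subspace]
        by (auto elim!: eventually_mono simp: prod_space_def axis_def)
      then have "AE x in \<nu>\<eta> j. x \<in> prod_space H"
        using P by (subst AE_distr_iff[OF axis_measurable]) auto
      then show ?thesis using P by (subst (asm) AE_iff_measurable[OF _ refl]) (auto simp: Compl_eq)
    qed
    moreover have "emeasure (\<kappa> \<theta>) (- prod_space H) = 0" for \<theta>
    proof -
      have "L\<theta> \<theta> -` (- prod_space H) \<inter> space M = {}" using L\<theta>_in_prod_space by auto
      then show ?thesis using P L\<theta>_measurable1 by (subst emeasure_distr) auto
    qed
    ultimately show ?thesis using P by (subst emeasure_\<mu>) auto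
  qed
  then show "AE x in \<mu>. x \<in> prod_space H"
    using P by (intro AE_I[of _ _ "- prod_space H"]) auto
  obtain K where K: "0 \<le> K" "\<And>\<theta>. \<theta> \<in> nonneg_orthant \<Longrightarrow>
    m2 \<theta> \<le> K * min 1 (norm \<theta>)" using L\<theta>_second_moment_bound by blast
  have f: "(\<lambda>x :: 'h ^ 'd. ennreal (min 1 ((norm x)\<^sup>2))) \<in> borel_measurable borel" by measurable
  have 1: "(\<integral>\<^sup>+ x. ennreal (min 1 ((norm x)\<^sup>2)) \<partial>\<nu>\<eta> j) =
      (\<integral>\<^sup>+ x. ennreal (min 1 ((norm x)\<^sup>2)) \<partial>\<nu> j)" for j
    using f by (subst nn_integral_distr[OF axis_measurable]) (simp_all add: norm_axis)
  have "(\<integral>\<^sup>+ \<theta>. \<integral>\<^sup>+ x. ennreal (min 1 ((norm x)\<^sup>2)) \<partial>\<kappa> \<theta> \<partial>F) \<le>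
      (\<integral>\<^sup>+ \<theta>. ennreal (K * min 1 (norm \<theta>)) \<partial>F)"
  proof (rule nn_integral_mono_AE)
    show "AE \<theta> in F. (\<integral>\<^sup>+ x. ennreal (min 1 ((norm x)\<^sup>2)) \<partial>\<kappa> \<theta>) \<le> ennreal (K * min 1 (norm \<theta>))"
      using F_orthant
    proof eventually_elim
      fix \<theta> :: "real ^ 'd" assume \<theta>: "\<theta> \<in> nonneg_orthant"
      have "(\<integral>\<^sup>+ x. ennreal (min 1 ((norm x)\<^sup>2)) \<partial>\<kappa> \<theta>) = (\<integral>\<^sup>+ \<omega>. ennreal (min 1 ((norm (L\<theta> \<theta> \<omega>))\<^sup>2)) \<partial>M)"
        using f by (subst nn_integral_distr[OF L\<theta>_measurable1]) simp_all
      also have "\<dots> = ennreal (m2 \<theta>)"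
        using L\<theta>_measurable1[of \<theta>] by (intro nn_integral_eq_integral integrable_const_bound[where B = 1]) auto
      also have "\<dots> \<le> ennreal (K * min 1 (norm \<theta>))" by (intro ennreal_leI K(2) \<theta>)
      finally show "(\<integral>\<^sup>+ x. ennreal (min 1 ((norm x)\<^sup>2)) \<partial>\<kappa> \<theta>) \<le> ennreal (K * min 1 (norm \<theta>))" .
    qed
  qed
  also have "\<dots> < \<infinity>"
  proof -
    have "integrable F (\<lambda>\<theta>. K * min 1 (norm \<theta>))"
      using integrable_min_1_norm[OF \<Theta>_charD(4) F_orthant F_trunc] by simp
    then show ?thesis using K(1) by (subst nn_integral_eq_integral) auto
  qed
  finally have 2: "(\<integral>\<^sup>+ \<theta>. \<integral>\<^sup>+ x. ennreal (min 1 ((norm x)\<^sup>2)) \<partial>\<kappa> \<theta> \<partial>F) < \<infinity>" .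
  have "(\<integral>\<^sup>+ x. ennreal (min 1 ((norm x)\<^sup>2)) \<partial>\<nu> j) < \<infinity>" for j
    using L_charD(4)[of j] by (simp add: levy_measure_def)
  with 2 show "(\<integral>\<^sup>+ x. ennreal (min 1 ((norm x)\<^sup>2)) \<partial>\<mu>) < \<infinity>"
    unfolding nn_integral_\<mu>[OF f] 1 by (auto simp: ennreal_mult_less_top)
qed

text \<open>Integrated over \<open>\<nu>\<^sub>j\<close>, the Levy--Khintchine integrand produces the jump part of \<open>a\<^sub>0\<^sub>j \<psi>\<^sub>j\<close>; integrated over the
law of \<open>L(\<theta>)\<close>, it produces \<open>E e\<^bsup>i\<langle>u|L(\<theta>)\<rangle>\<^esup> - 1\<close> minus a drift term, which the second summand of \<open>\<beta>\<close>
compensates.\<close>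

lemma exponent_X:
  assumes u: "u \<in> prod_space H"
  shows "levy_exponent \<beta> \<Gamma> \<mu> u = (\<Sum>j\<in>UNIV. \<psi> u j * of_real (a0 $ j))
    + (CLINT \<theta>|F. exp (\<Psi> u \<theta>) - 1)"
proof -
  define g where "g x = iexp (u \<bullet> x) - 1 - \<i> * of_real (u \<bullet> trunc x)" for x
  have g_m: "g \<in> borel_measurable borel" unfolding g_def[abs_def] by measurable
  have g_axis: "g (axis j x) = iexp (u $ j \<bullet> x) - 1 - \<i> * of_real (u $ j \<bullet> trunc x)" for j x
    unfolding g_def trunc_axis inner_axis ..
  have g_\<nu>: "integrable (\<nu>\<eta> j) g" for j
    unfolding integrable_distr_eq[OF axis_measurable g_m] g_axis
    by (rule levy_integrand_integrable[OF L_charD(4)])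
  have g_\<mu>: "integrable \<mu> g"
    unfolding g_def[abs_def] by (rule levy_integrand_integrable[OF levy_measure_\<mu>])
  have g_\<kappa>: "integrable (\<kappa> \<theta>) g" for \<theta>
  proof -
    have "integrable M (\<lambda>\<omega>. g (L\<theta> (pos \<theta>) \<omega>))"
      unfolding g_def by (rule integrand_L\<theta>(1)[OF pos_orthant u])
    then show ?thesis
      unfolding integrable_distr_eq[OF L\<theta>_measurable1 g_m] by (simp add: pos_id[OF pos_orthant])
  qed
  let ?E = "\<lambda>\<theta>. exp (\<Psi> u \<theta>) - 1"
  have E_int: "integrable F ?E"
    by (rule multivariate_subordinator_laplace(1)[OF prob_space_axioms \<Theta>_char \<Theta>_orthant F_orthant F_trunc a0_eq Re_\<psi>[OF u] order_refl])
  have "(CLINT x|\<mu>. g x) = (\<Sum>j\<in>UNIV. of_real (a0 $ j) * (CLINT x|\<nu>\<eta> j. g x))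
      + (CLINT \<theta>|F. CLINT x|\<kappa> \<theta>. g x)"
    by (rule integral_\<mu>(2)[OF g_m g_\<mu> g_\<nu> g_\<kappa>])
  also have "(CLINT \<theta>|F. CLINT x|\<kappa> \<theta>. g x) = (CLINT \<theta>|F. ?E \<theta> - \<i> * of_real (u \<bullet> drift \<theta>))"
  proof (rule integral_cong_AE)
    show "(\<lambda>\<theta>. CLINT x|\<kappa> \<theta>. g x) \<in> borel_measurable F"
      using integral_\<mu>(1)[OF g_m g_\<mu> g_\<nu> g_\<kappa>] by simp
    show "(\<lambda>\<theta>. ?E \<theta> - \<i> * of_real (u \<bullet> drift \<theta>)) \<in> borel_measurable F"
      using E_int drift_integrable by (intro borel_measurable_integrable) simp
    show "AE \<theta> in F. (CLINT x|\<kappa> \<theta>. g x) = ?E \<theta> - \<i> * of_real (u \<bullet> drift \<theta>)"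
      using F_orthant
    proof eventually_elim
      fix \<theta> :: "real ^ 'd" assume \<theta>: "\<theta> \<in> nonneg_orthant"
      have "(CLINT x|\<kappa> \<theta>. g x) = (CLINT \<omega>|M. g (L\<theta> \<theta> \<omega>))"
        by (rule integral_distr[OF L\<theta>_measurable1 g_m])
      then show "(CLINT x|\<kappa> \<theta>. g x) = ?E \<theta> - \<i> * of_real (u \<bullet> drift \<theta>)"
        unfolding g_def using integrand_L\<theta>(2)[OF \<theta> u] by simp
    qed
  qed
  also have "\<dots> = (CLINT \<theta>|F. ?E \<theta>) - \<i> * of_real (u \<bullet> (LINT \<theta>|F. drift \<theta>))"
    using E_int drift_integrable by simp
  finally have I: "(CLINT x|\<mu>. g x) =
      (\<Sum>j\<in>UNIV. of_real (a0 $ j) * (CLINT x|\<nu> j. g (axis j x)))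
      + ((CLINT \<theta>|F. ?E \<theta>) - \<i> * of_real (u \<bullet> (LINT \<theta>|F. drift \<theta>)))"
    by (simp add: integral_distr[OF axis_measurable g_m])
  have S: "(\<Sum>j\<in>UNIV. \<psi> u j * of_real (a0 $ j)) =
      \<i> * of_real (u \<bullet> (\<chi> j. a0 $ j *\<^sub>R b j)) - of_real (\<Gamma> u \<bullet> u) / 2
      + (\<Sum>j\<in>UNIV. of_real (a0 $ j) * (CLINT x|\<nu> j. g (axis j x)))"
    unfolding \<psi>_def levy_exponent_def g_axis \<Gamma>_def inner_vec_def
    by (simp add: sum_distrib_left sum_divide_distrib sum_subtractf[symmetric] sum.distrib[symmetric] algebra_simps)
  show ?thesis
    unfolding S levy_exponent_def g_def[symmetric] I \<beta>_def by (simp add: inner_add_right algebra_simps)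
qed

text \<open>Decoupling replaces \<open>\<Theta>(t)\<close> by an independent copy; given that copy the expectation over \<open>L\<close> is known,
and what remains is the Laplace transform of \<open>\<Theta>(t)\<close>.\<close>

lemma char_X:
  assumes t: "0 \<le> t" and u: "u \<in> prod_space H"
  shows "(CLINT \<omega>|M. iexp (u \<bullet> X t \<omega>)) = exp (of_real t * levy_exponent \<beta> \<Gamma> \<mu> u)"
proof -
  define f where "f p = iexp (u \<bullet> L\<theta> (\<Theta> t (snd p)) (fst p))" for p
  note [measurable] = L\<theta>_\<Theta>_measurable_path[OF t]
  have f_m: "f \<in> borel_measurable (path_L \<Otimes>\<^sub>M path_\<Theta>)" unfolding f_def by measurable
  have "(CLINT \<omega>|M. iexp (u \<bullet> X t \<omega>)) = (CLINT \<omega>|M. f (\<omega>, \<omega>))"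
    unfolding f_def using X_eq t by (intro Bochner_Integration.integral_cong) auto
  also have "\<dots> = (CLINT \<omega>'|M. CLINT \<omega>|M. f (\<omega>, \<omega>'))"
    using L_\<Theta>_indep f_m by (intro decoupling_integral[of path_L path_\<Theta> f 1]) (simp_all add: process_sigma_eq f_def)
  also have "\<dots> = (CLINT \<omega>'|M. exp (\<Sum>j\<in>UNIV. \<psi> u j * of_real (\<Theta> t \<omega>' $ j)))"
    unfolding f_def using char_L\<theta>[OF \<Theta>_orthant[OF _ t] u] by (intro Bochner_Integration.integral_cong) auto
  also have "\<dots> = exp (of_real t * levy_exponent \<beta> \<Gamma> \<mu> u)"
    unfolding exponent_X[OF u]
    by (rule multivariate_subordinator_laplace(2)[OF prob_space_axioms \<Theta>_char \<Theta>_orthant F_orthant F_trunc a0_eq Re_\<psi>[OF u] t])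
  finally show ?thesis .
qed

lemma \<beta>_in_prod_space: "\<beta> \<in> prod_space H"
proof -
  obtain B where B: "orthonormal_basis_on (prod_space H) B" by (rule prod_space_basis)
  have "(LINT \<theta>|F. drift \<theta>) \<in> prod_space H"
    by (rule integral_in_closed_subspace[OF subspace_prod B drift_integrable]) (simp add: drift_in_prod_space)
  moreover have "(\<chi> j. a0 $ j *\<^sub>R b j) \<in> prod_space H"
    using subspace_scale[OF H_subspace L_charD(2)] by (simp add: prod_space_def)
  ultimately show ?thesis unfolding \<beta>_def by (intro subspace_add[OF subspace_prod])
qed

proposition levy_characteristics_X: "levy_characteristics M (prod_space H) X \<beta> \<Gamma> \<mu>"
  unfolding levy_characteristics_def
proof (intro conjI allI impI ballI)
  show "covariance_operator (prod_space H) \<Gamma>"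
    unfolding \<Gamma>_def[abs_def]
    by (intro covariance_operator_coordinatewise H_subspace H_closed L_charD(3) a0_nonneg)
qed (use levy_process_X \<beta>_in_prod_space levy_measure_\<mu> char_X in \<open>simp_all add: levy_exponent_def\<close>)

lemma drift_set_integral:
  "set_integrable F nonneg_orthant (\<lambda>\<theta>. LINT \<omega>|M. trunc (multi_time L \<theta> \<omega>))"
  "(LINT \<theta>:nonneg_orthant|F. LINT \<omega>|M. trunc (multi_time L \<theta> \<omega>)) = (LINT \<theta>|F. drift \<theta>)"
proof -
  have eq: "indicator nonneg_orthant \<theta> *\<^sub>R (LINT \<omega>|M. trunc (multi_time L \<theta> \<omega>)) =
      indicator nonneg_orthant \<theta> *\<^sub>R drift \<theta>" for \<theta>
    by (cases "\<theta> \<in> nonneg_orthant") (simp_all add: drift_def pos_id)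
  have "integrable F (\<lambda>\<theta>. indicator nonneg_orthant \<theta> *\<^sub>R drift \<theta>)"
    using drift_integrable nonneg_orthant_measurable F_sets by (intro integrable_mult_indicator) auto
  then show int: "set_integrable F nonneg_orthant (\<lambda>\<theta>. LINT \<omega>|M. trunc (multi_time L \<theta> \<omega>))"
    unfolding set_integrable_def eq .
  then show "(LINT \<theta>:nonneg_orthant|F. LINT \<omega>|M. trunc (multi_time L \<theta> \<omega>)) = (LINT \<theta>|F. drift \<theta>)"
    unfolding set_lebesgue_integral_def set_integrable_def eq
    using F_orthant drift_integrable by (intro integral_cong_AE) (auto elim!: eventually_mono)
qed

end

theorem theorem2p4:
  fixes M :: "'w measure"
    and H :: "'d::finite \<Rightarrow> 'h::{real_inner, banach, second_countable_topology} set"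
    and L :: "'d \<Rightarrow> real \<Rightarrow> 'w \<Rightarrow> 'h"
    and b :: "'d \<Rightarrow> 'h" and Q :: "'d \<Rightarrow> 'h \<Rightarrow> 'h" and \<nu> :: "'d \<Rightarrow> 'h measure"
    and \<Theta> :: "real \<Rightarrow> 'w \<Rightarrow> real ^ 'd"
    and a a0 :: "real ^ 'd" and F :: "(real ^ 'd) measure"
    and X :: "real \<Rightarrow> 'w \<Rightarrow> 'h ^ 'd"
    and \<beta> :: "'h ^ 'd" and \<Gamma> :: "'h ^ 'd \<Rightarrow> 'h ^ 'd"
  assumes "prob_space M"
    and "\<And>j. subspace (H j)" and "\<And>j. closed (H j)"
    and "\<And>j. levy_characteristics M (H j) (L j) (b j) (Q j) (\<nu> j)"
    and "prob_space.indep_sets M (\<lambda>j. process_sigma M (L j)) UNIV"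
    and "levy_characteristics M UNIV \<Theta> a (\<lambda>_. 0) F"
    and "\<And>j. subordinator M (\<lambda>t \<omega>. \<Theta> t \<omega> $ j)"
    and "prob_space.indep_set M
           (process_sigma M (\<lambda>t \<omega>. \<chi> j. L j t \<omega>)) (process_sigma M \<Theta>)"
    and "AE \<theta> in F. \<theta> \<in> nonneg_orthant"
    and "set_integrable F nonneg_orthant trunc"
    and "a0 = a - (LINT \<theta>:nonneg_orthant|F. trunc \<theta>)"
    and "a0 \<in> nonneg_orthant"
    and "X = (\<lambda>t \<omega>. multi_time L (\<Theta> t \<omega>) \<omega>)"
    and "\<beta> = (\<chi> j. a0 $ j *\<^sub>R b j)
           + (LINT \<theta>:nonneg_orthant|F. LINT \<omega>|M. trunc (multi_time L \<theta> \<omega>))"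
    and "\<Gamma> = (\<lambda>u. \<chi> j. a0 $ j *\<^sub>R Q j (u $ j))"
  shows "set_integrable F nonneg_orthant (\<lambda>\<theta>. LINT \<omega>|M. trunc (multi_time L \<theta> \<omega>)) \<and>
    (\<exists>\<mu>. sets \<mu> = sets borel \<and>
         (\<forall>A\<in>sets borel. emeasure \<mu> A =
            (\<Sum>j\<in>UNIV. ennreal (a0 $ j) * emeasure (distr (\<nu> j) borel (axis j)) A)
            + (\<integral>\<^sup>+ \<theta>\<in>nonneg_orthant. emeasure (distr M borel (multi_time L \<theta>)) A \<partial>F)) \<and>
         levy_characteristics M (prod_space H) X \<beta> \<Gamma> \<mu>)"
proof -
  interpret subordinated_levy M H L b Q \<nu> \<Theta> a a0 F
    using assms(1-12) by (intro subordinated_levy.intro subordinated_levy_axioms.intro)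
  have X: "X = subordinated_levy.X L \<Theta>"
    unfolding assms(13) X_def[abs_def] ..
  have \<beta>: "\<beta> = subordinated_levy.\<beta> M L b a0 F"
    unfolding assms(14) \<beta>_def drift_set_integral(2) ..
  have \<Gamma>: "\<Gamma> = subordinated_levy.\<Gamma> Q a0"
    unfolding assms(15) \<Gamma>_def[abs_def] ..
  show ?thesis
    unfolding X \<beta> \<Gamma>
    using drift_set_integral(1) emeasure_\<mu>_orthant levy_characteristics_X \<mu>_sets by blast
qed

end
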